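(* There is an algorithm which, given a rooted tree $T$ with $n$ nodes and nonnegative real node weights, and an integer $K \ge 1$, computes maximum-entropy $k$-node summary trees of $T$ (and their entropies) for every $k$ with $1 \le k \le \min\{K,n\}$, in time $O(K^2 n + n \log n)$ in a real-arithmetic model of computation (in which arithmetic operations and logarithms on reals take unit time).
   Context: Let $T$ have nonnegative real weights $w_v$ and total weight $W>0$. For a node $v$, $T_v$ is the subtree rooted at $v$ and $V(T_v)$ its node set. Summary trees are trees whose nodes are labeled by sets of nodes of $T$, defined recursively. If $T_v$ has one node, the only summary tree for $T_v$ is $\{v\}$. Otherwise a summary tree for $T_v$ is one of: (1) the one-node tree $V(T_v)$; (2) a root $\{v\}$ together with, for each child $x$ of $v$, a summary tree for $T_x$ whose root is made a child of $\{v\}$; (3) a root $\{v\}$, a child node $other_v$ representing a non-empty subset $U_v$ of the children of $v$ together with all their descendants (the node $\bigcup_{x\in U_v} V(T_x)$), and for each child $x\notin U_v$ a summary tree for $T_x$ whose root is made a child of $\{v\}$. A summary tree of $T$ is a summary tree for $T_r$, $r$ the root; a $k$-node summary tree has exactly $k$ nodes. The weight of a summary-tree node is the sum of the weights of the nodes of $T$ it represents, and the entropy of a summary tree with node weights $W_1,\ldots,W_k$ is $-\sum_i p_i\lg p_i$, $p_i = W_i/W$ (with $0 \lg 0 = 0$). *)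

theory Defs
  imports Complex_Main
begin

section \<open>Rooted trees and summary trees\<close>

text \<open>Children are stored in a list, but nothing below depends on their order.\<close>

datatype (nodes: 'a) rtree = Node (root: 'a) (subtrees: "'a rtree list")
  for map: map_rtree

fun node_list :: "'a rtree \<Rightarrow> 'a list" where
  "node_list (Node v ts) = v # concat (map node_list ts)"

text \<open>Pairs (child, parent):\<close>

fun edges :: "'a rtree \<Rightarrow> ('a \<times> 'a) set" where
  "edges (Node v ts) = (\<Union>t\<in>set ts. insert (root t, v) (edges t))"

text \<open>In rule \<open>other\<close>, \<open>U\<close> is the set of positions (in the list \<open>ts\<close>) of the children that are
  merged. For a one-node tree only rule \<open>collapse\<close> applies, and its label is then \<open>{v}\<close>.\<close>

inductive summary_tree :: "'a rtree \<Rightarrow> 'a set rtree \<Rightarrow> bool" where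
  collapse: "summary_tree T (Node (nodes T) [])"
| expand: "ts \<noteq> [] \<Longrightarrow> list_all2 summary_tree ts ss \<Longrightarrow>
    summary_tree (Node v ts) (Node {v} ss)"
| other: "U \<noteq> {} \<Longrightarrow> U \<subseteq> {..<length ts} \<Longrightarrow> list_all2 summary_tree (nths ts (- U)) ss \<Longrightarrow>
    summary_tree (Node v ts) (Node {v} (Node (\<Union>i\<in>U. nodes (ts ! i)) [] # ss))"

definition num_nodes :: "'a rtree \<Rightarrow> nat" where
  "num_nodes T = length (node_list T)"

text \<open>The convention \<open>0 lg 0 = 0\<close> holds automatically because of the factor 0.\<close>

definition entropy :: "('a \<Rightarrow> real) \<Rightarrow> 'a rtree \<Rightarrow> 'a set rtree \<Rightarrow> real" where
  "entropy w T S = - (\<Sum>X\<leftarrow>node_list S. let p = sum w X / sum w (nodes T) in p * log 2 p)"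

definition max_entropy_summary_tree ::
  "('a \<Rightarrow> real) \<Rightarrow> 'a rtree \<Rightarrow> nat \<Rightarrow> 'a set rtree \<Rightarrow> bool" where
  "max_entropy_summary_tree w T k S \<longleftrightarrow>
     is_arg_max (entropy w T) (\<lambda>S. summary_tree T S \<and> num_nodes S = k) S"


section \<open>A real random access machine\<close>

text \<open>
  Programs of a small imperative language act on two kinds of memory: arrays of natural numbers
  and arrays of real numbers, each identified by a name. A scalar variable is an array that is only
  used at index 0. Array indices are natural-number expressions, so there is indirect addressing.
  Natural numbers are only added, subtracted (truncating at 0) and compared, so that the unit-cost
  measure is not abused by packing data into large integers. On reals there are the four
  arithmetic operations and the binary logarithm, each exact. Reals influence naturals and the
  control flow through comparisons only: there is no conversion (in particular no rounding) from
  reals to naturals. The only real literals are the integers.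

  Division and logarithm are total as in HOL. As a program can test its arguments beforehand,
  this makes no difference.
\<close>

type_synonym name = string

datatype nexp =
    NConst nat
  | NGet name nexp
  | NAdd nexp nexp
  | NSub nexp nexp

datatype rexp =
    RConst int
  | RGet name nexp
  | RAdd rexp rexp
  | RSub rexp rexp
  | RMul rexp rexp
  | RDiv rexp rexp
  | RLog rexp

datatype bexp =
    NLess nexp nexp
  | RLess rexp rexp
  | Not bexp
  | And bexp bexp

datatype com =
    Skip
  | NSet name nexp nexp  \<comment> \<open>array, index, new value\<close>
  | RSet name nexp rexp
  | Seq com com
  | If bexp com com
  | While bexp com

record state =
  nmem :: "name \<Rightarrow> nat \<Rightarrow> nat"
  rmem :: "name \<Rightarrow> nat \<Rightarrow> real"

primrec nval :: "nexp \<Rightarrow> state \<Rightarrow> nat" where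
  "nval (NConst c) s = c"
| "nval (NGet a i) s = nmem s a (nval i s)"
| "nval (NAdd e f) s = nval e s + nval f s"
| "nval (NSub e f) s = nval e s - nval f s"

primrec rval :: "rexp \<Rightarrow> state \<Rightarrow> real" where
  "rval (RConst c) s = of_int c"
| "rval (RGet a i) s = rmem s a (nval i s)"
| "rval (RAdd e f) s = rval e s + rval f s"
| "rval (RSub e f) s = rval e s - rval f s"
| "rval (RMul e f) s = rval e s * rval f s"
| "rval (RDiv e f) s = rval e s / rval f s"
| "rval (RLog e) s = log 2 (rval e s)"

primrec bval :: "bexp \<Rightarrow> state \<Rightarrow> bool" where
  "bval (NLess e f) s \<longleftrightarrow> nval e s < nval f s"
| "bval (RLess e f) s \<longleftrightarrow> rval e s < rval f s"
| "bval (Not b) s \<longleftrightarrow> \<not> bval b s"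
| "bval (And b c) s \<longleftrightarrow> bval b s \<and> bval c s"

text \<open>Every literal, memory access, arithmetic operation, logarithm, comparison and Boolean
  operation takes unit time.\<close>

primrec ncost :: "nexp \<Rightarrow> nat" where
  "ncost (NConst c) = 1"
| "ncost (NGet a i) = ncost i + 1"
| "ncost (NAdd e f) = ncost e + ncost f + 1"
| "ncost (NSub e f) = ncost e + ncost f + 1"

primrec rcost :: "rexp \<Rightarrow> nat" where
  "rcost (RConst c) = 1"
| "rcost (RGet a i) = ncost i + 1"
| "rcost (RAdd e f) = rcost e + rcost f + 1"
| "rcost (RSub e f) = rcost e + rcost f + 1"
| "rcost (RMul e f) = rcost e + rcost f + 1"
| "rcost (RDiv e f) = rcost e + rcost f + 1"
| "rcost (RLog e) = rcost e + 1"

primrec bcost :: "bexp \<Rightarrow> nat" where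
  "bcost (NLess e f) = ncost e + ncost f + 1"
| "bcost (RLess e f) = rcost e + rcost f + 1"
| "bcost (Not b) = bcost b + 1"
| "bcost (And b c) = bcost b + bcost c + 1"

definition nupd :: "name \<Rightarrow> nat \<Rightarrow> nat \<Rightarrow> state \<Rightarrow> state" where
  "nupd a i x s = s\<lparr>nmem := (nmem s)(a := (nmem s a)(i := x))\<rparr>"

definition rupd :: "name \<Rightarrow> nat \<Rightarrow> real \<Rightarrow> state \<Rightarrow> state" where
  "rupd a i x s = s\<lparr>rmem := (rmem s)(a := (rmem s a)(i := x))\<rparr>"

text \<open>\<open>exec c s t s'\<close>: started in state \<open>s\<close>, program \<open>c\<close> halts in state \<open>s'\<close> after time \<open>t\<close>.\<close>

inductive exec :: "com \<Rightarrow> state \<Rightarrow> nat \<Rightarrow> state \<Rightarrow> bool" where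
  Skip: "exec Skip s 1 s"
| NSet: "exec (NSet a i e) s (ncost i + ncost e + 1) (nupd a (nval i s) (nval e s) s)"
| RSet: "exec (RSet a i e) s (ncost i + rcost e + 1) (rupd a (nval i s) (rval e s) s)"
| Seq: "exec c1 s t1 s1 \<Longrightarrow> exec c2 s1 t2 s2 \<Longrightarrow> exec (Seq c1 c2) s (t1 + t2) s2"
| IfTrue: "bval b s \<Longrightarrow> exec c1 s t s' \<Longrightarrow> exec (If b c1 c2) s (bcost b + t) s'"
| IfFalse: "\<not> bval b s \<Longrightarrow> exec c2 s t s' \<Longrightarrow> exec (If b c1 c2) s (bcost b + t) s'"
| WhileFalse: "\<not> bval b s \<Longrightarrow> exec (While b c) s (bcost b) s"
| WhileTrue: "bval b s \<Longrightarrow> exec c s t1 s1 \<Longrightarrow> exec (While b c) s1 t2 s2 \<Longrightarrow>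
    exec (While b c) s (bcost b + t1 + t2) s2"

inductive_cases SkipE: "exec Skip s t s'"
inductive_cases NSetE: "exec (NSet a i e) s t s'"
inductive_cases RSetE: "exec (RSet a i e) s t s'"
inductive_cases SeqE: "exec (Seq c1 c2) s t s'"
inductive_cases IfE: "exec (If b c1 c2) s t s'"
inductive_cases WhileE: "exec (While b c) s t s'"

lemma exec_deterministic:
  "exec c s t s' \<Longrightarrow> exec c s u s'' \<Longrightarrow> t = u \<and> s' = s''"
proof (induction arbitrary: u s'' rule: exec.induct)
  case Skip then show ?case by (auto elim: SkipE)
next
  case NSet then show ?case by (auto elim: NSetE)
next
  case RSet then show ?case by (auto elim: RSetE)
next
  case Seq from Seq.prems show ?case by (rule SeqE) (use Seq.IH in blast)
next
  case IfTrue from IfTrue.prems show ?case by (rule IfE) (use IfTrue in blast)+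
next
  case IfFalse from IfFalse.prems show ?case by (rule IfE) (use IfFalse in blast)+
next
  case WhileFalse then show ?case by (auto elim: WhileE)
next
  case WhileTrue from WhileTrue.prems show ?case by (rule WhileE) (use WhileTrue in blast)+
qed


section \<open>Input and output conventions\<close>

text \<open>The node numbering is arbitrary; the root is its own entry in the array of parents.\<close>

definition parent_array :: "nat \<Rightarrow> (nat \<Rightarrow> nat) \<Rightarrow> nat rtree \<Rightarrow> bool" where
  "parent_array n p T \<longleftrightarrow>
     distinct (node_list T) \<and> nodes T = {..<n} \<and>
     p (root T) = root T \<and> (\<forall>(x, v)\<in>edges T. p x = v)"

text \<open>Memory not mentioned here has arbitrary initial contents.\<close>

definition input :: "nat \<Rightarrow> nat rtree \<Rightarrow> (nat \<Rightarrow> real) \<Rightarrow> nat \<Rightarrow> state \<Rightarrow> bool" where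
  "input n T w K s \<longleftrightarrow>
     nmem s ''n'' 0 = n \<and> nmem s ''K'' 0 = K \<and>
     parent_array n (nmem s ''parent'') T \<and>
     (\<forall>v<n. rmem s ''weight'' v = w v)"

text \<open>The nodes of a \<open>k\<close>-node summary tree are numbered from 0 to \<open>k - 1\<close>. Row \<open>k\<close> of the array
  \<open>block\<close> gives, for each node of the input tree, the number of the summary tree node containing it,
  and row \<open>k\<close> of \<open>sparent\<close> is the parent array of the numbered summary tree. Rows have length \<open>n\<close>.\<close>

definition output_tree :: "nat \<Rightarrow> nat \<Rightarrow> nat set rtree \<Rightarrow> state \<Rightarrow> bool" where
  "output_tree n k S s \<longleftrightarrow>
     (\<exists>N. parent_array k (\<lambda>j. nmem s ''sparent'' (k * n + j)) N \<and>
          S = map_rtree (\<lambda>j. {v. v < n \<and> nmem s ''block'' (k * n + v) = j}) N)"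

end

theory Submission
  imports Defs
begin

text \<open>
  Fix an order of the children of a node by decreasing weight. By concavity of \<open>- x lg x\<close> one may
  exchange subtrees between \<open>other\<close> and the remaining children without losing entropy until at most
  one child in \<open>other\<close> is heavier than some child outside it: a collapsed child outside is swapped
  with a heavier one in \<open>other\<close>, and if two children in \<open>other\<close> are heavier than a child \<open>x\<close> outside,
  one of them is pulled out and the summary tree of \<open>x\<close> is shrunk by one node. So the children
  outside \<open>other\<close> are the \<open>j\<close> heaviest ones for some \<open>j\<close>, possibly without one of them. For each
  choice of the exception a knapsack over the at most \<open>K\<close> heaviest children yields the optimum.
  Merging tables for \<open>a\<close> and \<open>b\<close> nodes costs \<open>min K a * min K b\<close>, which adds up to \<open>O(K n)\<close> over the
  whole tree, hence to \<open>O(K\<^sup>2 n)\<close> for all exceptions. The \<open>K\<close> heaviest children are kept in a list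
  by insertion, so that no complete sorting is necessary.
\<close>

section \<open>Entropy terms\<close>

text \<open>Pulling a child y out of \<open>other\<close> has to be paid by shrinking the summary
  tree of x by one node, although nothing is known about that tree except its optimality. The cost
  is nevertheless at most \<open>split_gain W s s\<close>, with s the weight of the subtree at x: a
  node can be saved by uniting two disjoint blocks, each of weight at most s, and the gain of a cut
  grows with both parts. Pulling y out gains the cut between y and the remainder of
  \<open>other\<close>; the remainder still holds a second child at least as heavy as x, so the gain
  covers the cost. With only one heavier child in \<open>other\<close> the remainder may be too
  light, which is why one exception survives.

  The exception costs a factor K over a plain tree knapsack. It is no more than that because, for a
  fixed exception, the prefixes of all lengths j share one pass: candidates are collected after
  every single merge.\<close>

definition eta :: "real \<Rightarrow> real \<Rightarrow> real" where
  "eta W x = - (x / W * log 2 (x / W))"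

text \<open>Convexity of x ln x in increment form: the derivative in b of the difference of both
  sides is ln (a' + b) - ln (a + b). The value a = 0 is kept apart because differentiation fails
  there at b = 0; it reduces to monotonicity of ln.\<close>

lemma xlnx_increment_mono:
  fixes a a' b :: real
  assumes "0 \<le> a" "a \<le> a'" "0 \<le> b"
  shows "a' * ln a' + (a + b) * ln (a + b) \<le> (a' + b) * ln (a' + b) + a * ln a"
proof (cases "a = 0")
  case True
  show ?thesis
  proof (cases "a' = 0 \<or> b = 0")
    case False
    then have "a' * ln a' \<le> a' * ln (a' + b)" "b * ln b \<le> b * ln (a' + b)"
      using assms by (auto intro!: mult_left_mono)
    then show ?thesis using True by (simp add: algebra_simps)
  qed (use True in auto)
next
  case False
  then have a: "0 < a" using assms by simp
  let ?g = "\<lambda>t. (a' + t) * ln (a' + t) - (a + t) * ln (a + t)"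
  have "?g 0 \<le> ?g b"
  proof (rule DERIV_nonneg_imp_nondecreasing[OF assms(3)])
    fix t assume t: "0 \<le> t" "t \<le> b"
    have "(?g has_real_derivative ln (a' + t) - ln (a + t)) (at t)"
      using a assms t by (auto intro!: derivative_eq_intros)
    moreover have "0 \<le> ln (a' + t) - ln (a + t)" using a assms t by simp
    ultimately show "\<exists>y. (?g has_real_derivative y) (at t) \<and> 0 \<le> y" by blast
  qed
  then show ?thesis by (simp add: algebra_simps)
qed

lemma eta_increment_antimono:
  assumes "0 < W" "0 \<le> a" "a \<le> a'" "0 \<le> b"
  shows "eta W (a' + b) + eta W a \<le> eta W a' + eta W (a + b)"
proof -
  define g :: "real \<Rightarrow> real" where "g y = y * ln y" for y
  have eta: "eta W x = - (g (x / W) / ln 2)" for x by (simp add: eta_def log_def g_def)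
  have "g (a' / W) + g ((a + b) / W) \<le> g ((a' + b) / W) + g (a / W)"
    unfolding g_def add_divide_distrib
    using assms by (intro xlnx_increment_mono) (auto intro: divide_right_mono)
  then have "(g (a' / W) + g ((a + b) / W)) / ln 2 \<le> (g ((a' + b) / W) + g (a / W)) / ln 2"
    by (intro divide_right_mono) auto
  then show ?thesis unfolding eta add_divide_distrib by linarith
qed

text \<open>Entropy gained by cutting a block of weight a + b into blocks of weights a and b. The
  cost of removing a node and the gain of pulling a child out of \<open>other\<close> are both
  expressed by it, so that monotonicity can compare them.\<close>

definition split_gain :: "real \<Rightarrow> real \<Rightarrow> real \<Rightarrow> real" where
  "split_gain W a b = eta W a + eta W b - eta W (a + b)"

lemma split_gain_mono:
  assumes "0 < W" "0 \<le> a" "a \<le> a'" "0 \<le> b" "b \<le> b'"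
  shows "split_gain W a b \<le> split_gain W a' b'"
  using eta_increment_antimono[of W a a' b] eta_increment_antimono[of W b b' a'] assms
  by (simp add: split_gain_def add.commute)


section \<open>Summary trees with a given number of nodes\<close>

text \<open>The normalising weight \<open>W\<close> is a parameter: summary trees of a subtree are
  valued with the weight of the whole tree, and so their values add up over the children.\<close>

definition tree_value :: "real \<Rightarrow> ('a \<Rightarrow> real) \<Rightarrow> 'a set rtree \<Rightarrow> real" where
  "tree_value W w S = (\<Sum>X\<leftarrow>node_list S. eta W (sum w X))"

lemma entropy_eq_tree_value: "entropy w T S = tree_value (sum w (nodes T)) w S"
proof -
  have "- sum_list (map f xs) = sum_list (map (\<lambda>x. - f x) xs)" for f :: "'a set \<Rightarrow> real" and xs
    by (induction xs) auto
  then show ?thesis by (simp add: entropy_def tree_value_def eta_def Let_def)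
qed

abbreviation tree_weight :: "('a \<Rightarrow> real) \<Rightarrow> 'a rtree \<Rightarrow> real" where
  "tree_weight w t \<equiv> sum w (nodes t)"

lemma set_node_list [simp]: "set (node_list t) = nodes t"
  by (induction t) auto

lemma finite_nodes [simp]: "finite (nodes t)"
  by (metis List.finite_set set_node_list)

lemma root_in_nodes [simp]: "root t \<in> nodes t"
  by (cases t) auto

lemma num_nodes_Node: "num_nodes (Node v ts) = 1 + (\<Sum>t\<leftarrow>ts. num_nodes t)"
  by (simp add: num_nodes_def length_concat comp_def)

lemma num_nodes_pos [simp]: "0 < num_nodes t"
  by (cases t) (simp add: num_nodes_Node)

lemma tree_value_Node:
  "tree_value W w (Node v ts) = eta W (sum w v) + (\<Sum>t\<leftarrow>ts. tree_value W w t)"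
  by (induction ts) (auto simp: tree_value_def)

lemma distinct_concat_node_lists:
  assumes "distinct (concat (map node_list ts))"
  shows "distinct ts \<and> (\<forall>t\<in>set ts. distinct (node_list t)) \<and>
    (\<forall>t\<in>set ts. \<forall>t'\<in>set ts. t \<noteq> t' \<longrightarrow> nodes t \<inter> nodes t' = {})"
  using assms
proof (induction ts)
  case (Cons t ts)
  then have dis: "nodes t \<inter> nodes t' = {}" if "t' \<in> set ts" for t'
    using that by auto
  then have "t \<notin> set ts" using root_in_nodes[of t] by blast
  moreover have "distinct (concat (map node_list ts))" "distinct (node_list t)"
    using Cons.prems by auto
  ultimately show ?case using Cons.IH dis by (simp add: Int_commute)
qed simp

lemma distinct_node_list_NodeD:
  assumes "distinct (node_list (Node v ts))"
  shows "distinct ts" "\<And>t. t \<in> set ts \<Longrightarrow> v \<notin> nodes t"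
    "\<And>t. t \<in> set ts \<Longrightarrow> distinct (node_list t)"
    "\<And>t t'. t \<in> set ts \<Longrightarrow> t' \<in> set ts \<Longrightarrow> t \<noteq> t' \<Longrightarrow> nodes t \<inter> nodes t' = {}"
  using assms distinct_concat_node_lists[of ts] by auto

lemma sum_nodes_Union:
  assumes "distinct (node_list (Node v ts))" "A \<subseteq> set ts"
  shows "sum w (\<Union>t\<in>A. nodes t) = (\<Sum>t\<in>A. tree_weight w t)"
proof (rule sum.UNION_disjoint)
  show "\<forall>t\<in>A. \<forall>t'\<in>A. t \<noteq> t' \<longrightarrow> nodes t \<inter> nodes t' = {}"
    using assms(2) distinct_node_list_NodeD(4)[OF assms(1)] by blast
qed (use finite_subset[OF assms(2)] in auto)

lemma tree_weight_Node:
  assumes "distinct (node_list (Node v ts))"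
  shows "tree_weight w (Node v ts) = w v + (\<Sum>t\<in>set ts. tree_weight w t)"
proof -
  have "v \<notin> (\<Union>t\<in>set ts. nodes t)" using distinct_node_list_NodeD(2)[OF assms] by auto
  then show ?thesis using sum_nodes_Union[OF assms order.refl, of w] by simp
qed

text \<open>A summary tree in which the children of the root on which \<open>f\<close> is \<open>None\<close> are merged into
  the node \<open>other\<close> (absent if there are none).\<close>

definition assemble :: "'a \<Rightarrow> 'a rtree list \<Rightarrow> ('a rtree \<Rightarrow> 'a set rtree option) \<Rightarrow> 'a set rtree" where
  "assemble v ts f = Node {v}
     ((if \<exists>t\<in>set ts. f t = None then [Node (\<Union>t\<in>{t\<in>set ts. f t = None}. nodes t) []] else []) @
      map (\<lambda>t. the (f t)) (filter (\<lambda>t. f t \<noteq> None) ts))"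

lemma nths_cong_set: "(\<And>i. i < length xs \<Longrightarrow> i \<in> A \<longleftrightarrow> i \<in> B) \<Longrightarrow> nths xs A = nths xs B"
  unfolding nths_def by (intro arg_cong[where f = "map fst"] filter_cong) (auto simp: set_zip)

lemma summary_tree_assemble:
  assumes "\<And>t S. t \<in> set ts \<Longrightarrow> f t = Some S \<Longrightarrow> summary_tree t S"
  shows "summary_tree (Node v ts) (assemble v ts f)"
proof -
  have l: "list_all2 summary_tree (filter (\<lambda>t. f t \<noteq> None) ts)
      (map (\<lambda>t. the (f t)) (filter (\<lambda>t. f t \<noteq> None) ts))"
    using assms by (auto simp: list_all2_map2 list_all2_same)
  show ?thesis
  proof (cases "\<exists>t\<in>set ts. f t = None")
    case True
    define U where "U = {i. i < length ts \<and> f (ts ! i) = None}"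
    have "nths ts (- U) = filter (\<lambda>t. f t \<noteq> None) ts"
      unfolding filter_eq_nths by (rule nths_cong_set) (auto simp: U_def)
    moreover have "(\<Union>t\<in>{t\<in>set ts. f t = None}. nodes t) = (\<Union>i\<in>U. nodes (ts ! i))"
      by (auto simp: U_def in_set_conv_nth)
    moreover have "U \<noteq> {}" using True by (auto simp: U_def in_set_conv_nth)
    ultimately show ?thesis
      using True l by (auto simp: assemble_def U_def intro!: summary_tree.other)
  next
    case False
    then have all: "filter (\<lambda>t. f t \<noteq> None) ts = ts" by (auto simp: filter_id_conv)
    show ?thesis
    proof (cases "ts = []")
      case True
      \<comment> \<open>A leaf is outside the scope of rule \<open>expand\<close>, but collapsing it
        yields the same tree with label \<open>{v}\<close>.\<close>
      then show ?thesis using summary_tree.collapse[of "Node v []"] by (simp add: assemble_def)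
    next
      case ne: False
      show ?thesis unfolding assemble_def using False l ne unfolding all
        by (auto intro!: summary_tree.expand)
    qed
  qed
qed

text \<open>Positions and aligned lists give way to a function on the children themselves.
  Distinctness of \<open>ts\<close> lets a child stand for its position, so that
  \<open>map_of\<close> of the zipped lists picks the right summary tree.\<close>

lemma summary_tree_cases:
  assumes "summary_tree (Node v ts) S" "distinct ts"
  obtains (collapse) "S = Node (nodes (Node v ts)) []"
  | (assemble) f where "\<And>t S'. t \<in> set ts \<Longrightarrow> f t = Some S' \<Longrightarrow> summary_tree t S'"
      "S = assemble v ts f"
  using assms(1)
proof cases
  case collapse
  then show ?thesis using that(1) by blast
next
  case (expand ss)
  define f where "f = map_of (zip ts ss)"
  have len: "length ss = length ts" using expand by (simp add: list_all2_lengthD)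
  have f: "f (ts ! i) = Some (ss ! i)" if "i < length ts" for i
    using that len assms(2) by (simp add: f_def map_of_zip_nth)
  then have none: "f t \<noteq> None" if "t \<in> set ts" for t
    using that by (metis in_set_conv_nth option.distinct(1))
  then have all: "filter (\<lambda>t. f t \<noteq> None) ts = ts" by (auto simp: filter_id_conv)
  have "map (\<lambda>t. the (f t)) ts = ss" using f len by (auto intro!: nth_equalityI)
  then have "S = assemble v ts f" using none expand all by (auto simp: assemble_def)
  moreover have "summary_tree t S'" if "t \<in> set ts" "f t = Some S'" for t S'
    using that f expand by (auto simp: in_set_conv_nth list_all2_conv_all_nth)
  ultimately show ?thesis using that(2) by blast
next
  case (other U ss)
  define us where "us = nths ts (- U)"
  define f where "f = map_of (zip us ss)"
  have len: "length ss = length us" using other by (simp add: us_def list_all2_lengthD)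
  have d: "distinct us" using assms(2) by (simp add: us_def)
  have f: "f (us ! i) = Some (ss ! i)" if "i < length us" for i
    using that len d by (simp add: f_def map_of_zip_nth)
  have none: "f t = None \<longleftrightarrow> t \<notin> set us" for t
    using len by (simp add: f_def map_of_zip_is_None)
  have us: "ts ! i \<in> set us \<longleftrightarrow> i \<notin> U" if "i < length ts" for i
    using that nth_eq_iff_index_eq[OF assms(2)] by (auto simp: us_def set_nths)
  have "filter (\<lambda>t. f t \<noteq> None) ts = us"
    unfolding filter_eq_nths unfolding us_def by (rule nths_cong_set) (auto simp: none us)
  moreover have "map (\<lambda>t. the (f t)) us = ss" using f len by (auto intro!: nth_equalityI)
  moreover have "(\<Union>t\<in>{t\<in>set ts. f t = None}. nodes t) = (\<Union>i\<in>U. nodes (ts ! i))"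
    using other(3) by (auto simp: none us in_set_conv_nth) (metis (no_types) lessThan_iff subsetD us in_set_conv_nth)+
  moreover have "\<exists>t\<in>set ts. f t = None"
    using other(2,3) us none by (metis ex_in_conv lessThan_iff nth_mem subsetD)
  ultimately have "S = assemble v ts f" using other by (auto simp: assemble_def)
  moreover have "summary_tree t S'" if "t \<in> set ts" "f t = Some S'" for t S'
  proof -
    from that(2) none have "t \<in> set us" by (metis option.distinct(1))
    then show ?thesis using that f other(4) len
      by (auto simp: in_set_conv_nth list_all2_conv_all_nth us_def[symmetric])
  qed
  ultimately show ?thesis using that(2) by blast
qed

lemma sum_list_filter_option:
  assumes "distinct ts"
  shows "(\<Sum>t\<leftarrow>filter (\<lambda>t. f t \<noteq> None) ts. g (the (f t))) =
    (\<Sum>t\<in>set ts. case f t of None \<Rightarrow> 0 | Some S \<Rightarrow> (g S :: 'b :: comm_monoid_add))"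
  using assms by (induction ts) (auto split: option.splits)

lemma num_nodes_assemble:
  assumes "distinct ts"
  shows "num_nodes (assemble v ts f) = 1 + (if \<exists>t\<in>set ts. f t = None then 1 else 0) +
    (\<Sum>t\<in>set ts. case f t of None \<Rightarrow> 0 | Some S \<Rightarrow> num_nodes S)"
  using sum_list_filter_option[OF assms, where f = f and g = num_nodes]
  by (auto simp: assemble_def num_nodes_Node comp_def)

lemma tree_value_assemble:
  assumes "distinct (node_list (Node v ts))"
  shows "tree_value W w (assemble v ts f) = eta W (w v) +
    (if \<exists>t\<in>set ts. f t = None then eta W (\<Sum>t\<in>{t\<in>set ts. f t = None}. tree_weight w t) else 0) +
    (\<Sum>t\<in>set ts. case f t of None \<Rightarrow> 0 | Some S \<Rightarrow> tree_value W w S)"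
  using sum_list_filter_option[OF distinct_node_list_NodeD(1)[OF assms], where f = f and g = "tree_value W w"]
    sum_nodes_Union[OF assms, of "{t\<in>set ts. f t = None}" w]
  by (auto simp: assemble_def tree_value_Node comp_def)

text \<open>The values attained with k nodes thereby form a finite set, so that \<open>best\<close>
  can be its \<open>Max\<close>. Below a root only finitely many lists are possible: the entries
  come from a finite pool, and \<open>other\<close> adds at most one to the number of
  children.\<close>

lemma finite_summary_trees:
  "distinct (node_list t) \<Longrightarrow> finite {S. summary_tree t S}"
proof (induction t)
  case (Node v ts)
  note d = distinct_node_list_NodeD[OF Node.prems]
  define Os where "Os = (\<lambda>A. (Node (\<Union>t\<in>A. nodes t) [] :: 'a set rtree)) ` Pow (set ts)"
  define A where "A = (\<Union>t\<in>set ts. {S. summary_tree t S}) \<union> Os"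
  define LS where "LS = {ss. set ss \<subseteq> A \<and> length ss \<le> length ts + 1}"
  have "S \<in> insert (Node (nodes (Node v ts)) []) (Node {v} ` LS)"
    if "summary_tree (Node v ts) S" for S
    using that d(1)
  proof (cases rule: summary_tree_cases)
    case collapse
    then show ?thesis by blast
  next
    case (assemble f)
    define ss1 where "ss1 = (if \<exists>t\<in>set ts. f t = None
      then [Node (\<Union>t\<in>{t\<in>set ts. f t = None}. nodes t) []] else [])"
    define ss2 where "ss2 = map (\<lambda>t. the (f t)) (filter (\<lambda>t. f t \<noteq> None) ts)"
    have "Node (\<Union>t\<in>{t\<in>set ts. f t = None}. nodes t) [] \<in> Os"
      unfolding Os_def by (rule imageI) blast
    then have "set ss1 \<subseteq> A"
      unfolding ss1_def A_def by (cases "\<exists>t\<in>set ts. f t = None") auto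
    moreover have "set ss2 \<subseteq> A"
    proof
      fix S' assume "S' \<in> set ss2"
      then obtain t where "t \<in> set ts" "f t = Some S'" unfolding ss2_def by auto
      then show "S' \<in> A" using assemble(1) unfolding A_def by blast
    qed
    moreover have "length ss1 \<le> 1" "length ss2 \<le> length ts" by (simp_all add: ss1_def ss2_def)
    ultimately have "ss1 @ ss2 \<in> LS" by (simp add: LS_def)
    moreover have "S = Node {v} (ss1 @ ss2)"
      unfolding assemble(2) assemble_def ss1_def ss2_def ..
    ultimately show ?thesis by blast
  qed
  moreover have "finite A" using Node.IH d(3) by (simp add: A_def Os_def)
  then have "finite LS" unfolding LS_def by (rule finite_lists_length_le)
  ultimately show ?case
    by (intro finite_subset[OF _ finite.insertI[OF finite_imageI], of _ _ "Node {v}" LS]) blast+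
qed

text \<open>Only the size and the value of a summary tree matter to the optimisation. A relation
  comes before any maximum so that the recursion over the children can be stated as an
  equivalence.\<close>

definition achieves :: "real \<Rightarrow> ('a \<Rightarrow> real) \<Rightarrow> 'a rtree \<Rightarrow> nat \<Rightarrow> real \<Rightarrow> bool" where
  "achieves W w t k x \<longleftrightarrow> (\<exists>S. summary_tree t S \<and> num_nodes S = k \<and> tree_value W w S = x)"

lemma achieves_1: "achieves W w t 1 (eta W (tree_weight w t))"
  unfolding achieves_def
  by (rule exI[of _ "Node (nodes t) []"])
    (simp add: summary_tree.collapse num_nodes_Node tree_value_Node)

text \<open>The value \<open>\<kappa> t = 0\<close> encodes that the child \<open>t\<close> is merged into the node \<open>other\<close>.\<close>

lemma achieves_Node:
  assumes "distinct (node_list (Node v ts))"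
  shows "achieves W w (Node v ts) k x \<longleftrightarrow>
    k = 1 \<and> x = eta W (tree_weight w (Node v ts)) \<or>
    (\<exists>\<kappa> \<xi>. (\<forall>t\<in>set ts. \<kappa> t \<noteq> 0 \<longrightarrow> achieves W w t (\<kappa> t) (\<xi> t)) \<and>
      k = 1 + (if \<exists>t\<in>set ts. \<kappa> t = 0 then 1 else 0) + (\<Sum>t\<in>set ts. \<kappa> t) \<and>
      x = eta W (w v) +
        (if \<exists>t\<in>set ts. \<kappa> t = 0 then eta W (\<Sum>t\<in>{t\<in>set ts. \<kappa> t = 0}. tree_weight w t) else 0) +
        (\<Sum>t\<in>set ts. if \<kappa> t = 0 then 0 else \<xi> t))"
    (is "_ \<longleftrightarrow> ?C \<or> (\<exists>\<kappa> \<xi>. ?A \<kappa> \<xi> \<and> k = ?k \<kappa> \<and> x = ?x \<kappa> \<xi>)")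
proof
  note d = distinct_node_list_NodeD[OF assms]
  assume "achieves W w (Node v ts) k x"
  then obtain S where S: "summary_tree (Node v ts) S" "num_nodes S = k" "tree_value W w S = x"
    by (auto simp: achieves_def)
  from S(1) d(1) show "?C \<or> (\<exists>\<kappa> \<xi>. ?A \<kappa> \<xi> \<and> k = ?k \<kappa> \<and> x = ?x \<kappa> \<xi>)"
  proof (cases rule: summary_tree_cases)
    case collapse
    then show ?thesis using S by (auto simp: num_nodes_Node tree_value_Node)
  next
    case (assemble f)
    define \<kappa> where "\<kappa> t = (case f t of None \<Rightarrow> 0 | Some S \<Rightarrow> num_nodes S)" for t
    define \<xi> where "\<xi> t = (case f t of None \<Rightarrow> 0 | Some S \<Rightarrow> tree_value W w S)" for t
    have 0: "\<kappa> t = 0 \<longleftrightarrow> f t = None" for t by (auto simp: \<kappa>_def split: option.splits)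
    have "?A \<kappa> \<xi>" using assemble(1)
      by (auto simp: \<kappa>_def \<xi>_def achieves_def split: option.splits)
    moreover have "k = ?k \<kappa>"
      using S(2) unfolding assemble(2) num_nodes_assemble[OF d(1)] 0 by (simp add: \<kappa>_def)
    moreover have "x = ?x \<kappa> \<xi>"
    proof -
      have "(\<Sum>t\<in>set ts. case f t of None \<Rightarrow> 0 | Some S \<Rightarrow> tree_value W w S) =
          (\<Sum>t\<in>set ts. if f t = None then 0 else \<xi> t)"
        by (intro sum.cong) (auto simp: \<xi>_def)
      then show ?thesis
        using S(3) unfolding assemble(2) tree_value_assemble[OF assms] 0 by simp
    qed
    ultimately show ?thesis by blast
  qed
next
  note d = distinct_node_list_NodeD[OF assms]
  assume "?C \<or> (\<exists>\<kappa> \<xi>. ?A \<kappa> \<xi> \<and> k = ?k \<kappa> \<and> x = ?x \<kappa> \<xi>)"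
  then show "achieves W w (Node v ts) k x"
  proof
    assume ?C
    then show ?thesis using achieves_1[of W w "Node v ts"] by simp
  next
    assume "\<exists>\<kappa> \<xi>. ?A \<kappa> \<xi> \<and> k = ?k \<kappa> \<and> x = ?x \<kappa> \<xi>"
    then obtain \<kappa> \<xi> where *: "?A \<kappa> \<xi>" "k = ?k \<kappa>" "x = ?x \<kappa> \<xi>" by blast
    then obtain g where g: "\<And>t. t \<in> set ts \<Longrightarrow> \<kappa> t \<noteq> 0 \<Longrightarrow>
        summary_tree t (g t) \<and> num_nodes (g t) = \<kappa> t \<and> tree_value W w (g t) = \<xi> t"
      unfolding achieves_def by metis
    define f where "f t = (if \<kappa> t = 0 then None else Some (g t))" for t
    have 0: "f t = None \<longleftrightarrow> \<kappa> t = 0" for t by (auto simp: f_def)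
    have "summary_tree (Node v ts) (assemble v ts f)"
      using g by (intro summary_tree_assemble) (auto simp: f_def split: if_splits)
    moreover have "num_nodes (assemble v ts f) = k"
      unfolding num_nodes_assemble[OF d(1)] 0 *(2)
      using g by (auto simp: f_def intro!: sum.cong)
    moreover have "tree_value W w (assemble v ts f) = x"
      unfolding tree_value_assemble[OF assms] 0 *(3)
      using g by (auto simp: f_def intro!: sum.cong)
    ultimately show ?thesis unfolding achieves_def by blast
  qed
qed

section \<open>Lowering the number of nodes by one\<close>

lemma sum_upd_remove:
  fixes g :: "'a \<Rightarrow> 'b \<Rightarrow> 'c :: ab_group_add"
  assumes "finite C" "y \<in> C"
  shows "(\<Sum>i\<in>C. g i ((f(y := z)) i)) = (\<Sum>i\<in>C. g i (f i)) - g y (f y) + g y z"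
proof -
  have "(\<Sum>i\<in>C - {y}. g i ((f(y := z)) i)) = (\<Sum>i\<in>C - {y}. g i (f i))" by (intro sum.cong) auto
  then show ?thesis
    using sum.remove[OF assms, of "\<lambda>i. g i (f i)"] sum.remove[OF assms, of "\<lambda>i. g i ((f(y := z)) i)"]
    by simp
qed

lemma sum_upd_remove_nat:
  fixes g :: "'a \<Rightarrow> 'b \<Rightarrow> nat"
  assumes "finite C" "y \<in> C"
  shows "(\<Sum>i\<in>C. g i ((f(y := z)) i)) + g y (f y) = (\<Sum>i\<in>C. g i (f i)) + g y z"
proof -
  have "(\<Sum>i\<in>C - {y}. g i ((f(y := z)) i)) = (\<Sum>i\<in>C - {y}. g i (f i))" by (intro sum.cong) auto
  then show ?thesis
    using sum.remove[OF assms, of "\<lambda>i. g i (f i)"] sum.remove[OF assms, of "\<lambda>i. g i ((f(y := z)) i)"]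
    by simp
qed

text \<open>Number of nodes and value of the part of a summary tree below its root, where \<open>\<kappa> i\<close> nodes
  are allotted to the child \<open>i\<close> of weight \<open>s i\<close> and \<open>\<kappa> i = 0\<close> means that \<open>i\<close> is merged into
  the node \<open>other\<close>.\<close>

definition alloc_size :: "'i set \<Rightarrow> ('i \<Rightarrow> nat) \<Rightarrow> nat" where
  "alloc_size C \<kappa> = (if \<exists>i\<in>C. \<kappa> i = 0 then 1 else 0) + (\<Sum>i\<in>C. \<kappa> i)"

definition alloc_value ::
  "real \<Rightarrow> ('i \<Rightarrow> real) \<Rightarrow> ('i \<Rightarrow> nat \<Rightarrow> real) \<Rightarrow> 'i set \<Rightarrow> ('i \<Rightarrow> nat) \<Rightarrow> real" where
  "alloc_value W s b C \<kappa> =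
     (if \<exists>i\<in>C. \<kappa> i = 0 then eta W (\<Sum>i\<in>C. if \<kappa> i = 0 then s i else 0) else 0) +
     (\<Sum>i\<in>C. if \<kappa> i = 0 then 0 else b i (\<kappa> i))"

lemma achieves_Node_alloc:
  assumes "distinct (node_list (Node v ts))"
  shows "achieves W w (Node v ts) k x \<longleftrightarrow>
    k = 1 \<and> x = eta W (tree_weight w (Node v ts)) \<or>
    (\<exists>\<kappa> \<xi>. (\<forall>t\<in>set ts. \<kappa> t \<noteq> 0 \<longrightarrow> achieves W w t (\<kappa> t) (\<xi> t)) \<and>
      k = 1 + alloc_size (set ts) \<kappa> \<and>
      x = eta W (w v) + alloc_value W (tree_weight w) (\<lambda>t _. \<xi> t) (set ts) \<kappa>)"
proof -
  have "(\<Sum>t\<in>{t\<in>set ts. \<kappa> t = 0}. tree_weight w t) =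
      (\<Sum>t\<in>set ts. if \<kappa> t = 0 then tree_weight w t else 0)" for \<kappa> :: "'a rtree \<Rightarrow> nat"
    by (rule sum.inter_filter) simp
  then show ?thesis
    unfolding achieves_Node[OF assms] alloc_size_def alloc_value_def by (simp add: add.assoc)
qed

lemma achieves_bounds:
  assumes "distinct (node_list t)" "achieves W w t k x"
  shows "1 \<le> k \<and> k \<le> num_nodes t"
  using assms
proof (induction t arbitrary: k x)
  case (Node v ts)
  note d = distinct_node_list_NodeD[OF Node.prems(1)]
  have n: "num_nodes (Node v ts) = 1 + (\<Sum>t\<in>set ts. num_nodes t)"
    using d(1) by (simp add: num_nodes_Node sum_list_distinct_conv_sum_set)
  show ?case
    using Node.prems(2) unfolding achieves_Node_alloc[OF Node.prems(1)]
  proof (elim disjE exE conjE)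
    fix \<kappa> \<xi> assume *: "\<forall>t\<in>set ts. \<kappa> t \<noteq> 0 \<longrightarrow> achieves W w t (\<kappa> t) (\<xi> t)"
      and k: "k = 1 + alloc_size (set ts) \<kappa>"
    have le: "\<kappa> t \<le> num_nodes t" if "t \<in> set ts" for t
      using Node.IH[OF that d(3)[OF that]] * that by (cases "\<kappa> t = 0") auto
    have "alloc_size (set ts) \<kappa> \<le> (\<Sum>t\<in>set ts. num_nodes t)"
    proof (cases "\<exists>t\<in>set ts. \<kappa> t = 0")
      case True
      then obtain t where t: "t \<in> set ts" "\<kappa> t = 0" by blast
      \<comment> \<open>A merged child leaves its positive \<open>num_nodes t\<close> unspent; this
        strict gap pays for the node \<open>other\<close>.\<close>
      have "(\<Sum>t\<in>set ts. \<kappa> t) < (\<Sum>t\<in>set ts. num_nodes t)"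
      proof (rule sum_strict_mono_ex1)
        show "\<exists>t\<in>set ts. \<kappa> t < num_nodes t" using t by (intro bexI[of _ t]) simp_all
      qed (use le in simp_all)
      then show ?thesis using True by (simp add: alloc_size_def)
    next
      case False
      then show ?thesis using le by (auto simp: alloc_size_def intro: sum_mono)
    qed
    then show ?thesis using k n by simp
  qed (use n in simp)
qed

lemma achieves_1_iff:
  assumes "distinct (node_list t)"
  shows "achieves W w t 1 x \<longleftrightarrow> x = eta W (tree_weight w t)"
proof
  show "x = eta W (tree_weight w t)" if "achieves W w t 1 x"
  proof (cases t)
    case (Node v ts)
    show ?thesis
      using that assms unfolding Node achieves_Node_alloc[OF assms[unfolded Node]]
    proof (elim disjE exE conjE)
      fix \<kappa> \<xi> assume "1 = 1 + alloc_size (set ts) \<kappa>"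
        and x: "x = eta W (w v) + alloc_value W (tree_weight w) (\<lambda>t _. \<xi> t) (set ts) \<kappa>"
      then have "alloc_size (set ts) \<kappa> = 0" by simp
      then have "ts = []" by (cases ts) (auto simp: alloc_size_def split: if_splits)
      then show "x = eta W (tree_weight w (Node v ts))" using x by (simp add: alloc_value_def)
    qed
  qed
qed (use achieves_1 in auto)

text \<open>Full expansion, the upper end from which \<open>achieves_pred\<close> descends through
  all smaller sizes.\<close>

lemma achieves_num_nodes:
  "distinct (node_list t) \<Longrightarrow> \<exists>x. achieves W w t (num_nodes t) x"
proof (induction t)
  case (Node v ts)
  note d = distinct_node_list_NodeD[OF Node.prems(1)]
  have "\<forall>t\<in>set ts. \<exists>x. achieves W w t (num_nodes t) x" using Node.IH d(3) by auto
  then obtain \<xi> where \<xi>: "\<forall>t\<in>set ts. achieves W w t (num_nodes t) (\<xi> t)" by metis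
  have "num_nodes (Node v ts) = 1 + alloc_size (set ts) num_nodes"
    using d(1) by (simp add: num_nodes_Node alloc_size_def sum_list_distinct_conv_sum_set)
  with \<xi> show ?case unfolding achieves_Node_alloc[OF Node.prems] by blast
qed

text \<open>A node is saved by uniting two disjoint blocks; each weighs at most as much as t, so by
  \<open>split_gain_mono\<close> the loss is within the stated bound, whatever the tree looks like.
  If some child has at least two nodes, the union takes place inside it. Otherwise every child is a
  single block or merged, and the candidates for a union are the root with all the rest, a child
  with \<open>other\<close>, or two children.\<close>

lemma achieves_pred:
  assumes "distinct (node_list t)" "\<And>v. v \<in> nodes t \<Longrightarrow> 0 \<le> w v" "0 < W"
    and "achieves W w t (Suc k) x" "k \<noteq> 0"
  shows "\<exists>y. achieves W w t k y \<and> x - split_gain W (tree_weight w t) (tree_weight w t) \<le> y"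
  using assms
proof (induction t arbitrary: k x)
  case (Node v ts)
  note d = distinct_node_list_NodeD[OF Node.prems(1)]
  let ?s = "tree_weight w"
  let ?C = "set ts"
  let ?val = "alloc_value W ?s"
  have s0: "0 \<le> ?s t" if "t \<in> ?C" for t
    using that Node.prems(2) by (intro sum_nonneg) auto
  have sv: "?s (Node v ts) = w v + sum ?s ?C" by (rule tree_weight_Node[OF Node.prems(1)])
  have wv: "0 \<le> w v" using Node.prems(2) by simp
  have gain: "split_gain W a b \<le> split_gain W (?s (Node v ts)) (?s (Node v ts))"
    if "0 \<le> a" "0 \<le> b" "a + b \<le> ?s (Node v ts)" for a b
    using that Node.prems(3) by (intro split_gain_mono) auto
  have le1: "?s t \<le> sum ?s ?C" if "t \<in> ?C" for t
    using that s0 by (intro member_le_sum) auto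
  from Node.prems(4,5) obtain \<kappa> \<xi> where \<kappa>: "\<forall>t\<in>?C. \<kappa> t \<noteq> 0 \<longrightarrow> achieves W w t (\<kappa> t) (\<xi> t)"
    and k: "k = alloc_size ?C \<kappa>" and x: "x = eta W (w v) + ?val (\<lambda>t _. \<xi> t) ?C \<kappa>"
    unfolding achieves_Node_alloc[OF Node.prems(1)] by auto
  \<comment> \<open>Here all children together form one block, of weight \<open>sum ?s ?C\<close>;
    it is united with the root.\<close>
  have collapse: ?case
    if "k = 1" "?val (\<lambda>t _. \<xi> t) ?C \<kappa> = eta W (sum ?s ?C)"
  proof -
    have "eta W (w v) + eta W (sum ?s ?C) - split_gain W (w v) (sum ?s ?C) = eta W (?s (Node v ts))"
      unfolding sv by (simp add: split_gain_def)
    moreover have "split_gain W (w v) (sum ?s ?C) \<le>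
        split_gain W (?s (Node v ts)) (?s (Node v ts))"
    proof (rule gain)
      show "0 \<le> sum ?s ?C" using s0 by (rule sum_nonneg)
      show "w v + sum ?s ?C \<le> ?s (Node v ts)" unfolding sv ..
    qed (rule wv)
    moreover have "achieves W w (Node v ts) k (eta W (?s (Node v ts)))"
      unfolding \<open>k = 1\<close> by (rule achieves_1)
    ultimately show ?thesis using x that(2) by (intro exI[of _ "eta W (?s (Node v ts))"]) linarith
  qed
  have finish: ?case
    if "\<forall>t\<in>?C. \<kappa>' t \<noteq> 0 \<longrightarrow> achieves W w t (\<kappa>' t) (\<xi>' t)" "k = 1 + alloc_size ?C \<kappa>'"
      "x - split_gain W (?s (Node v ts)) (?s (Node v ts)) \<le> eta W (w v) + ?val (\<lambda>t _. \<xi>' t) ?C \<kappa>'"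
    for \<kappa>' \<xi>'
  proof (intro exI conjI)
    show "achieves W w (Node v ts) k (eta W (w v) + ?val (\<lambda>t _. \<xi>' t) ?C \<kappa>')"
      unfolding achieves_Node_alloc[OF Node.prems(1)]
      by (intro disjI2 exI[of _ \<kappa>'] exI[of _ \<xi>'] conjI that refl)
  qed (rule that)
  show ?case
  proof (cases "\<exists>t\<in>?C. 2 \<le> \<kappa> t")
    case True
    then obtain t where t: "t \<in> ?C" "2 \<le> \<kappa> t" by blast
    have "achieves W w t (Suc (\<kappa> t - 1)) (\<xi> t)" "\<kappa> t - 1 \<noteq> 0" using \<kappa> t by auto
    from Node.IH[OF t(1) d(3)[OF t(1)] _ Node.prems(3) this] Node.prems(2) t(1)
    obtain y where y: "achieves W w t (\<kappa> t - 1) y" "\<xi> t - split_gain W (?s t) (?s t) \<le> y"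
      by auto
    define \<kappa>' where "\<kappa>' = \<kappa>(t := \<kappa> t - 1)"
    define \<xi>' where "\<xi>' = \<xi>(t := y)"
    have 0: "\<kappa>' i = 0 \<longleftrightarrow> \<kappa> i = 0" for i using t by (auto simp: \<kappa>'_def)
    have "(\<Sum>i\<in>?C. \<kappa>' i) + \<kappa> t = (\<Sum>i\<in>?C. \<kappa> i) + (\<kappa> t - 1)"
      unfolding \<kappa>'_def using sum_upd_remove_nat[of ?C t "\<lambda>_ x. x"] t by simp
    then have "k = 1 + alloc_size ?C \<kappa>'" using k t unfolding alloc_size_def 0 by auto
    moreover have "(\<Sum>i\<in>?C. if \<kappa>' i = 0 then 0 else \<xi>' i) =
        (\<Sum>i\<in>?C. if \<kappa> i = 0 then 0 else \<xi> i) - \<xi> t + y"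
      unfolding 0 \<xi>'_def using sum_upd_remove[of ?C t "\<lambda>i x. if \<kappa> i = 0 then 0 else x" \<xi> y] t by simp
    then have "?val (\<lambda>t _. \<xi>' t) ?C \<kappa>' = ?val (\<lambda>t _. \<xi> t) ?C \<kappa> - \<xi> t + y"
      unfolding alloc_value_def 0 by simp
    moreover have "split_gain W (?s t) (?s t) \<le> split_gain W (?s (Node v ts)) (?s (Node v ts))"
      using le1[OF t(1)] s0[OF t(1)] wv sv Node.prems(3) by (intro split_gain_mono) auto
    moreover have "\<forall>t\<in>?C. \<kappa>' t \<noteq> 0 \<longrightarrow> achieves W w t (\<kappa>' t) (\<xi>' t)"
      using \<kappa> y by (auto simp: \<kappa>'_def \<xi>'_def)
    ultimately show ?thesis
      using x y(2) by - (rule finish[of \<kappa>' \<xi>'], assumption, assumption, linarith)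
  next
    case False
    then have le: "\<kappa> t = 0 \<or> \<kappa> t = 1" if "t \<in> ?C" for t using that by force
    have \<xi>1: "\<xi> t = eta W (?s t)" if "t \<in> ?C" "\<kappa> t \<noteq> 0" for t
      using \<kappa> le[OF that(1)] that achieves_1_iff[OF d(3)[OF that(1)], of W w "\<xi> t"] by auto
    show ?thesis
    proof (cases "\<exists>t\<in>?C. \<kappa> t \<noteq> 0")
      case False
      then have 0: "\<kappa> t = 0" if "t \<in> ?C" for t using that by blast
      have "?C \<noteq> {}"
      proof
        assume "?C = {}"
        then show False using k Node.prems(5) unfolding alloc_size_def by simp
      qed
      then have ex: "\<exists>t\<in>?C. \<kappa> t = 0" using 0 equals0I[of ?C] by metis
      have "(\<Sum>i\<in>?C. \<kappa> i) = 0" by (intro sum.neutral ballI 0)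
      then have k1: "k = 1" unfolding k alloc_size_def if_P[OF ex] by simp
      have "(\<Sum>i\<in>?C. if \<kappa> i = 0 then ?s i else 0) = sum ?s ?C"
        by (intro sum.cong) (simp_all add: 0)
      moreover have "(\<Sum>i\<in>?C. if \<kappa> i = 0 then 0 else \<xi> i) = 0"
        by (intro sum.neutral ballI) (simp add: 0)
      ultimately have "?val (\<lambda>t _. \<xi> t) ?C \<kappa> = eta W (sum ?s ?C)"
        unfolding alloc_value_def if_P[OF ex] by simp
      then show ?thesis by (rule collapse[OF k1])
    next
      case True
      then obtain t where t: "t \<in> ?C" "\<kappa> t \<noteq> 0" by blast
      then have t1: "\<kappa> t = 1" using le[OF t(1)] by simp
      show ?thesis
      proof (cases "\<exists>u\<in>?C. \<kappa> u = 0")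
        case u: True
        let ?u = "\<Sum>i\<in>?C. if \<kappa> i = 0 then ?s i else 0"
        \<comment> \<open>The single block of \<open>t\<close> joins the existing node
          \<open>other\<close>.\<close>
        define \<kappa>' where "\<kappa>' = \<kappa>(t := 0)"
        have u': "\<exists>u\<in>?C. \<kappa>' u = 0" using t by (auto simp: \<kappa>'_def)
        have "(\<Sum>i\<in>?C. \<kappa>' i) + \<kappa> t = (\<Sum>i\<in>?C. \<kappa> i) + 0"
          unfolding \<kappa>'_def using sum_upd_remove_nat[of ?C t "\<lambda>_ x. x" \<kappa> 0] t by simp
        then have "k = 1 + alloc_size ?C \<kappa>'"
          unfolding k alloc_size_def if_P[OF u] if_P[OF u'] t1 by linarith
        moreover have sw: "(\<Sum>i\<in>?C. if \<kappa>' i = 0 then ?s i else 0) = ?u + ?s t"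
          unfolding \<kappa>'_def using t sum_upd_remove[of ?C t "\<lambda>i x. if x = 0 then ?s i else 0" \<kappa> 0] by simp
        have sx: "(\<Sum>i\<in>?C. if \<kappa>' i = 0 then 0 else \<xi> i) =
            (\<Sum>i\<in>?C. if \<kappa> i = 0 then 0 else \<xi> i) - \<xi> t"
          unfolding \<kappa>'_def using t sum_upd_remove[of ?C t "\<lambda>i x. if x = 0 then 0 else \<xi> i" \<kappa> 0] by simp
        have "?val (\<lambda>t _. \<xi> t) ?C \<kappa>' = ?val (\<lambda>t _. \<xi> t) ?C \<kappa> - split_gain W ?u (?s t)"
          unfolding alloc_value_def sw sx if_P[OF u] if_P[OF u'] \<xi>1[OF t] split_gain_def by linarith
        moreover have "split_gain W ?u (?s t) \<le> split_gain W (?s (Node v ts)) (?s (Node v ts))"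
        proof (rule gain)
          show "0 \<le> ?u" using s0 by (intro sum_nonneg) auto
          have "?u + ?s t \<le> sum ?s ?C" unfolding sw[symmetric] using s0 by (intro sum_mono) auto
          then show "?u + ?s t \<le> ?s (Node v ts)" using sv wv by simp
        qed (use s0 t in auto)
        moreover have "\<forall>t\<in>?C. \<kappa>' t \<noteq> 0 \<longrightarrow> achieves W w t (\<kappa>' t) (\<xi> t)"
          using \<kappa> by (auto simp: \<kappa>'_def)
        ultimately show ?thesis
          using x by - (rule finish[of \<kappa>' \<xi>], assumption, assumption, linarith)
      next
        case nu: False
        have one: "\<kappa> i = 1" if "i \<in> ?C" for i using nu le that by blast
        show ?thesis
        \<comment> \<open>An only child can be united with nothing but the root.\<close>
        proof (cases "?C = {t}")
          case True
          then show ?thesis using collapse k \<xi>1[OF t] t1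
            by (simp add: alloc_size_def alloc_value_def)
        next
          case False
          then obtain t' where t': "t' \<in> ?C" "t' \<noteq> t" using t by blast
          have \<xi>t': "\<xi> t' = eta W (?s t')" using \<xi>1[OF t'(1)] one[OF t'(1)] by simp
          \<comment> \<open>Two blocks disappear and \<open>other\<close> is created from them: one
            node fewer in all.\<close>
          define \<kappa>' where "\<kappa>' = \<kappa>(t := 0, t' := 0)"
          have u': "\<exists>u\<in>?C. \<kappa>' u = 0" using t by (auto simp: \<kappa>'_def)
          have "(\<Sum>i\<in>?C. \<kappa>' i) + \<kappa> t + \<kappa> t' = (\<Sum>i\<in>?C. \<kappa> i)"
            unfolding \<kappa>'_def using sum_upd_remove_nat[of ?C t' "\<lambda>_ x. x" "\<kappa>(t := 0)" 0]
              sum_upd_remove_nat[of ?C t "\<lambda>_ x. x" \<kappa> 0] t t' by simp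
          then have "k = 1 + alloc_size ?C \<kappa>'"
            unfolding k alloc_size_def if_not_P[OF nu] if_P[OF u'] one[OF t(1)] one[OF t'(1)]
            by linarith
          moreover have sw: "(\<Sum>i\<in>?C. if \<kappa>' i = 0 then ?s i else 0) = ?s t + ?s t'"
          proof -
            have "(\<Sum>i\<in>?C. if \<kappa> i = 0 then ?s i else 0) = 0"
              by (intro sum.neutral ballI) (simp add: one)
            then show ?thesis
              unfolding \<kappa>'_def using t t' one[OF t(1)] one[OF t'(1)]
                sum_upd_remove[of ?C t "\<lambda>i x. if x = 0 then ?s i else 0" \<kappa> 0]
                sum_upd_remove[of ?C t' "\<lambda>i x. if x = 0 then ?s i else 0" "\<kappa>(t := 0)" 0] by simp
          qed
          have sx: "(\<Sum>i\<in>?C. if \<kappa>' i = 0 then 0 else \<xi> i) =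
              (\<Sum>i\<in>?C. if \<kappa> i = 0 then 0 else \<xi> i) - \<xi> t - \<xi> t'"
            unfolding \<kappa>'_def using t t' one[OF t(1)] one[OF t'(1)]
              sum_upd_remove[of ?C t "\<lambda>i x. if x = 0 then 0 else \<xi> i" \<kappa> 0]
              sum_upd_remove[of ?C t' "\<lambda>i x. if x = 0 then 0 else \<xi> i" "\<kappa>(t := 0)" 0] by simp
          have "?val (\<lambda>t _. \<xi> t) ?C \<kappa>' = ?val (\<lambda>t _. \<xi> t) ?C \<kappa> - split_gain W (?s t) (?s t')"
            unfolding alloc_value_def sw sx if_not_P[OF nu] if_P[OF u'] \<xi>1[OF t] \<xi>t' split_gain_def
            by linarith
          moreover have "split_gain W (?s t) (?s t') \<le> split_gain W (?s (Node v ts)) (?s (Node v ts))"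
          proof (rule gain)
            have "sum ?s {t, t'} \<le> sum ?s ?C"
              by (rule sum_mono2) (use t t' in simp, use t t' in simp, rule s0, simp)
            then show "?s t + ?s t' \<le> ?s (Node v ts)" unfolding sv using wv t'(2) by simp
          qed (rule s0[OF t(1)] s0[OF t'(1)])+
          moreover have "\<forall>t\<in>?C. \<kappa>' t \<noteq> 0 \<longrightarrow> achieves W w t (\<kappa>' t) (\<xi> t)"
            using \<kappa> by (auto simp: \<kappa>'_def)
          ultimately show ?thesis
            using x by - (rule finish[of \<kappa>' \<xi>], assumption, assumption, linarith)
        qed
      qed
    qed
  qed
qed

section \<open>The exchange argument\<close>

text \<open>\<open>\<rho>\<close> ranks the children by decreasing weight, \<open>F i\<close>
  describes the possible sizes and \<open>b i\<close> the best values of child i. The conclusion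
  speaks of ranks instead of weights, so that ties are settled as well. Every exchange lowers the
  sum of \<open>M - \<rho> i\<close> over the merged children, either because a child of later rank
  replaces an earlier one in \<open>other\<close> or because one child leaves
  \<open>other\<close>.\<close>

lemma exchange:
  fixes \<rho> :: "'i \<Rightarrow> nat" and s :: "'i \<Rightarrow> real"
  assumes "finite C" "0 < W"
    and s0: "\<And>i. i \<in> C \<Longrightarrow> 0 \<le> s i"
    and \<rho>: "\<And>i j. i \<in> C \<Longrightarrow> j \<in> C \<Longrightarrow> \<rho> i < \<rho> j \<Longrightarrow> s j \<le> s i"
    and F1: "\<And>i. i \<in> C \<Longrightarrow> F i 1 \<and> b i 1 = eta W (s i)"
    and F2: "\<And>i k. i \<in> C \<Longrightarrow> F i (Suc k) \<Longrightarrow> k \<noteq> 0 \<Longrightarrow>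
      F i k \<and> b i (Suc k) - split_gain W (s i) (s i) \<le> b i k"
    and "\<forall>i\<in>C. \<kappa> i \<noteq> 0 \<longrightarrow> F i (\<kappa> i)"
  shows "\<exists>\<kappa>'. (\<forall>i\<in>C. \<kappa>' i \<noteq> 0 \<longrightarrow> F i (\<kappa>' i)) \<and> alloc_size C \<kappa>' = alloc_size C \<kappa> \<and>
    alloc_value W s b C \<kappa> \<le> alloc_value W s b C \<kappa>' \<and>
    (\<forall>x\<in>C. \<forall>y1\<in>C. \<forall>y2\<in>C. \<kappa>' x \<noteq> 0 \<longrightarrow> \<kappa>' y1 = 0 \<longrightarrow> \<kappa>' y2 = 0 \<longrightarrow>
       \<rho> y1 < \<rho> x \<longrightarrow> \<rho> y2 < \<rho> x \<longrightarrow> y1 = y2)"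
proof -
  \<comment> \<open>\<open>M\<close> exceeds every rank, so each merged child contributes a positive
    amount to the measure.\<close>
  define M where "M = Suc (\<Sum>i\<in>C. \<rho> i)"
  have \<rho>M: "\<rho> i < M" if "i \<in> C" for i
    unfolding M_def using member_le_sum[OF that _ assms(1), of \<rho>] by simp
  show ?thesis using assms(7)
  proof (induction "\<Sum>i\<in>C. if \<kappa> i = 0 then M - \<rho> i else 0" arbitrary: \<kappa> rule: less_induct)
    case less
    show ?case
    proof (cases "\<exists>x\<in>C. \<exists>y1\<in>C. \<exists>y2\<in>C. \<kappa> x \<noteq> 0 \<and> \<kappa> y1 = 0 \<and> \<kappa> y2 = 0 \<and>
        \<rho> y1 < \<rho> x \<and> \<rho> y2 < \<rho> x \<and> y1 \<noteq> y2")
      case False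
      then show ?thesis using less.prems by (intro exI[of _ \<kappa>]) blast
    next
      case True
      then obtain x y z where xyz: "x \<in> C" "y \<in> C" "z \<in> C" "\<kappa> x \<noteq> 0" "\<kappa> y = 0" "\<kappa> z = 0"
        "\<rho> y < \<rho> x" "\<rho> z < \<rho> x" "y \<noteq> z" by blast
      have xy: "x \<noteq> y" "x \<noteq> z" using xyz by auto
      let ?u = "\<Sum>i\<in>C. if \<kappa> i = 0 then s i else 0"
      have sxy: "s x \<le> s y" "s x \<le> s z" using \<rho> xyz by blast+
      have uyz: "s y + s z \<le> ?u"
      proof -
        have "(\<Sum>i\<in>{y, z}. if \<kappa> i = 0 then s i else 0) \<le> ?u"
          using xyz s0 assms(1) by (intro sum_mono2) auto
        then show ?thesis using xyz by simp
      qed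
      have "\<exists>\<kappa>'. (\<Sum>i\<in>C. if \<kappa>' i = 0 then M - \<rho> i else 0) < (\<Sum>i\<in>C. if \<kappa> i = 0 then M - \<rho> i else 0) \<and>
        (\<forall>i\<in>C. \<kappa>' i \<noteq> 0 \<longrightarrow> F i (\<kappa>' i)) \<and> alloc_size C \<kappa>' = alloc_size C \<kappa> \<and>
        alloc_value W s b C \<kappa> \<le> alloc_value W s b C \<kappa>'"
      proof (cases "\<kappa> x = 1")
        case True
        define \<kappa>' where "\<kappa>' = \<kappa>(x := 0, y := 1)"
        have upd: "(\<Sum>i\<in>C. g i (\<kappa>' i)) = (\<Sum>i\<in>C. g i (\<kappa> i)) - g x 1 + g x 0 - g y 0 + g y 1"
          for g :: "'i \<Rightarrow> nat \<Rightarrow> real"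
          unfolding \<kappa>'_def using sum_upd_remove[OF assms(1) xyz(2), of g "\<kappa>(x := 0)" 1]
            sum_upd_remove[OF assms(1) xyz(1), of g \<kappa> 0] True xyz xy by simp
        have updn: "(\<Sum>i\<in>C. g i (\<kappa>' i)) + g x 1 + g y 0 = (\<Sum>i\<in>C. g i (\<kappa> i)) + g x 0 + g y 1"
          for g :: "'i \<Rightarrow> nat \<Rightarrow> nat"
          unfolding \<kappa>'_def using sum_upd_remove_nat[OF assms(1) xyz(2), of g "\<kappa>(x := 0)" 1]
            sum_upd_remove_nat[OF assms(1) xyz(1), of g \<kappa> 0] True xyz xy by simp
        have ex: "\<exists>i\<in>C. \<kappa>' i = 0" "\<exists>i\<in>C. \<kappa> i = 0" using xyz xy by (auto simp: \<kappa>'_def)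
        have "alloc_size C \<kappa>' = alloc_size C \<kappa>"
          using ex updn[of "\<lambda>_ k. k"] by (simp add: alloc_size_def)
        moreover have "(\<Sum>i\<in>C. if \<kappa>' i = 0 then M - \<rho> i else 0) < (\<Sum>i\<in>C. if \<kappa> i = 0 then M - \<rho> i else 0)"
          using updn[of "\<lambda>i k. if k = 0 then M - \<rho> i else 0"] xyz(7) \<rho>M[OF xyz(1)] by simp
        moreover have "\<forall>i\<in>C. \<kappa>' i \<noteq> 0 \<longrightarrow> F i (\<kappa>' i)"
          using less.prems F1 by (auto simp: \<kappa>'_def)
        moreover have "alloc_value W s b C \<kappa> \<le> alloc_value W s b C \<kappa>'"
        proof -
          \<comment> \<open>\<open>x\<close> and \<open>y\<close> change places: concavity, with the
            rest of \<open>other\<close> as the common increment of both weights.\<close>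
          have "eta W (s y + (?u - s y)) + eta W (s x) \<le> eta W (s y) + eta W (s x + (?u - s y))"
            using assms(2) s0 xyz sxy uyz by (intro eta_increment_antimono) (use s0[OF xyz(1)] s0[OF xyz(3)] in linarith)+
          moreover have "(\<Sum>i\<in>C. if \<kappa>' i = 0 then s i else 0) = s x + (?u - s y)"
            using upd[of "\<lambda>i k. if k = 0 then s i else 0"] by simp
          moreover have "(\<Sum>i\<in>C. if \<kappa>' i = 0 then 0 else b i (\<kappa>' i)) =
              (\<Sum>i\<in>C. if \<kappa> i = 0 then 0 else b i (\<kappa> i)) - eta W (s x) + eta W (s y)"
            using upd[of "\<lambda>i k. if k = 0 then 0 else b i k"] F1[OF xyz(1)] F1[OF xyz(2)] by simp
          ultimately show ?thesis using ex by (simp add: alloc_value_def)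
        qed
        ultimately show ?thesis by blast
      next
        case False
        then obtain k where k: "\<kappa> x = Suc k" "k \<noteq> 0" using xyz(4) by (cases "\<kappa> x") auto
        define \<kappa>' where "\<kappa>' = \<kappa>(x := k, y := 1)"
        have upd: "(\<Sum>i\<in>C. g i (\<kappa>' i)) = (\<Sum>i\<in>C. g i (\<kappa> i)) - g x (Suc k) + g x k - g y 0 + g y 1"
          for g :: "'i \<Rightarrow> nat \<Rightarrow> real"
          unfolding \<kappa>'_def using sum_upd_remove[OF assms(1) xyz(2), of g "\<kappa>(x := k)" 1]
            sum_upd_remove[OF assms(1) xyz(1), of g \<kappa> k] k xyz xy by simp
        have updn: "(\<Sum>i\<in>C. g i (\<kappa>' i)) + g x (Suc k) + g y 0 = (\<Sum>i\<in>C. g i (\<kappa> i)) + g x k + g y 1"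
          for g :: "'i \<Rightarrow> nat \<Rightarrow> nat"
          unfolding \<kappa>'_def using sum_upd_remove_nat[OF assms(1) xyz(2), of g "\<kappa>(x := k)" 1]
            sum_upd_remove_nat[OF assms(1) xyz(1), of g \<kappa> k] k xyz xy by simp
        have ex: "\<exists>i\<in>C. \<kappa>' i = 0" "\<exists>i\<in>C. \<kappa> i = 0" using xyz xy by (auto simp: \<kappa>'_def)
        have Fk: "F x k" "b x (Suc k) - split_gain W (s x) (s x) \<le> b x k"
          using F2[OF xyz(1), of k] less.prems xyz(1) k by auto
        have "alloc_size C \<kappa>' = alloc_size C \<kappa>"
          using ex updn[of "\<lambda>_ k. k"] by (simp add: alloc_size_def)
        moreover have "(\<Sum>i\<in>C. if \<kappa>' i = 0 then M - \<rho> i else 0) < (\<Sum>i\<in>C. if \<kappa> i = 0 then M - \<rho> i else 0)"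
          using updn[of "\<lambda>i k. if k = 0 then M - \<rho> i else 0"] k \<rho>M[OF xyz(2)] by simp
        moreover have "\<forall>i\<in>C. \<kappa>' i \<noteq> 0 \<longrightarrow> F i (\<kappa>' i)"
          using less.prems F1 Fk by (auto simp: \<kappa>'_def)
        moreover have "alloc_value W s b C \<kappa> \<le> alloc_value W s b C \<kappa>'"
        proof -
          \<comment> \<open>The right side is the gain of pulling \<open>y\<close> out. What remains
            in \<open>other\<close> still contains \<open>z\<close> and thus weighs at least
            \<open>s x\<close>, so the gain covers the bound on the cost of shrinking
            \<open>x\<close>.\<close>
          have "split_gain W (s x) (s x) \<le> split_gain W (s y) (?u - s y)"
            using assms(2) s0[OF xyz(1)] sxy uyz by (intro split_gain_mono) auto
          moreover have "(\<Sum>i\<in>C. if \<kappa>' i = 0 then s i else 0) = ?u - s y"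
            using upd[of "\<lambda>i k. if k = 0 then s i else 0"] k by simp
          moreover have "(\<Sum>i\<in>C. if \<kappa>' i = 0 then 0 else b i (\<kappa>' i)) =
              (\<Sum>i\<in>C. if \<kappa> i = 0 then 0 else b i (\<kappa> i)) - b x (Suc k) + b x k + eta W (s y)"
            using upd[of "\<lambda>i k. if k = 0 then 0 else b i k"] F1[OF xyz(2)] k by simp
          ultimately show ?thesis using ex Fk by (simp add: alloc_value_def split_gain_def)
        qed
        ultimately show ?thesis by blast
      qed
      then obtain \<kappa>' where *: "(\<Sum>i\<in>C. if \<kappa>' i = 0 then M - \<rho> i else 0) < (\<Sum>i\<in>C. if \<kappa> i = 0 then M - \<rho> i else 0)"
        "\<forall>i\<in>C. \<kappa>' i \<noteq> 0 \<longrightarrow> F i (\<kappa>' i)" "alloc_size C \<kappa>' = alloc_size C \<kappa>"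
        "alloc_value W s b C \<kappa> \<le> alloc_value W s b C \<kappa>'" by blast
      from less.hyps[OF *(1,2)] show ?thesis
        unfolding *(3) by (elim exE conjE, intro exI conjI) (assumption | rule order.trans[OF *(4)])+
    qed
  qed
qed

lemma alloc_size_cong:
  assumes "\<And>c. c \<in> C \<Longrightarrow> \<kappa> c = \<kappa>' c"
  shows "alloc_size C \<kappa> = alloc_size C \<kappa>'"
proof -
  have "(\<exists>c\<in>C. \<kappa> c = 0) = (\<exists>c\<in>C. \<kappa>' c = 0)" using assms by simp
  moreover have "(\<Sum>c\<in>C. \<kappa> c) = (\<Sum>c\<in>C. \<kappa>' c)" using assms by (intro sum.cong refl)
  ultimately show ?thesis by (simp only: alloc_size_def)
qed

lemma alloc_value_cong:
  assumes "\<And>c. c \<in> C \<Longrightarrow> \<kappa> c = \<kappa>' c"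
  shows "alloc_value W s b C \<kappa> = alloc_value W s b C \<kappa>'"
proof -
  have "(\<exists>c\<in>C. \<kappa> c = 0) = (\<exists>c\<in>C. \<kappa>' c = 0)" using assms by simp
  moreover have "(\<Sum>c\<in>C. if \<kappa> c = 0 then s c else 0) = (\<Sum>c\<in>C. if \<kappa>' c = 0 then s c else 0)"
    using assms by (intro sum.cong refl) simp
  moreover have "(\<Sum>c\<in>C. if \<kappa> c = 0 then 0 else b c (\<kappa> c)) =
      (\<Sum>c\<in>C. if \<kappa>' c = 0 then 0 else b c (\<kappa>' c))"
    using assms by (intro sum.cong refl) simp
  ultimately show ?thesis by (simp only: alloc_value_def)
qed

section \<open>Trees given by parent arrays\<close>

fun subtree_set :: "'a rtree \<Rightarrow> 'a rtree set" where
  "subtree_set (Node v ts) = insert (Node v ts) (\<Union>t\<in>set ts. subtree_set t)"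

lemma self_in_subtree_set [simp]: "t \<in> subtree_set t"
  by (cases t) simp

lemma subtree_set_trans: "s \<in> subtree_set t \<Longrightarrow> t \<in> subtree_set u \<Longrightarrow> s \<in> subtree_set u"
  by (induction u) auto

lemma subtrees_in_subtree_set: "t \<in> set (subtrees s) \<Longrightarrow> t \<in> subtree_set s"
  using self_in_subtree_set by (cases s) fastforce

lemma subtree_set_nodes: "s \<in> subtree_set t \<Longrightarrow> nodes s \<subseteq> nodes t"
  by (induction t) auto

lemma subtree_set_edges: "s \<in> subtree_set t \<Longrightarrow> edges s \<subseteq> edges t"
  by (induction t) auto

lemma subtree_set_distinct:
  "s \<in> subtree_set t \<Longrightarrow> distinct (node_list t) \<Longrightarrow> distinct (node_list s)"
proof (induction t)
  case (Node v ts)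
  then show ?case using distinct_node_list_NodeD(3)[OF Node.prems(2)] by auto
qed

lemma nodes_subtree_set: "nodes t = root ` subtree_set t"
  by (induction t) (auto simp: image_UN)

lemma subtree_set_parent:
  "s \<in> subtree_set t \<Longrightarrow> s = t \<or> (\<exists>u\<in>subtree_set t. s \<in> set (subtrees u))"
  by (induction t) (auto; metis rtree.sel(2) self_in_subtree_set)

text \<open>Distinct labels allow a subtree to be addressed by the number of its root;
  \<open>st\<close> rests on this.\<close>

lemma inj_on_root_subtree_set:
  "distinct (node_list t) \<Longrightarrow> inj_on root (subtree_set t)"
proof (induction t)
  case (Node v ts)
  note d = distinct_node_list_NodeD[OF Node.prems]
  have r: "root s \<in> nodes t" if "s \<in> subtree_set t" for s t :: "'a rtree"
    using that subtree_set_nodes by fastforce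
  have eq: "s = s'"
    if "t \<in> set ts" "t' \<in> set ts" "s \<in> subtree_set t" "s' \<in> subtree_set t'" "root s = root s'"
    for s s' t t'
  proof (cases "t = t'")
    case True
    then show ?thesis using Node.IH[OF that(1) d(3)[OF that(1)]] that by (auto dest: inj_onD)
  next
    case False
    then show ?thesis using d(4)[OF that(1,2)] r[OF that(3)] r[OF that(4)] that(5) by auto
  qed
  have "root s \<noteq> v" if "t \<in> set ts" "s \<in> subtree_set t" for s t
    using d(2)[OF that(1)] r[OF that(2)] by auto
  then show ?case using eq by (auto simp: inj_on_def)
qed

lemma edges_child: "c \<in> set (subtrees t) \<Longrightarrow> (root c, root t) \<in> edges t"
  by (cases t) auto

lemma num_nodes_subtrees: "c \<in> set (subtrees t) \<Longrightarrow> num_nodes c < num_nodes t"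
proof (cases t)
  case (Node v ts)
  assume "c \<in> set (subtrees t)"
  then have "num_nodes c \<le> (\<Sum>t\<leftarrow>ts. num_nodes t)"
    by (simp add: Node member_le_sum_list)
  then show ?thesis by (simp add: Node num_nodes_Node)
qed

lemma num_nodes_subtree_set: "s \<in> subtree_set t \<Longrightarrow> num_nodes s \<le> num_nodes t"
proof (induction t)
  case (Node v ts)
  show ?case
  proof (cases "s = Node v ts")
    case False
    then obtain t where t: "t \<in> set ts" "s \<in> subtree_set t" using Node.prems by auto
    have "num_nodes t < num_nodes (Node v ts)" using num_nodes_subtrees[of t "Node v ts"] t(1) by simp
    then show ?thesis using Node.IH[OF t] by linarith
  qed simp
qed

section \<open>Subtrees and optimal values, indexed by node number\<close>

locale weighted_tree =
  fixes n K :: nat and T :: "nat rtree" and w :: "nat \<Rightarrow> real" and p :: "nat \<Rightarrow> nat"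
  assumes parent_array: "parent_array n p T"
    and weight_nonneg: "\<And>v. v \<in> nodes T \<Longrightarrow> 0 \<le> w v"
    and weight_pos: "0 < sum w (nodes T)"
    and K_pos: "1 \<le> K"
begin

definition "W = sum w (nodes T)"
definition "rt = root T"
definition "st v = (THE t. t \<in> subtree_set T \<and> root t = v)"
definition "Ch v = root ` set (subtrees (st v))"
definition "sz v = num_nodes (st v)"
definition "sw v = tree_weight w (st v)"
definition "achv v k x \<longleftrightarrow> achieves W w (st v) k x"
definition "feas v k \<longleftrightarrow> (\<exists>x. achv v k x)"
definition "best v k = Max {x. achv v k x}"

lemma W_pos: "0 < W" using weight_pos by (simp add: W_def)

lemma dist_T: "distinct (node_list T)" and nodes_T: "nodes T = {..<n}"
  using parent_array by (auto simp: parent_array_def)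

lemma n_pos: "0 < n" using nodes_T root_in_nodes[of T] by auto

lemma rt_less: "rt < n" using nodes_T root_in_nodes[of T] by (auto simp: rt_def)

lemma p_rt: "p rt = rt" using parent_array by (auto simp: parent_array_def rt_def)

lemma st:
  assumes "v < n" shows "st v \<in> subtree_set T \<and> root (st v) = v"
proof -
  from assms have "v \<in> root ` subtree_set T" using nodes_T nodes_subtree_set[of T] by auto
  then obtain t where t: "t \<in> subtree_set T \<and> root t = v" by auto
  moreover have "s = t" if "s \<in> subtree_set T \<and> root s = v" for s
    using inj_on_root_subtree_set[OF dist_T] that t by (auto dest: inj_onD)
  ultimately show ?thesis unfolding st_def by (rule theI)
qed

lemma st_root [simp]: "v < n \<Longrightarrow> root (st v) = v" using st by blast

lemma root_less: "t \<in> subtree_set T \<Longrightarrow> root t < n"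
  using subsetD[OF subtree_set_nodes root_in_nodes, of t T] nodes_T by simp

lemma st_eq: "t \<in> subtree_set T \<Longrightarrow> st (root t) = t"
  using st[OF root_less, of t] inj_on_root_subtree_set[OF dist_T] by (auto dest: inj_onD)

lemma st_rt: "st rt = T" unfolding rt_def by (rule st_eq) simp

lemma dist_st: "v < n \<Longrightarrow> distinct (node_list (st v))"
  using st subtree_set_distinct[OF _ dist_T] by blast

lemma subtrees_st: "v < n \<Longrightarrow> t \<in> set (subtrees (st v)) \<Longrightarrow> t \<in> subtree_set T"
  using st subtrees_in_subtree_set subtree_set_trans by blast

lemma st_Node: "v < n \<Longrightarrow> st v = Node v (subtrees (st v))"
  using st_root[of v] by (cases "st v") simp

lemma set_subtrees_st: "v < n \<Longrightarrow> set (subtrees (st v)) = st ` Ch v"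
  unfolding Ch_def image_image using st_eq subtrees_st by (auto simp: image_iff)

lemma finite_Ch [simp]: "finite (Ch v)" by (simp add: Ch_def)

lemma Ch_less: "v < n \<Longrightarrow> c \<in> Ch v \<Longrightarrow> c < n"
  using root_less subtrees_st by (auto simp: Ch_def)

lemma inj_st: "inj_on st {..<n}" by (rule inj_on_inverseI[of _ root]) simp

lemma inj_st_Ch: "v < n \<Longrightarrow> inj_on st (Ch v)"
  using inj_st by (rule inj_on_subset) (auto dest: Ch_less)

lemma sz_Ch: "v < n \<Longrightarrow> c \<in> Ch v \<Longrightarrow> sz c < sz v"
  using num_nodes_subtrees[of "st c" "st v"] set_subtrees_st[of v] by (auto simp: sz_def)

lemma sz_le: "v < n \<Longrightarrow> sz v \<le> n"
proof -
  have "num_nodes T = card (nodes T)"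
    unfolding num_nodes_def using distinct_card[OF dist_T] by simp
  then have "num_nodes T = n" by (simp add: nodes_T)
  then show ?thesis if "v < n" using st[OF that] num_nodes_subtree_set by (auto simp: sz_def)
qed

lemma sz_rt: "sz rt = n"
  using distinct_card[OF dist_T] by (simp add: sz_def st_rt num_nodes_def nodes_T)

text \<open>The program knows the tree only through \<open>p\<close>, while the recursion follows
  the datatype; here the two meet. The clause \<open>c \<noteq> rt\<close> removes the self-loop of
  the root. That the root is nobody's child follows from sizes: a child is strictly smaller than its
  parent's subtree, which has at most n nodes.\<close>

lemma Ch_iff:
  assumes "v < n"
  shows "c \<in> Ch v \<longleftrightarrow> c < n \<and> c \<noteq> rt \<and> p c = v"
proof
  assume c: "c \<in> Ch v"
  then obtain t where t: "t \<in> set (subtrees (st v))" "root t = c" by (auto simp: Ch_def)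
  have "(c, v) \<in> edges T"
    using edges_child[OF t(1)] t(2) st[OF assms] subtree_set_edges[of "st v" T] assms by auto
  then have "p c = v" using parent_array by (auto simp: parent_array_def)
  moreover have "c \<noteq> rt" using sz_Ch[OF assms c] sz_rt sz_le[OF assms] by auto
  ultimately show "c < n \<and> c \<noteq> rt \<and> p c = v" using Ch_less[OF assms c] by simp
next
  assume c: "c < n \<and> c \<noteq> rt \<and> p c = v"
  then have "st c \<noteq> T" using st_root[of c] unfolding rt_def by metis
  then obtain u where u: "u \<in> subtree_set T" "st c \<in> set (subtrees u)"
    using subtree_set_parent[of "st c" T] st[of c] c by auto
  then have "(c, root u) \<in> edges T"
    using edges_child[OF u(2)] subtree_set_edges[OF u(1)] c by auto
  then have "p c = root u" using parent_array by (auto simp: parent_array_def)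
  then have "u = st v" using st_eq[OF u(1)] c by simp
  then show "c \<in> Ch v" using u(2) c by (force simp: Ch_def)
qed

lemma p_less: "v < n \<Longrightarrow> p v < n"
proof (cases "v = rt")
  case True
  then show ?thesis using p_rt rt_less by simp
next
  case False
  assume v: "v < n"
  have "st v \<noteq> T" using False st_root[OF v] unfolding rt_def by metis
  then obtain u where u: "u \<in> subtree_set T" "st v \<in> set (subtrees u)"
    using subtree_set_parent[of "st v" T] st[OF v] by auto
  have "v \<in> Ch (root u)" unfolding Ch_def st_eq[OF u(1)] using u(2) st_root[OF v] by force
  then have "p v = root u" using Ch_iff[OF root_less[OF u(1)]] by simp
  then show ?thesis using root_less[OF u(1)] by simp
qed

lemma p_eq_iff: "v < n \<Longrightarrow> p v = v \<longleftrightarrow> v = rt"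
  using p_rt Ch_iff[of v v] sz_Ch[of v v] by auto

lemma in_Ch_p: "v < n \<Longrightarrow> v \<noteq> rt \<Longrightarrow> v \<in> Ch (p v)"
  using Ch_iff[OF p_less] by simp

lemma Ch_disjoint: "u < n \<Longrightarrow> v < n \<Longrightarrow> u \<noteq> v \<Longrightarrow> Ch u \<inter> Ch v = {}"
  using Ch_iff by auto

lemma rt_notin_Ch: "v < n \<Longrightarrow> rt \<notin> Ch v" using Ch_iff by simp

lemma sum_subtrees_st:
  "v < n \<Longrightarrow> (\<Sum>t\<in>set (subtrees (st v)). g t) = (\<Sum>c\<in>Ch v. g (st c))"
  by (simp add: set_subtrees_st sum.reindex[OF inj_st_Ch])

lemma distinct_subtrees_st: "v < n \<Longrightarrow> distinct (subtrees (st v))"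
  using dist_st[of v] st_Node[of v] distinct_node_list_NodeD(1) by metis

lemma sz_eq: "v < n \<Longrightarrow> sz v = 1 + (\<Sum>c\<in>Ch v. sz c)"
  unfolding sz_def
  by (subst st_Node, assumption)
    (simp add: num_nodes_Node sum_list_distinct_conv_sum_set distinct_subtrees_st sum_subtrees_st)

lemma sw_eq: "v < n \<Longrightarrow> sw v = w v + (\<Sum>c\<in>Ch v. sw c)"
proof -
  assume v: "v < n"
  have "distinct (node_list (Node v (subtrees (st v))))"
    using dist_st[OF v] st_Node[OF v] by simp
  from tree_weight_Node[OF this, of w] show ?thesis
    unfolding sw_def st_Node[OF v, symmetric] sum_subtrees_st[OF v] .
qed

lemma nodes_st: "v < n \<Longrightarrow> nodes (st v) = insert v (\<Union>c\<in>Ch v. nodes (st c))"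
  by (subst st_Node, assumption) (simp add: set_subtrees_st)

lemma nodes_st_less: "v < n \<Longrightarrow> u \<in> nodes (st v) \<Longrightarrow> u < n"
  using st subtree_set_nodes nodes_T by blast

lemma sw_nonneg: "v < n \<Longrightarrow> 0 \<le> sw v"
  unfolding sw_def using weight_nonneg nodes_T nodes_st_less by (intro sum_nonneg) auto

lemma finite_achv: "v < n \<Longrightarrow> finite {x. achv v k x}"
proof -
  assume v: "v < n"
  have "{x. achv v k x} \<subseteq> tree_value W w ` {S. summary_tree (st v) S}"
    by (auto simp: achv_def achieves_def)
  then show ?thesis using finite_summary_trees[OF dist_st[OF v]] finite_subset by blast
qed

lemma achv_best: "v < n \<Longrightarrow> feas v k \<Longrightarrow> achv v k (best v k)"
  using Max_in[OF finite_achv[of v k]] by (auto simp: feas_def best_def)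

lemma achv_le_best: "v < n \<Longrightarrow> achv v k x \<Longrightarrow> x \<le> best v k"
  unfolding best_def by (intro Max_ge finite_achv) auto

lemma best_eqI:
  "v < n \<Longrightarrow> achv v k x \<Longrightarrow> (\<And>y. achv v k y \<Longrightarrow> y \<le> x) \<Longrightarrow> best v k = x"
  unfolding best_def by (intro Max_eqI finite_achv) auto

lemma feas_bounds: "v < n \<Longrightarrow> feas v k \<Longrightarrow> 1 \<le> k \<and> k \<le> sz v"
  unfolding feas_def achv_def sz_def using achieves_bounds[OF dist_st] by blast

lemma feas_1: "feas v 1"
  unfolding feas_def achv_def using achieves_1 by blast

lemma achv_1_iff: "v < n \<Longrightarrow> achv v 1 x \<longleftrightarrow> x = eta W (sw v)"
  unfolding achv_def sw_def by (rule achieves_1_iff[OF dist_st])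

lemma best_1: "v < n \<Longrightarrow> best v 1 = eta W (sw v)"
  using achv_best[OF _ feas_1] achv_1_iff by blast

lemma feas_pred:
  assumes "v < n" "feas v (Suc k)" "k \<noteq> 0"
  shows "feas v k \<and> best v (Suc k) - split_gain W (sw v) (sw v) \<le> best v k"
proof -
  have "achieves W w (st v) (Suc k) (best v (Suc k))"
    using achv_best[OF assms(1,2)] by (simp add: achv_def)
  moreover have "0 \<le> w u" if "u \<in> nodes (st v)" for u
    using nodes_st_less[OF assms(1) that] weight_nonneg nodes_T by simp
  ultimately obtain y where "achieves W w (st v) k y" "best v (Suc k) - split_gain W (sw v) (sw v) \<le> y"
    using achieves_pred[OF dist_st[OF assms(1)] _ W_pos] assms(3) unfolding sw_def by metis
  then show ?thesis using achv_le_best[OF assms(1)] by (auto simp: feas_def achv_def intro: order.trans)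
qed

text \<open>Downward induction from the full expansion. It guarantees that an optimum exists at the
  root for every k up to n.\<close>

lemma feas_le_sz: "v < n \<Longrightarrow> 1 \<le> k \<Longrightarrow> k \<le> sz v \<Longrightarrow> feas v k"
proof (induction "sz v - k" arbitrary: k)
  case 0
  then have "k = sz v" by simp
  then show ?case using achieves_num_nodes[OF dist_st[OF 0(2)]] by (simp add: feas_def achv_def sz_def)
next
  case (Suc m)
  then have "feas v (Suc k)" by (intro Suc.hyps(1)) auto
  then show ?case using feas_pred[of v k] Suc.prems by simp
qed

text \<open>A plan for \<open>v\<close> lists the children that are not merged into \<open>other\<close>, with the number of
  nodes allotted to each.\<close>

definition "valid v L \<longleftrightarrow> distinct (map fst L) \<and> fst ` set L \<subseteq> Ch v \<and> (\<forall>(c, k)\<in>set L. feas c k)"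

definition "alloc L c = (case map_of L c of None \<Rightarrow> 0 | Some k \<Rightarrow> k)"

text \<open>Whether \<open>other\<close> exists is read off the length of the plan, and in
  \<open>pval\<close> its weight is a difference. Both are available to the program as a counter and
  a running sum, without visiting the merged children.\<close>

definition "psize v L = 1 + (if length L < card (Ch v) then 1 else 0) + (\<Sum>(c, k)\<leftarrow>L. k)"

definition "pval v L = eta W (w v) +
  (if length L < card (Ch v) then eta W (sw v - w v - (\<Sum>(c, k)\<leftarrow>L. sw c)) else 0) +
  (\<Sum>(c, k)\<leftarrow>L. best c k)"

lemma assemble_alloc:
  assumes v: "v < n"
    and g: "\<And>c. c \<in> Ch v \<Longrightarrow> \<kappa> c \<noteq> 0 \<Longrightarrow>
      summary_tree (st c) (g c) \<and> num_nodes (g c) = \<kappa> c \<and> tree_value W w (g c) = best c (\<kappa> c)"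
  defines "S \<equiv> assemble v (subtrees (st v)) (\<lambda>t. if \<kappa> (root t) = 0 then None else Some (g (root t)))"
  shows "summary_tree (st v) S" "num_nodes S = 1 + alloc_size (Ch v) \<kappa>"
    "tree_value W w S = eta W (w v) + alloc_value W sw best (Ch v) \<kappa>"
proof -
  let ?f = "\<lambda>t. if \<kappa> (root t) = 0 then None else Some (g (root t))"
  let ?ts = "subtrees (st v)"
  have d: "distinct (node_list (Node v ?ts))" using dist_st[OF v] st_Node[OF v] by simp
  have r: "root (st c) = c" if "c \<in> Ch v" for c using Ch_less[OF v that] by simp
  have ex: "(\<exists>t\<in>set ?ts. ?f t = None) \<longleftrightarrow> (\<exists>c\<in>Ch v. \<kappa> c = 0)"
    unfolding set_subtrees_st[OF v] using r by (auto split: if_splits)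
  have "summary_tree (Node v ?ts) S"
    unfolding S_def
  proof (rule summary_tree_assemble)
    fix t S' assume t: "t \<in> set ?ts" "?f t = Some S'"
    then obtain c where "c \<in> Ch v" "t = st c" using set_subtrees_st[OF v] by auto
    then show "summary_tree t S'" using t g[of c] r[of c] by (auto split: if_splits)
  qed
  then show "summary_tree (st v) S" using st_Node[OF v] by simp
  have "(\<Sum>c\<in>Ch v. case ?f (st c) of None \<Rightarrow> 0 | Some S \<Rightarrow> num_nodes S) = (\<Sum>c\<in>Ch v. \<kappa> c)"
    by (intro sum.cong) (use r g in auto)
  then show "num_nodes S = 1 + alloc_size (Ch v) \<kappa>"
    unfolding S_def num_nodes_assemble[OF distinct_subtrees_st[OF v]] sum_subtrees_st[OF v] ex
      alloc_size_def by simp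
  have "(\<Sum>c\<in>Ch v. case ?f (st c) of None \<Rightarrow> 0 | Some S \<Rightarrow> tree_value W w S) =
      (\<Sum>c\<in>Ch v. if \<kappa> c = 0 then 0 else best c (\<kappa> c))"
    by (intro sum.cong) (use r g in auto)
  moreover have "(\<Sum>t\<in>{t\<in>set ?ts. ?f t = None}. tree_weight w t) =
      (\<Sum>t\<in>set ?ts. if ?f t = None then tree_weight w t else 0)"
    by (rule sum.inter_filter) simp
  moreover have "\<dots> = (\<Sum>c\<in>Ch v. if \<kappa> c = 0 then sw c else 0)"
    unfolding sum_subtrees_st[OF v] by (intro sum.cong) (use r in \<open>auto simp: sw_def\<close>)
  ultimately show "tree_value W w S = eta W (w v) + alloc_value W sw best (Ch v) \<kappa>"
    unfolding S_def tree_value_assemble[OF d] sum_subtrees_st[OF v] ex alloc_value_def by simp force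
qed

lemma achv_alloc:
  assumes "v < n" "\<forall>c\<in>Ch v. \<kappa> c \<noteq> 0 \<longrightarrow> feas c (\<kappa> c)"
  shows "achv v (1 + alloc_size (Ch v) \<kappa>) (eta W (w v) + alloc_value W sw best (Ch v) \<kappa>)"
proof -
  have "\<exists>S. summary_tree (st c) S \<and> num_nodes S = \<kappa> c \<and> tree_value W w S = best c (\<kappa> c)"
    if "c \<in> Ch v" "\<kappa> c \<noteq> 0" for c
    using achv_best[OF Ch_less[OF assms(1) that(1)]] assms(2) that
    unfolding achv_def achieves_def by blast
  then obtain g where "\<And>c. c \<in> Ch v \<Longrightarrow> \<kappa> c \<noteq> 0 \<Longrightarrow>
      summary_tree (st c) (g c) \<and> num_nodes (g c) = \<kappa> c \<and> tree_value W w (g c) = best c (\<kappa> c)"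
    by metis
  from assemble_alloc[OF assms(1) this] show ?thesis unfolding achv_def achieves_def by blast
qed

text \<open>With the sizes fixed, the value is additive over the unmerged children, so each may be
  given its best value.\<close>

lemma achv_alloc_complete:
  assumes v: "v < n" and a: "achv v k x" "k \<noteq> 1"
  obtains \<kappa> where "\<forall>c\<in>Ch v. \<kappa> c \<noteq> 0 \<longrightarrow> feas c (\<kappa> c)" "k = 1 + alloc_size (Ch v) \<kappa>"
    "x \<le> eta W (w v) + alloc_value W sw best (Ch v) \<kappa>"
proof -
  let ?ts = "subtrees (st v)"
  have d: "distinct (node_list (Node v ?ts))" using dist_st[OF v] st_Node[OF v] by simp
  from a(1) have "achieves W w (Node v ?ts) k x" using st_Node[OF v] by (simp add: achv_def)
  with a(2) obtain \<kappa> \<xi> where *: "\<forall>t\<in>set ?ts. \<kappa> t \<noteq> 0 \<longrightarrow> achieves W w t (\<kappa> t) (\<xi> t)"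
    "k = 1 + alloc_size (set ?ts) \<kappa>"
    "x = eta W (w v) + alloc_value W (tree_weight w) (\<lambda>t _. \<xi> t) (set ?ts) \<kappa>"
    unfolding achieves_Node_alloc[OF d] by blast
  have ex: "(\<exists>t\<in>set ?ts. \<kappa> t = 0) \<longleftrightarrow> (\<exists>c\<in>Ch v. (\<kappa> \<circ> st) c = 0)"
    unfolding set_subtrees_st[OF v] by auto
  have "\<forall>c\<in>Ch v. (\<kappa> \<circ> st) c \<noteq> 0 \<longrightarrow> achv c ((\<kappa> \<circ> st) c) (\<xi> (st c))"
    using *(1) unfolding set_subtrees_st[OF v] by (simp add: achv_def)
  then have "\<forall>c\<in>Ch v. (\<kappa> \<circ> st) c \<noteq> 0 \<longrightarrow> feas c ((\<kappa> \<circ> st) c)"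
    and le: "\<forall>c\<in>Ch v. (\<kappa> \<circ> st) c \<noteq> 0 \<longrightarrow> \<xi> (st c) \<le> best c ((\<kappa> \<circ> st) c)"
    using achv_le_best[OF Ch_less[OF v]] by (auto simp: feas_def)
  moreover have "k = 1 + alloc_size (Ch v) (\<kappa> \<circ> st)"
    using *(2) unfolding alloc_size_def ex sum_subtrees_st[OF v] by simp
  moreover have "(\<Sum>c\<in>Ch v. if \<kappa> (st c) = 0 then 0 else \<xi> (st c)) \<le>
      (\<Sum>c\<in>Ch v. if (\<kappa> \<circ> st) c = 0 then 0 else best c ((\<kappa> \<circ> st) c))"
    using le by (intro sum_mono) auto
  then have "x \<le> eta W (w v) + alloc_value W sw best (Ch v) (\<kappa> \<circ> st)"
    using *(3) unfolding alloc_value_def ex sum_subtrees_st[OF v] sw_def[symmetric]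
    unfolding comp_def by linarith
  ultimately show ?thesis using that by blast
qed

lemma alloc_plan:
  assumes "v < n" "valid v L"
  shows "1 + alloc_size (Ch v) (alloc L) = psize v L"
    "eta W (w v) + alloc_value W sw best (Ch v) (alloc L) = pval v L"
    "\<forall>c\<in>Ch v. alloc L c \<noteq> 0 \<longrightarrow> feas c (alloc L c)"
proof -
  let ?O = "set (map fst L)"
  have d: "distinct (map fst L)" and sub: "?O \<subseteq> Ch v" using assms(2) by (auto simp: valid_def)
  have al: "alloc L c = k" if "(c, k) \<in> set L" for c k
    using that d by (simp add: alloc_def)
  have f: "feas c k \<and> k \<noteq> 0" if "(c, k) \<in> set L" for c k
  proof -
    have "feas c k" "c < n" using that assms(2) Ch_less[OF assms(1)] by (auto simp: valid_def)
    then show ?thesis using feas_bounds by fastforce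
  qed
  have 0: "alloc L c = 0 \<longleftrightarrow> c \<notin> ?O" for c
  proof (cases "c \<in> ?O")
    case True
    then obtain k where "(c, k) \<in> set L" by auto
    then show ?thesis using al f True by fastforce
  next
    case False
    then show ?thesis by (simp add: alloc_def map_of_eq_None_iff[THEN iffD2] image_image)
  qed
  have sumL: "(\<Sum>(c, k)\<leftarrow>L. h c k) = (\<Sum>c\<in>?O. h c (alloc L c))" for h :: "nat \<Rightarrow> nat \<Rightarrow> 'z::comm_monoid_add"
  proof -
    have "(\<Sum>(c, k)\<leftarrow>L. h c k) = (\<Sum>c\<leftarrow>map fst L. h c (alloc L c))"
      unfolding map_map using al by (intro arg_cong[where f = sum_list] map_cong) auto
    then show ?thesis unfolding sum_list_distinct_conv_sum_set[OF d] .
  qed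
  have split: "(\<Sum>c\<in>Ch v. h c) = (\<Sum>c\<in>?O. h c) + (\<Sum>c\<in>Ch v - ?O. h c)"
    for h :: "nat \<Rightarrow> 'z::comm_monoid_add"
    using sum.subset_diff[OF sub, of h] by (simp add: add.commute)
  have cO: "card ?O = length L" using distinct_card[OF d] by simp
  have ex: "(\<exists>c\<in>Ch v. alloc L c = 0) \<longleftrightarrow> length L < card (Ch v)"
  proof
    assume "\<exists>c\<in>Ch v. alloc L c = 0"
    then have "?O \<subset> Ch v" using 0 sub by blast
    then show "length L < card (Ch v)" unfolding cO[symmetric] by (intro psubset_card_mono) simp_all
  next
    assume "length L < card (Ch v)"
    then have "?O \<noteq> Ch v" unfolding cO[symmetric] by auto
    then obtain c where "c \<in> Ch v" "c \<notin> ?O" using sub by blast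
    then show "\<exists>c\<in>Ch v. alloc L c = 0" using 0[of c] by blast
  qed
  have "(\<Sum>c\<in>Ch v. alloc L c) = (\<Sum>c\<in>?O. alloc L c)"
    unfolding split[of "alloc L"] using 0 by simp
  then show "1 + alloc_size (Ch v) (alloc L) = psize v L"
    unfolding alloc_size_def psize_def ex sumL[of "\<lambda>c k. k"] by simp
  have "(\<Sum>c\<in>Ch v. if alloc L c = 0 then sw c else 0) = (\<Sum>c\<in>Ch v - ?O. sw c)"
    unfolding split[of "\<lambda>c. if alloc L c = 0 then sw c else 0"] using 0 by simp
  moreover have "\<dots> = sw v - w v - (\<Sum>c\<in>?O. sw c)"
    using sw_eq[OF assms(1)] split[of sw] by simp
  moreover have "(\<Sum>c\<in>Ch v. if alloc L c = 0 then 0 else best c (alloc L c)) =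
      (\<Sum>c\<in>?O. best c (alloc L c))"
    unfolding split[of "\<lambda>c. if alloc L c = 0 then 0 else best c (alloc L c)"] using 0 by simp
  ultimately show "eta W (w v) + alloc_value W sw best (Ch v) (alloc L) = pval v L"
    unfolding alloc_value_def pval_def ex sumL by simp
  show "\<forall>c\<in>Ch v. alloc L c \<noteq> 0 \<longrightarrow> feas c (alloc L c)"
  proof (intro ballI impI)
    fix c assume "alloc L c \<noteq> 0"
    then obtain k where "(c, k) \<in> set L" using 0[of c] by auto
    then show "feas c (alloc L c)" using al f by simp
  qed
qed

lemma achv_plan: "v < n \<Longrightarrow> valid v L \<Longrightarrow> achv v (psize v L) (pval v L)"
  using achv_alloc[of v "alloc L"] alloc_plan by metis

section \<open>Plans that keep the heaviest children, with at most one exception\<close>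

definition "heaviest C L \<longleftrightarrow> distinct L \<and> set L \<subseteq> C \<and> length L = min K (card C) \<and>
  sorted_wrt (\<lambda>c d. sw d \<le> sw c) L \<and> (\<forall>c\<in>C - set L. \<forall>d\<in>set L. sw c \<le> sw d)"

text \<open>A \<open>y\<close> outside \<open>[0..<j]\<close> stands for no exception, so a single
  loop over \<open>y\<close> covers both situations.\<close>

definition "kept L y j = map ((!) L) (filter (\<lambda>i. i \<noteq> y) [0..<j])"

text \<open>The reversal reflects how plans arise: each merge puts its child in front of the
  list.\<close>

definition "plans_over X = {L. map fst L = rev X \<and> (\<forall>(c, k)\<in>set L. feas c k)}"

text \<open>A ranking of all children exists only in the proof. The exchange argument needs it,
  whereas the program stores just its beginning.\<close>

lemma sorted_extension:
  assumes "heaviest C L" "finite C"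
  obtains M where "distinct (L @ M)" "set (L @ M) = C" "sorted_wrt (\<lambda>c d. sw d \<le> sw c) (L @ M)"
proof -
  define M where "M = sort_key (\<lambda>c. - sw c) (sorted_list_of_set (C - set L))"
  have M: "set M = C - set L" "distinct M" using assms(2) by (simp_all add: M_def)
  have "sorted (map (\<lambda>c. - sw c) M)" by (simp add: M_def)
  then have "sorted_wrt (\<lambda>c d. sw d \<le> sw c) M" by (simp add: sorted_map)
  then show ?thesis
    using that[of M] assms(1) M by (auto simp: heaviest_def sorted_wrt_append)
qed

text \<open>Apply the gap condition to the maximum of \<open>I\<close>: all numbers missing below it
  coincide. The value \<open>y = d\<close> codes that none is missing.\<close>

lemma initial_segment:
  fixes I :: "nat set"
  assumes "finite I" "I \<noteq> {}" "I \<subseteq> {..<d}"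
    and gap: "\<And>x y z. x \<in> I \<Longrightarrow> y < x \<Longrightarrow> z < x \<Longrightarrow> y \<notin> I \<Longrightarrow> z \<notin> I \<Longrightarrow> y = z"
  obtains j y where "I = {..<j} - {y}" "j - 1 \<in> I" "0 < j" "y < j \<or> y = d"
proof -
  define j where "j = Suc (Max I)"
  have max: "Max I \<in> I" "\<And>i. i \<in> I \<Longrightarrow> i < j" using assms(1,2) by (auto simp: j_def less_Suc_eq_le)
  show ?thesis
  proof (cases "{..<j} \<subseteq> I")
    case True
    then have "I = {..<j} - {d}" using max assms(3) by auto
    then show ?thesis using that[of j d] max by (simp add: j_def)
  next
    case False
    then obtain y where y: "y < j" "y \<notin> I" by auto
    have "y < Max I" using y max(1) by (metis j_def less_SucE)
    have "i \<in> I" if "i < j" "i \<noteq> y" for i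
    proof (rule ccontr)
      assume "i \<notin> I"
      then have "i < Max I" using that max(1) by (metis j_def less_SucE)
      then show False using gap[OF max(1) \<open>y < Max I\<close> _ y(2) \<open>i \<notin> I\<close>] that by simp
    qed
    then have "I = {..<j} - {y}" using max y by auto
    then show ?thesis using that[of j y] max y by (simp add: j_def)
  qed
qed

lemma plan_complete:
  assumes v: "v < n" and top: "heaviest (Ch v) L0" and a: "achv v k x" "k \<noteq> 1" "k \<le> K"
  obtains y j L where "y \<le> length L0" "j \<le> length L0" "L \<in> plans_over (kept L0 y j)"
    "psize v L = k" "x \<le> pval v L"
proof -
  let ?C = "Ch v"
  from top obtain M where M: "distinct (L0 @ M)" "set (L0 @ M) = ?C"
    "sorted_wrt (\<lambda>c d. sw d \<le> sw c) (L0 @ M)" by (rule sorted_extension) simp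
  define Lf where "Lf = L0 @ M"
  define d where "d = length Lf"
  have d: "d = card ?C" unfolding d_def Lf_def using distinct_card[OF M(1)] M(2) by simp
  have m: "length L0 = min K d" using top d by (simp add: heaviest_def)
  have inj: "inj_on ((!) Lf) {..<d}" using M(1) by (simp add: inj_on_nth Lf_def d_def)
  have C: "?C = (!) Lf ` {..<d}"
    using M(2) set_conv_nth[of Lf] unfolding Lf_def[symmetric] d_def by blast
  define \<rho> where "\<rho> = inv_into {..<d} ((!) Lf)"
  have \<rho>: "\<rho> (Lf ! i) = i" if "i < d" for i
    unfolding \<rho>_def using inv_into_f_f[OF inj, of i] that by simp
  have anti: "sw c' \<le> sw c" if cc: "c \<in> ?C" "c' \<in> ?C" "\<rho> c < \<rho> c'" for c c'
  proof -
    obtain i i' where i: "i < d" "i' < d" "c = Lf ! i" "c' = Lf ! i'" using C cc(1,2) by auto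
    then have "i < i'" using cc(3) \<rho> by simp
    then show ?thesis
      using sorted_wrt_nth_less[OF M(3)[folded Lf_def], of i i'] i unfolding d_def by simp
  qed
  from achv_alloc_complete[OF v a(1,2)] obtain \<kappa>0 where \<kappa>0:
    "\<forall>c\<in>?C. \<kappa>0 c \<noteq> 0 \<longrightarrow> feas c (\<kappa>0 c)" "k = 1 + alloc_size ?C \<kappa>0"
    "x \<le> eta W (w v) + alloc_value W sw best ?C \<kappa>0" by blast
  have "\<exists>\<kappa>. (\<forall>i\<in>?C. \<kappa> i \<noteq> 0 \<longrightarrow> feas i (\<kappa> i)) \<and> alloc_size ?C \<kappa> = alloc_size ?C \<kappa>0 \<and>
    alloc_value W sw best ?C \<kappa>0 \<le> alloc_value W sw best ?C \<kappa> \<and>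
    (\<forall>x\<in>?C. \<forall>y1\<in>?C. \<forall>y2\<in>?C. \<kappa> x \<noteq> 0 \<longrightarrow> \<kappa> y1 = 0 \<longrightarrow> \<kappa> y2 = 0 \<longrightarrow>
       \<rho> y1 < \<rho> x \<longrightarrow> \<rho> y2 < \<rho> x \<longrightarrow> y1 = y2)"
    by (rule exchange[OF finite_Ch W_pos])
      (use sw_nonneg Ch_less[OF v] anti feas_1 best_1 feas_pred \<kappa>0(1) in simp_all)
  then obtain \<kappa> where \<kappa>0': "\<forall>c\<in>?C. \<kappa> c \<noteq> 0 \<longrightarrow> feas c (\<kappa> c)" "alloc_size ?C \<kappa> = alloc_size ?C \<kappa>0"
      "alloc_value W sw best ?C \<kappa>0 \<le> alloc_value W sw best ?C \<kappa>"
    and gap: "\<forall>x\<in>?C. \<forall>y1\<in>?C. \<forall>y2\<in>?C. \<kappa> x \<noteq> 0 \<longrightarrow> \<kappa> y1 = 0 \<longrightarrow> \<kappa> y2 = 0 \<longrightarrow>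
       \<rho> y1 < \<rho> x \<longrightarrow> \<rho> y2 < \<rho> x \<longrightarrow> y1 = y2"
    by (elim exE conjE)
  have \<kappa>: "\<And>c. c \<in> ?C \<Longrightarrow> \<kappa> c \<noteq> 0 \<Longrightarrow> feas c (\<kappa> c)" "k = 1 + alloc_size ?C \<kappa>"
      "x \<le> eta W (w v) + alloc_value W sw best ?C \<kappa>"
    using \<kappa>0 \<kappa>0' by simp_all
  define I where "I = {i. i < d \<and> \<kappa> (Lf ! i) \<noteq> 0}"
  have inC: "Lf ! i \<in> ?C" if "i < d" for i using C that by auto
  obtain j y where jy: "I = {..<j} - {y}" "j \<le> d" "y < j \<or> y = d" "j = 0 \<or> j - 1 \<in> I"
  proof (cases "I = {}")
    case True
    then show ?thesis using that[of 0 d] by simp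
  next
    case False
    have gap': "y = z" if "x \<in> I" "y < x" "z < x" "y \<notin> I" "z \<notin> I" for x y z
      using gap[rule_format, of "Lf ! x" "Lf ! y" "Lf ! z"] that inC \<rho> inj_onD[OF inj, of y z] by (auto simp: I_def)
    have "finite I" "I \<subseteq> {..<d}" by (auto simp: I_def)
    show ?thesis
    proof (rule initial_segment[OF \<open>finite I\<close> False \<open>I \<subseteq> {..<d}\<close>])
      show "y = z" if "x \<in> I" "y < x" "z < x" "y \<notin> I" "z \<notin> I" for x y z
        using that by (rule gap')
    next
      fix j y assume j: "I = {..<j} - {y}" "j - 1 \<in> I" "0 < j" "y < j \<or> y = d"
      moreover have "j \<le> d" using j(2,3) by (auto simp: I_def)
      ultimately show ?thesis using that by blast
    qed
  qed
  have cI: "card I \<le> (\<Sum>c\<in>?C. \<kappa> c)"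
  proof -
    have "card I = (\<Sum>i\<in>I. 1)" by simp
    also have "\<dots> \<le> (\<Sum>i\<in>I. \<kappa> (Lf ! i))" by (intro sum_mono) (auto simp: I_def)
    also have "\<dots> \<le> (\<Sum>i<d. \<kappa> (Lf ! i))" by (intro sum_mono2) (auto simp: I_def)
    also have "\<dots> = (\<Sum>c\<in>?C. \<kappa> c)" unfolding C sum.reindex[OF inj] by simp
    finally show ?thesis .
  qed
  \<comment> \<open>With more than K children some child is merged. Root and \<open>other\<close>
    then leave at most K - 2 kept children, and one gap among them still gives j at most K - 1. So
    the K heaviest children suffice.\<close>
  have jm: "j \<le> length L0"
  proof (cases "d \<le> K")
    case True
    then show ?thesis using m jy(2) by simp
  next
    case False
    have "card I < d" using cI \<kappa>(2) a(3) False unfolding alloc_size_def by auto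
    then have "I \<noteq> {..<d}" by auto
    then have ex: "\<exists>c\<in>?C. \<kappa> c = 0" using inC by (auto simp: I_def)
    have "card I + 2 \<le> K" using cI \<kappa>(2) a(3) ex unfolding alloc_size_def by auto
    moreover have "j \<le> card I + 1" unfolding jy(1) by (auto simp: card_Diff_singleton_if)
    ultimately show ?thesis using m False by simp
  qed
  \<comment> \<open>The value \<open>d\<close> for no exception may lie beyond \<open>L0\<close>;
    capped at \<open>length L0\<close> it stays outside \<open>{..<j}\<close> and comes within the
    range of the program's loop.\<close>
  define y' where "y' = min y (length L0)"
  have y': "{..<j} - {y'} = I" unfolding jy(1) y'_def using jy(3) jm m by auto
  define X where "X = kept L0 y' j"
  have X: "X = map ((!) Lf) (filter (\<lambda>i. i \<noteq> y') [0..<j])"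
    unfolding X_def kept_def Lf_def using jm by (intro map_cong) (auto simp: nth_append)
  have setX: "set X = (!) Lf ` I" unfolding X y'[symmetric] by auto
  have distX: "distinct X"
    unfolding X distinct_map using jy(2) by (intro conjI inj_on_subset[OF inj]) auto
  have kX: "\<kappa> c \<noteq> 0 \<longleftrightarrow> c \<in> set X" if "c \<in> ?C" for c
    unfolding setX using that inj_onD[OF inj] by (auto simp: C I_def)
  have XC: "set X \<subseteq> ?C" unfolding setX using inC by (auto simp: I_def)
  define L where "L = rev (map (\<lambda>c. (c, \<kappa> c)) X)"
  have fst: "map fst L = rev X" by (simp add: L_def rev_map comp_def)
  have valid: "valid v L"
    using distX XC \<kappa>(1) kX unfolding valid_def fst by (auto simp: L_def)
  have al: "alloc L c = \<kappa> c" if "c \<in> ?C" for c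
  proof (cases "c \<in> set X")
    case True
    then have "(c, \<kappa> c) \<in> set L" by (simp add: L_def)
    moreover have "distinct (map fst L)" using distX fst by simp
    ultimately show ?thesis by (simp add: alloc_def)
  next
    case False
    then have "map_of L c = None" by (auto simp: map_of_eq_None_iff L_def)
    then show ?thesis using kX[OF that] False by (simp add: alloc_def)
  qed
  have "alloc_size ?C (alloc L) = alloc_size ?C \<kappa>"
    using al by (rule alloc_size_cong)
  then have "psize v L = k" using alloc_plan(1)[OF v valid] \<kappa>(2) by simp
  moreover have "alloc_value W sw best ?C (alloc L) = alloc_value W sw best ?C \<kappa>"
    using al by (rule alloc_value_cong)
  then have "x \<le> pval v L" using alloc_plan(2)[OF v valid] \<kappa>(3) by simp
  moreover have "L \<in> plans_over X" using valid by (simp add: plans_over_def fst valid_def)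
  ultimately show ?thesis using that[of y' j L] jm by (simp add: X_def y'_def)
qed

lemma valid_kept:
  assumes "heaviest (Ch v) L0" "j \<le> length L0" "L \<in> plans_over (kept L0 y j)"
  shows "valid v L"
proof -
  have d: "distinct (kept L0 y j)"
    using assms(1,2) by (auto simp: kept_def heaviest_def distinct_map intro: inj_on_nth)
  have "set (kept L0 y j) \<subseteq> set L0" using assms(2) by (auto simp: kept_def)
  moreover have "set L0 \<subseteq> Ch v" using assms(1) by (simp add: heaviest_def)
  moreover have "map fst L = rev (kept L0 y j)" using assms(3) by (simp add: plans_over_def)
  moreover from this have "fst ` set L = set (kept L0 y j)" "distinct (map fst L)"
    using d by (metis image_set set_rev) (simp add: d \<open>map fst L = rev (kept L0 y j)\<close>)
  ultimately show ?thesis using assms(3) by (auto simp: valid_def plans_over_def)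
qed

end

section \<open>Reading a summary tree off a numbering of its nodes\<close>

lemma distinct_concat_map:
  assumes "distinct ts" "\<And>t. t \<in> set ts \<Longrightarrow> distinct (f t)"
    "\<And>t t'. t \<in> set ts \<Longrightarrow> t' \<in> set ts \<Longrightarrow> t \<noteq> t' \<Longrightarrow> set (f t) \<inter> set (f t') = {}"
  shows "distinct (concat (map f ts))"
  using assms
proof (induction ts)
  case (Cons t ts)
  have "set (f t) \<inter> set (f t') = {}" if "t' \<in> set ts" for t'
    using Cons.prems(1) that by (intro Cons.prems(3)) auto
  moreover have "distinct (concat (map f ts))"
    using Cons.prems by (intro Cons.IH) auto
  ultimately show ?case using Cons.prems(2)[of t] by auto
qed simp

lemma num_nodes_map_rtree: "num_nodes (map_rtree f t) = num_nodes t"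
proof (induction t)
  case (Node v ts)
  then have "(\<Sum>t\<leftarrow>ts. num_nodes (map_rtree f t)) = (\<Sum>t\<leftarrow>ts. num_nodes t)"
    by (intro arg_cong[where f = sum_list] map_cong) auto
  then show ?case by (simp add: num_nodes_Node comp_def)
qed

text \<open>In the following locale \<open>kk v\<close> is the number of nodes allotted to the summary tree of the
  subtree at \<open>v\<close> if \<open>v\<close> is the top node of a block of its own, and 0 otherwise; \<open>blk v\<close> is the
  number of the block of \<open>v\<close>, \<open>df v\<close> the default block of the children of \<open>v\<close> (the number of
  \<open>other\<close> if \<open>v\<close> has such a child), and \<open>sp\<close> the parent array of the summary tree.\<close>

locale numbering = weighted_tree +
  fixes kk blk df sp :: "nat \<Rightarrow> nat"
  assumes own_0: "\<And>v. v < n \<Longrightarrow> kk v = 0 \<Longrightarrow> blk v = df (p v) \<and> df v = blk v"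
    and own_le_1: "\<And>v c. v < n \<Longrightarrow> kk v \<le> 1 \<Longrightarrow> c \<in> Ch v \<Longrightarrow> kk c = 0"
    and own_1: "\<And>v. v < n \<Longrightarrow> kk v = 1 \<Longrightarrow> df v = blk v"
    and own_2: "\<And>v. v < n \<Longrightarrow> 2 \<le> kk v \<Longrightarrow> \<exists>L. valid v L \<and> psize v L = kk v \<and>
      pval v L = best v (kk v) \<and> (\<forall>c\<in>Ch v. kk c = alloc L c)"
    and sp_own: "\<And>v. v < n \<Longrightarrow> 1 \<le> kk v \<Longrightarrow> sp (blk v) = blk (p v)"
    and sp_other: "\<And>v. v < n \<Longrightarrow> 2 \<le> kk v \<Longrightarrow> \<exists>c\<in>Ch v. kk c = 0 \<Longrightarrow> sp (df v) = blk v"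
begin

text \<open>A pair \<open>(v, False)\<close> names the block with top node v, a pair
  \<open>(v, True)\<close> the node \<open>other\<close> below v.\<close>

definition "labels = {(v, b). v < n \<and> 1 \<le> kk v \<and> (b \<longrightarrow> 2 \<le> kk v \<and> (\<exists>c\<in>Ch v. kk c = 0))}"

fun label_id where "label_id (v, b) = (if b then df v else blk v)"

text \<open>Being merged is inherited: below a node without a block of its own no node has one, and
  the default number is passed down unchanged.\<close>

lemma not_own:
  "v < n \<Longrightarrow> kk v = 0 \<Longrightarrow> u \<in> nodes (st v) \<Longrightarrow> kk u = 0 \<and> blk u = blk v"
proof (induction "sz v" arbitrary: v rule: less_induct)
  case less
  show ?case
  proof (cases "u = v")
    case False
    then obtain c where c: "c \<in> Ch v" "u \<in> nodes (st c)"
      using less.prems(3) nodes_st[OF less.prems(1)] by auto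
    have cn: "c < n" and kc: "kk c = 0" and pc: "p c = v"
      using Ch_iff[OF less.prems(1)] c(1) own_le_1[OF less.prems(1) _ c(1)] less.prems(2) by auto
    have "blk c = blk v" using own_0[OF cn kc] own_0[OF less.prems(1,2)] pc by simp
    then show ?thesis using less.hyps[OF sz_Ch[OF less.prems(1) c(1)] cn kc c(2)] by simp
  qed (use less.prems in simp)
qed

text \<open>The tree \<open>N\<close> of block numbers is built along with \<open>S\<close>.
  Injectivity keeps the number trees of different children disjoint. The last conjunct strengthens
  the induction: it confines the numbers occurring in a subtree to \<open>N\<close>, so that
  collecting the nodes with a given number over a larger subtree adds nothing to that block.\<close>

lemma summary_numbering:
  assumes inj: "inj_on label_id labels"
  shows "v < n \<Longrightarrow> 1 \<le> kk v \<Longrightarrow> \<exists>S N. summary_tree (st v) S \<and> num_nodes S = kk v \<and>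
    tree_value W w S = best v (kk v) \<and> distinct (node_list N) \<and> root N = blk v \<and>
    nodes N = label_id ` (labels \<inter> nodes (st v) \<times> UNIV) \<and> (\<forall>(x, y)\<in>edges N. sp x = y) \<and>
    S = map_rtree (\<lambda>j. {u \<in> nodes (st v). blk u = j}) N \<and> blk ` nodes (st v) \<subseteq> nodes N"
    (is "_ \<Longrightarrow> _ \<Longrightarrow> \<exists>S N. ?P v S N")
proof (induction "sz v" arbitrary: v rule: less_induct)
  case less
  note v = less.prems(1)
  have pc: "p c = v" "c < n" if "c \<in> Ch v" for c using Ch_iff[OF v] that by auto
  have lv: "(v, False) \<in> labels" using less.prems by (simp add: labels_def)
  have vc: "v \<notin> nodes (st c)" if "c \<in> Ch v" for c
  proof -
    have "distinct (node_list (Node v (subtrees (st v))))" using dist_st[OF v] st_Node[OF v] by simp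
    then show ?thesis
      using distinct_node_list_NodeD(2)[of v _ "st c"] that set_subtrees_st[OF v] by blast
  qed
  have disj: "nodes (st c) \<inter> nodes (st c') = {}" if "c \<in> Ch v" "c' \<in> Ch v" "c \<noteq> c'" for c c'
  proof -
    have "distinct (node_list (Node v (subtrees (st v))))" using dist_st[OF v] st_Node[OF v] by simp
    moreover have "st c \<noteq> st c'" using inj_onD[OF inj_st_Ch[OF v]] that by blast
    ultimately show ?thesis
      using distinct_node_list_NodeD(4)[of v _ "st c" "st c'"] that set_subtrees_st[OF v] by blast
  qed
  show ?case
  proof (cases "kk v = 1")
    case True
    have c: "kk u = 0 \<and> blk u = blk v" if "c \<in> Ch v" "u \<in> nodes (st c)" for u c
    proof -
      have "kk c = 0" using own_le_1[OF v _ that(1)] True by simp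
      moreover from own_0[OF pc(2)[OF that(1)] this] have "blk c = blk v"
        using own_1[OF v True] pc(1)[OF that(1)] by simp
      ultimately show ?thesis using not_own[OF pc(2)[OF that(1)] _ that(2)] by simp
    qed
    have "labels \<inter> nodes (st v) \<times> UNIV = {(v, False)}"
    proof -
      have "(x, b) \<in> labels \<inter> nodes (st v) \<times> UNIV \<longleftrightarrow> (x, b) = (v, False)" for x b
        using lv True c by (cases b) (auto simp: labels_def nodes_st[OF v])
      then show ?thesis by auto
    qed
    moreover have "{u \<in> nodes (st v). blk u = blk v} = nodes (st v)"
      using c by (auto simp: nodes_st[OF v])
    moreover have "blk ` nodes (st v) \<subseteq> {blk v}" using c by (auto simp: nodes_st[OF v])
    ultimately have "?P v (Node (nodes (st v)) []) (Node (blk v) [])"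
      using best_1[OF v] True
      by (simp add: summary_tree.collapse num_nodes_Node tree_value_Node sw_def)
    then show ?thesis by blast
  next
    case False
    then have k2: "2 \<le> kk v" using less.prems(2) by simp
    from own_2[OF v k2] obtain L where L: "valid v L" "psize v L = kk v"
      "pval v L = best v (kk v)" "\<And>c. c \<in> Ch v \<Longrightarrow> kk c = alloc L c" by blast
    have "\<forall>c\<in>{c \<in> Ch v. kk c \<noteq> 0}. \<exists>S N. ?P c S N"
    proof
      fix c assume c: "c \<in> {c \<in> Ch v. kk c \<noteq> 0}"
      show "\<exists>S N. ?P c S N" by (rule less.hyps) (use c sz_Ch[OF v] pc in auto)
    qed
    from bchoice[OF this] obtain S where "\<forall>c\<in>{c \<in> Ch v. kk c \<noteq> 0}. \<exists>N. ?P c (S c) N" ..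
    from bchoice[OF this] obtain N where N: "\<forall>c\<in>{c \<in> Ch v. kk c \<noteq> 0}. ?P c (S c) (N c)" ..
    have SN: "?P c (S c) (N c)" if "c \<in> Ch v" "kk c \<noteq> 0" for c
      by (rule bspec[OF N]) (use that in simp)
    let ?ts = "subtrees (st v)"
    let ?own = "filter (\<lambda>t. kk (root t) \<noteq> 0) ?ts"
    let ?ex = "\<exists>c\<in>Ch v. kk c = 0"
    let ?g = "\<lambda>j. {u \<in> nodes (st v). blk u = j}"
    define S' where "S' = assemble v ?ts (\<lambda>t. if kk (root t) = 0 then None else Some (S (root t)))"
    define os where "os = (if ?ex then [Node (df v) []] else [])"
    define N' where "N' = Node (blk v) (os @ map (\<lambda>t. N (root t)) ?own)"
    have own: "set ?own = st ` {c \<in> Ch v. kk c \<noteq> 0}"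
      unfolding set_filter set_subtrees_st[OF v] using pc by auto
    have rst: "root (st c) = c" if "c \<in> Ch v" for c using pc[OF that] by simp
    have "(\<Union>t\<in>st ` {c \<in> Ch v. kk c \<noteq> 0}. nodes (N (root t))) =
        (\<Union>c\<in>{c \<in> Ch v. kk c \<noteq> 0}. nodes (N c))"
      using rst by auto
    then have own_UN: "(\<Union>t\<in>set ?own. nodes (N (root t))) =
        (\<Union>c\<in>{c \<in> Ch v. kk c \<noteq> 0}. nodes (N c))"
      by (simp only: own)
    have S': "summary_tree (st v) S'" "num_nodes S' = 1 + alloc_size (Ch v) kk"
      "tree_value W w S' = eta W (w v) + alloc_value W sw best (Ch v) kk"
      unfolding S'_def by (rule assemble_alloc[OF v]; use SN in blast)+
    have "alloc_size (Ch v) kk = alloc_size (Ch v) (alloc L)" using L(4) by (rule alloc_size_cong)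
    then have "num_nodes S' = kk v" using S'(2) alloc_plan(1)[OF v L(1)] L(2) by simp
    moreover have "alloc_value W sw best (Ch v) kk = alloc_value W sw best (Ch v) (alloc L)"
      using L(4) by (rule alloc_value_cong)
    then have "tree_value W w S' = best v (kk v)"
      using S'(3) alloc_plan(2)[OF v L(1)] L(3) by simp
    moreover have lab: "labels \<inter> nodes (st v) \<times> UNIV = {(v, False)} \<union>
      (if ?ex then {(v, True)} else {}) \<union> (\<Union>c\<in>{c \<in> Ch v. kk c \<noteq> 0}. labels \<inter> nodes (st c) \<times> UNIV)"
    proof -
      have "kk c \<noteq> 0" if "c \<in> Ch v" "u \<in> nodes (st c)" "(u, b) \<in> labels" for c u b
        using not_own[OF pc(2)[OF that(1)] _ that(2)] that(3) by (auto simp: labels_def)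
      then have "(x, b) \<in> labels \<inter> nodes (st v) \<times> UNIV \<longleftrightarrow> (x, b) \<in> {(v, False)} \<union>
        (if ?ex then {(v, True)} else {}) \<union> (\<Union>c\<in>{c \<in> Ch v. kk c \<noteq> 0}. labels \<inter> nodes (st c) \<times> UNIV)"
        for x b
        using lv k2 vc v unfolding nodes_st[OF v] by (cases b; cases "x = v") (auto simp: labels_def)
      then show ?thesis by (intro set_eqI) (simp only: split_paired_all)
    qed
    have nodesN: "nodes (N c) = label_id ` (labels \<inter> nodes (st c) \<times> UNIV)"
      if "c \<in> Ch v" "kk c \<noteq> 0" for c using SN[OF that] by blast
    have nodes_N': "nodes N' = {blk v} \<union> (if ?ex then {df v} else {}) \<union>
        (\<Union>c\<in>{c \<in> Ch v. kk c \<noteq> 0}. nodes (N c))"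
    proof -
      have "(\<Union>t\<in>set ?own. nodes (N (root t))) = (\<Union>c\<in>{c \<in> Ch v. kk c \<noteq> 0}. nodes (N c))"
        by (rule own_UN)
      then show ?thesis by (simp add: N'_def os_def) force
    qed
    have "nodes N' = label_id ` (labels \<inter> nodes (st v) \<times> UNIV)"
      unfolding nodes_N' lab image_Un image_UN using nodesN by auto
    moreover have dj: "nodes (N c) \<inter> nodes (N c') = {}"
      if "c \<in> Ch v" "c' \<in> Ch v" "c \<noteq> c'" "kk c \<noteq> 0" "kk c' \<noteq> 0" for c c'
      unfolding nodesN[OF that(1,4)] nodesN[OF that(2,5)]
      using disj[OF that(1-3)] by (subst inj_on_image_Int[OF inj, symmetric]) auto
    have bv: "blk v \<notin> nodes (N c)" if cc: "c \<in> Ch v" "kk c \<noteq> 0" for c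
    proof
      assume "blk v \<in> nodes (N c)"
      then obtain l where l: "l \<in> labels" "fst l \<in> nodes (st c)" "label_id (v, False) = label_id l"
        unfolding nodesN[OF cc] by auto
      from inj_onD[OF inj l(3) lv l(1)] vc[OF cc(1)] l(2) show False by auto
    qed
    have lo: "(v, True) \<in> labels" if ?ex using that k2 v by (simp add: labels_def)
    have dv: "df v \<notin> nodes (N c)" if cc: "c \<in> Ch v" "kk c \<noteq> 0" ?ex for c
    proof
      assume "df v \<in> nodes (N c)"
      then obtain l where l: "l \<in> labels" "fst l \<in> nodes (st c)" "label_id (v, True) = label_id l"
        unfolding nodesN[OF cc(1,2)] by auto
      from inj_onD[OF inj l(3) lo[OF cc(3)] l(1)] vc[OF cc(1)] l(2) show False by auto
    qed
    have bd: "df v \<noteq> blk v" if ?ex using inj_onD[OF inj _ lo[OF that] lv] by auto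
    have dis: "distinct (node_list N')"
    proof -
      have "distinct (concat (map (\<lambda>t. node_list (N (root t))) ?own))"
      proof (rule distinct_concat_map)
        show "distinct ?own" using distinct_subtrees_st[OF v] by simp
      next
        fix t assume "t \<in> set ?own"
        then obtain c where "c \<in> Ch v" "kk c \<noteq> 0" "t = st c" unfolding own by auto
        then show "distinct (node_list (N (root t)))" using SN rst by simp
      next
        fix t t' assume "t \<in> set ?own" "t' \<in> set ?own" and ne: "t \<noteq> t'"
        then obtain c c' where "c \<in> Ch v" "kk c \<noteq> 0" "t = st c" "c' \<in> Ch v" "kk c' \<noteq> 0" "t' = st c'"
          unfolding own by auto
        then show "set (node_list (N (root t))) \<inter> set (node_list (N (root t'))) = {}"
          using ne rst dj[of c c'] by auto
      qed
      moreover have "(\<Union>t\<in>set ?own. nodes (N (root t))) = (\<Union>c\<in>{c \<in> Ch v. kk c \<noteq> 0}. nodes (N c))"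
        by (rule own_UN)
      moreover have "distinct (node_list N')"
        if "distinct (concat (map (\<lambda>t. node_list (N (root t))) ?own))"
          "(\<Union>t\<in>set ?own. nodes (N (root t))) = (\<Union>c\<in>{c \<in> Ch v. kk c \<noteq> 0}. nodes (N c))"
      proof (cases ?ex)
        case True
        then have "os = [Node (df v) []]" unfolding os_def by (rule if_P)
        then show ?thesis
          using that bv dv[OF _ _ True] bd[OF True] by (auto simp: N'_def comp_def)
      next
        case False
        then have "os = []" unfolding os_def by (rule if_not_P)
        then show ?thesis using that bv by (auto simp: N'_def comp_def)
      qed
      ultimately show ?thesis by blast
    qed
    have "\<forall>(x, y)\<in>edges N'. sp x = y"
    proof -
      have "sp x = y" if xy: "(x, y) \<in> edges N'" for x y
      proof -
        from xy consider "?ex" "x = df v" "y = blk v"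
          | t where "t \<in> set ?own" "(x, y) = (root (N (root t)), blk v) \<or> (x, y) \<in> edges (N (root t))"
          by (auto simp: N'_def os_def split: if_splits)
        then show ?thesis
        proof cases
          case 1
          then show ?thesis using sp_other[OF v k2] by simp
        next
          case 2
          then obtain c where c: "c \<in> Ch v" "kk c \<noteq> 0" "t = st c" unfolding own by auto
          with SN[OF c(1,2)] 2(2) rst[OF c(1)] show ?thesis
            using sp_own[OF pc(2)[OF c(1)]] pc(1)[OF c(1)] by auto
        qed
      qed
      then show ?thesis by auto
    qed
    moreover have blkN: "blk u \<in> nodes (N c)" if "c \<in> Ch v" "kk c \<noteq> 0" "u \<in> nodes (st c)" for c u
      using SN[OF that(1,2)] that(3) by blast
    have blkU: "blk u = df v" if "c \<in> Ch v" "kk c = 0" "u \<in> nodes (st c)" for c u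
      using not_own[OF pc(2)[OF that(1)] that(2,3)] own_0[OF pc(2)[OF that(1)] that(2)]
        pc(1)[OF that(1)] by simp
    have "blk ` nodes (st v) \<subseteq> nodes N'"
    proof
      fix j assume "j \<in> blk ` nodes (st v)"
      then consider "j = blk v" | c u where "c \<in> Ch v" "u \<in> nodes (st c)" "j = blk u"
        unfolding nodes_st[OF v] by blast
      then show "j \<in> nodes N'"
      proof cases
        case (2 c u)
        then show ?thesis using blkN[of c u] blkU[of c u] unfolding nodes_N'
          by (cases "kk c = 0") auto
      qed (simp add: nodes_N')
    qed
    moreover have "S' = map_rtree ?g N'"
    proof -
      have gv: "?g (blk v) = {v}"
      proof -
        have "blk u \<noteq> blk v" if "c \<in> Ch v" "u \<in> nodes (st c)" for c u
        proof (cases "kk c = 0")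
          case True
          then have ?ex using that(1) by blast
          then show ?thesis using blkU[OF that(1) True that(2)] bd by simp
        next
          case False
          then show ?thesis using blkN[OF that(1) False that(2)] bv[OF that(1) False] by auto
        qed
        then show ?thesis unfolding nodes_st[OF v] by auto
      qed
      have gd: "?g (df v) = (\<Union>c\<in>{c \<in> Ch v. kk c = 0}. nodes (st c))" if ?ex
      proof -
        have "blk u = df v \<longleftrightarrow> kk c = 0" if "c \<in> Ch v" "u \<in> nodes (st c)" for c u
          using blkU[OF that(1) _ that(2)] blkN[OF that(1) _ that(2)] dv[OF that(1) _ \<open>?ex\<close>]
          by (cases "kk c = 0") auto
        then show ?thesis unfolding nodes_st[OF v] using bd[OF that] by auto
      qed
      have gc: "map_rtree ?g (N c) = S c" if "c \<in> Ch v" "kk c \<noteq> 0" for c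
      proof -
        note cc = that
        have "?g j = {u \<in> nodes (st c). blk u = j}" if j: "j \<in> nodes (N c)" for j
        proof -
          have "c' = c" if "c' \<in> Ch v" "u \<in> nodes (st c')" "blk u = j" for c' u
          proof (rule ccontr)
            assume ne: "c' \<noteq> c"
            show False
            proof (cases "kk c' = 0")
              case True
              then have ?ex using that(1) by blast
              then show False
                using dv[OF \<open>c \<in> Ch v\<close> \<open>kk c \<noteq> 0\<close>] blkU[OF that(1) True that(2)] that(3) j by simp
            next
              case False
              then show False
                using dj[OF that(1) \<open>c \<in> Ch v\<close> ne False \<open>kk c \<noteq> 0\<close>] blkN[OF that(1) False that(2)]
                  that(3) j by auto
            qed
          qed
          moreover have "blk v \<noteq> j" using bv[OF cc] j by auto
          ultimately show ?thesis unfolding nodes_st[OF v] using cc(1) by auto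
        qed
        then have "map_rtree ?g (N c) = map_rtree (\<lambda>j. {u \<in> nodes (st c). blk u = j}) (N c)"
          by (intro rtree.map_cong0)
        also have "\<dots> = S c" using SN[OF that] by argo
        finally show ?thesis .
      qed
      let ?f = "\<lambda>t. if kk (root t) = 0 then None else Some (S (root t))"
      have ff: "filter (\<lambda>t. ?f t \<noteq> None) ?ts = ?own" by (intro filter_cong) auto
      have "(\<exists>t\<in>set ?ts. ?f t = None) \<longleftrightarrow> ?ex"
        unfolding set_subtrees_st[OF v] using rst by auto
      moreover have "map (\<lambda>t. the (?f t)) ?own = map (map_rtree ?g \<circ> (\<lambda>t. N (root t))) ?own"
      proof (rule map_cong[OF refl])
        fix t assume "t \<in> set ?own"
        then obtain c where "c \<in> Ch v" "kk c \<noteq> 0" "t = st c" unfolding own by auto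
        then show "the (?f t) = (map_rtree ?g \<circ> (\<lambda>t. N (root t))) t" using gc rst by simp
      qed
      moreover have "(\<Union>t\<in>{t\<in>set ?ts. ?f t = None}. nodes t) = (\<Union>c\<in>{c \<in> Ch v. kk c = 0}. nodes (st c))"
        unfolding set_subtrees_st[OF v] using rst by (auto split: if_splits)
      ultimately show ?thesis
        unfolding S'_def assemble_def ff N'_def os_def rtree.map gv using gd by simp
    qed
    ultimately have "?P v S' N'" using S'(1) dis by (simp add: N'_def)
    then show ?thesis by blast
  qed
qed

lemma decode:
  assumes inj: "inj_on label_id labels" and ids: "label_id ` labels = {..<m}" and k: "1 \<le> kk rt"
  obtains S N where "summary_tree T S" "num_nodes S = kk rt" "tree_value W w S = best rt (kk rt)"
    "parent_array (kk rt) sp N" "S = map_rtree (\<lambda>j. {v. v < n \<and> blk v = j}) N"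
proof -
  from summary_numbering[OF inj rt_less k] obtain S N where
    *: "summary_tree T S" "num_nodes S = kk rt" "tree_value W w S = best rt (kk rt)"
      "distinct (node_list N)" "root N = blk rt" "nodes N = label_id ` (labels \<inter> nodes T \<times> UNIV)"
      "\<forall>(x, y)\<in>edges N. sp x = y" "S = map_rtree (\<lambda>j. {u \<in> nodes T. blk u = j}) N"
    unfolding st_rt by blast
  have "labels \<inter> nodes T \<times> UNIV = labels" by (auto simp: labels_def nodes_T)
  then have nm: "nodes N = {..<m}" using *(6) ids by simp
  have "num_nodes N = kk rt" using *(2,8) num_nodes_map_rtree by metis
  then have "m = kk rt" using nm distinct_card[OF *(4)] by (simp add: num_nodes_def)
  \<comment> \<open>The root is its own parent in \<open>p\<close>, so \<open>sp_own\<close> at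
    \<open>rt\<close> yields the self-entry that a parent array needs for its root.\<close>
  then have "parent_array (kk rt) sp N"
    using *(4,5,7) nm sp_own[OF rt_less k] p_rt by (simp add: parent_array_def)
  moreover have "{u \<in> nodes T. blk u = j} = {v. v < n \<and> blk v = j}" for j
    by (auto simp: nodes_T)
  ultimately show ?thesis using *(1-3,8) that[of S N] by simp
qed

end

section \<open>Total correctness with running times\<close>

definition wp :: "com \<Rightarrow> state \<Rightarrow> (nat \<Rightarrow> state \<Rightarrow> bool) \<Rightarrow> bool" where
  "wp c s Q \<longleftrightarrow> (\<exists>t s'. exec c s t s' \<and> Q t s')"

text \<open>Determinism of \<open>exec\<close> turns the rules for atomic commands into
  equivalences, so that symbolic execution becomes rewriting.\<close>

lemma wp_atomic: "exec c s t s' \<Longrightarrow> wp c s Q \<longleftrightarrow> Q t s'"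
  unfolding wp_def using exec_deterministic by metis

lemmas wp_Skip = wp_atomic[OF exec.Skip]
  and wp_NSet = wp_atomic[OF exec.NSet]
  and wp_RSet = wp_atomic[OF exec.RSet]

lemma wp_Seq: "wp (Seq c1 c2) s Q \<longleftrightarrow> wp c1 s (\<lambda>t1 s1. wp c2 s1 (\<lambda>t2 s2. Q (t1 + t2) s2))"
  unfolding wp_def by (blast intro: exec.Seq elim: SeqE)

lemma wp_If: "wp (If b c1 c2) s Q \<longleftrightarrow>
    (if bval b s then wp c1 s (\<lambda>t. Q (bcost b + t)) else wp c2 s (\<lambda>t. Q (bcost b + t)))"
  unfolding wp_def
  by (cases "bval b s") (simp_all only: if_True if_False, (blast intro: exec.IfTrue exec.IfFalse elim: IfE)+)

lemmas wp_simps = wp_Skip wp_NSet wp_RSet wp_Seq wp_If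

lemma nmem_nupd [simp]: "nmem (nupd a i x s) = (nmem s)(a := (nmem s a)(i := x))"
  and rmem_nupd [simp]: "rmem (nupd a i x s) = rmem s"
  and nmem_rupd [simp]: "nmem (rupd a i y s) = nmem s"
  and rmem_rupd [simp]: "rmem (rupd a i y s) = (rmem s)(a := (rmem s a)(i := y))"
  by (simp_all add: nupd_def rupd_def)

text \<open>The arrays a program may write. Since \<open>wp_conseq\<close> hands over the frame
  condition for all others, loop invariants need to mention only what a loop changes.\<close>

primrec nw :: "com \<Rightarrow> name set" where
  "nw Skip = {}"
| "nw (NSet a i e) = {a}"
| "nw (RSet a i e) = {}"
| "nw (Seq c1 c2) = nw c1 \<union> nw c2"
| "nw (If b c1 c2) = nw c1 \<union> nw c2"
| "nw (While b c) = nw c"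

primrec rw :: "com \<Rightarrow> name set" where
  "rw Skip = {}"
| "rw (NSet a i e) = {}"
| "rw (RSet a i e) = {a}"
| "rw (Seq c1 c2) = rw c1 \<union> rw c2"
| "rw (If b c1 c2) = rw c1 \<union> rw c2"
| "rw (While b c) = rw c"

definition frm :: "name set \<Rightarrow> name set \<Rightarrow> state \<Rightarrow> state \<Rightarrow> bool" where
  "frm A B s s' \<longleftrightarrow> (\<forall>a. a \<notin> A \<longrightarrow> nmem s' a = nmem s a) \<and> (\<forall>a. a \<notin> B \<longrightarrow> rmem s' a = rmem s a)"

lemma frm_n: "frm A B s s' \<Longrightarrow> a \<notin> A \<Longrightarrow> nmem s' a = nmem s a"
  and frm_r: "frm A B s s' \<Longrightarrow> b \<notin> B \<Longrightarrow> rmem s' b = rmem s b"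
  by (simp_all add: frm_def)

lemmas frm = frm_n frm_r

lemma frm_trans:
  "frm A B s s' \<Longrightarrow> frm A' B' s' s'' \<Longrightarrow> A \<subseteq> C \<Longrightarrow> A' \<subseteq> C \<Longrightarrow> B \<subseteq> D \<Longrightarrow> B' \<subseteq> D \<Longrightarrow> frm C D s s''"
  unfolding frm_def by (metis subsetD)

lemma exec_frm: "exec c s t s' \<Longrightarrow> frm (nw c) (rw c) s s'"
  by (induction rule: exec.induct) (auto simp: frm_def)

lemma wp_conseq:
  assumes "wp c s P" "\<And>t s'. P t s' \<Longrightarrow> frm (nw c) (rw c) s s' \<Longrightarrow> Q t s'"
  shows "wp c s Q"
  using assms exec_frm unfolding wp_def by blast

definition For :: "name \<Rightarrow> nexp \<Rightarrow> com \<Rightarrow> com" where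
  "For x e c = Seq (NSet x (NConst 0) (NConst 0))
     (While (NLess (NGet x (NConst 0)) e)
       (Seq c (NSet x (NConst 0) (NAdd (NGet x (NConst 0)) (NConst 1)))))"

lemma nw_For [simp]: "nw (For x e c) = insert x (nw c)"
  and rw_For [simp]: "rw (For x e c) = rw c"
  by (auto simp: For_def)

text \<open>Per round the test costs \<open>ncost e + 3\<close> and the increment 6. The bound
  \<open>e\<close> is evaluated anew each time, hence the requirement that it keep the value m. The
  invariant is imposed on the state in which the counter has already advanced.\<close>

lemma wp_For:
  assumes x: "x \<notin> nw c"
    and init: "I 0 (nupd x 0 0 s)"
    and bound: "\<And>i s'. frm (insert x (nw c)) (rw c) s s' \<Longrightarrow> I i s' \<Longrightarrow> nval e s' = m"
    and body: "\<And>i s'. i < m \<Longrightarrow> nmem s' x 0 = i \<Longrightarrow> frm (insert x (nw c)) (rw c) s s' \<Longrightarrow> I i s' \<Longrightarrow>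
      wp c s' (\<lambda>t s''. t \<le> B i \<and> I (Suc i) (nupd x 0 (Suc i) s''))"
  shows "wp (For x e c) s (\<lambda>t s'. t \<le> (\<Sum>i<m. B i) + m * (ncost e + 9) + ncost e + 9 \<and>
    nmem s' x 0 = m \<and> I m s')"
proof -
  let ?b = "NLess (NGet x (NConst 0)) e"
  let ?c = "Seq c (NSet x (NConst 0) (NAdd (NGet x (NConst 0)) (NConst 1)))"
  let ?frm = "frm (insert x (nw c)) (rw c) s"
  have loop: "\<exists>t s''. exec (While ?b ?c) s' t s'' \<and>
      t \<le> (\<Sum>j\<in>{i..<m}. B j) + (m - i) * (ncost e + 9) + ncost e + 3 \<and> nmem s'' x 0 = m \<and> I m s''"
    if "i \<le> m" "nmem s' x 0 = i" "?frm s'" "I i s'" for i s'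
    using that
  proof (induction "m - i" arbitrary: i s')
    case 0
    then have "\<not> bval ?b s'" "i = m" using bound[OF 0(4,5)] by auto
    then show ?case using exec.WhileFalse[of ?b s' ?c] 0 by fastforce
  next
    case (Suc d)
    have im: "i < m" using Suc.hyps(2) by simp
    from body[OF im Suc.prems(2-4)] obtain t s1 where
      c: "exec c s' t s1" "t \<le> B i" "I (Suc i) (nupd x 0 (Suc i) s1)" unfolding wp_def by blast
    have f1: "?frm s1" using Suc.prems(3) exec_frm[OF c(1)] by (rule frm_trans) auto
    have x1: "nmem s1 x 0 = i" using frm_n[OF exec_frm[OF c(1)] x] Suc.prems(2) by simp
    let ?s2 = "nupd x 0 (Suc i) s1"
    have "exec (NSet x (NConst 0) (NAdd (NGet x (NConst 0)) (NConst 1))) s1 6 ?s2"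
      using exec.NSet[of x "NConst 0" "NAdd (NGet x (NConst 0)) (NConst 1)" s1] x1
      by (simp add: numeral_eq_Suc)
    with c(1) have body': "exec ?c s' (t + 6) ?s2" by (rule exec.Seq)
    have "?frm ?s2" using f1 by (simp add: frm_def)
    moreover have "d = m - Suc i" using Suc.hyps(2) by simp
    ultimately obtain t2 s3 where w: "exec (While ?b ?c) ?s2 t2 s3"
      "t2 \<le> (\<Sum>j\<in>{Suc i..<m}. B j) + (m - Suc i) * (ncost e + 9) + ncost e + 3"
      "nmem s3 x 0 = m" "I m s3"
      using Suc.hyps(1)[of "Suc i" ?s2] im c(3) by auto
    have "bval ?b s'" using im Suc.prems bound[OF Suc.prems(3,4)] by simp
    from exec.WhileTrue[OF this body' w(1)]
    have e: "exec (While ?b ?c) s' (bcost ?b + (t + 6) + t2) s3" .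
    have "(\<Sum>j\<in>{i..<m}. B j) = B i + (\<Sum>j\<in>{Suc i..<m}. B j)"
      using im by (simp add: sum.atLeast_Suc_lessThan)
    moreover have "(m - i) * (ncost e + 9) = (m - Suc i) * (ncost e + 9) + (ncost e + 9)"
      using im by (simp flip: Suc_diff_Suc)
    ultimately have "bcost ?b + (t + 6) + t2 \<le>
        (\<Sum>j\<in>{i..<m}. B j) + (m - i) * (ncost e + 9) + ncost e + 3"
      using c(2) w(2) by simp
    with e w(3,4) show ?case by blast
  qed
  have "?frm (nupd x 0 0 s)" by (simp add: frm_def)
  from loop[of 0, OF _ _ this init] obtain t s'' where w: "exec (While ?b ?c) (nupd x 0 0 s) t s''"
    "t \<le> (\<Sum>j<m. B j) + m * (ncost e + 9) + ncost e + 3" "nmem s'' x 0 = m" "I m s''"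
    by (auto simp: atLeast0LessThan)
  have "exec (NSet x (NConst 0) (NConst 0)) s 3 (nupd x 0 0 s)"
    using exec.NSet[of x "NConst 0" "NConst 0" s] by (simp add: numeral_eq_Suc)
  from exec.Seq[OF this w(1)] have "exec (For x e c) s (3 + t) s''" by (simp add: For_def)
  moreover have "3 + t \<le> (\<Sum>i<m. B i) + m * (ncost e + 9) + ncost e + 9" using w(2) by simp
  ultimately show ?thesis unfolding wp_def using w(3,4) by blast
qed

lemma wp_For_const:
  assumes "x \<notin> nw c"
    and "I 0 (nupd x 0 0 s)"
    and "\<And>i s'. frm (insert x (nw c)) (rw c) s s' \<Longrightarrow> I i s' \<Longrightarrow> nval e s' = m"
    and "\<And>i s'. i < m \<Longrightarrow> nmem s' x 0 = i \<Longrightarrow> frm (insert x (nw c)) (rw c) s s' \<Longrightarrow> I i s' \<Longrightarrow>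
      wp c s' (\<lambda>t s''. t \<le> b \<and> I (Suc i) (nupd x 0 (Suc i) s''))"
  shows "wp (For x e c) s (\<lambda>t s'. t \<le> (m + 1) * (b + ncost e + 9) \<and> nmem s' x 0 = m \<and> I m s')"
  by (rule wp_conseq[OF wp_For[where B = "\<lambda>_. b" and m = m, OF assms]]) (auto simp: algebra_simps)


section \<open>Tables of optimal plans\<close>

notation Seq (infixr ";;" 60)

abbreviation N :: "name \<Rightarrow> nexp" where "N a \<equiv> NGet a (NConst 0)"
abbreviation R :: "name \<Rightarrow> rexp" where "R a \<equiv> RGet a (NConst 0)"
abbreviation NLet :: "name \<Rightarrow> nexp \<Rightarrow> com" where "NLet a e \<equiv> NSet a (NConst 0) e"
abbreviation RLet :: "name \<Rightarrow> rexp \<Rightarrow> com" where "RLet a e \<equiv> RSet a (NConst 0) e"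
abbreviation "K1 \<equiv> NAdd (N ''K'') (NConst 1)"

text \<open>Plans are stored as linked lists in an area of memory that only grows; the pointer 1 stands
  for the empty list and the pointer 0 for the absence of a plan.\<close>

fun linked :: "nat \<Rightarrow> (nat \<Rightarrow> nat) \<Rightarrow> (nat \<Rightarrow> nat) \<Rightarrow> (nat \<Rightarrow> nat) \<Rightarrow> nat \<Rightarrow> (nat \<times> nat) list \<Rightarrow> bool" where
  "linked hp ch ck cn q [] \<longleftrightarrow> q = 1"
| "linked hp ch ck cn q ((c, k) # L) \<longleftrightarrow>
     1 < q \<and> q < hp \<and> ch q = c \<and> ck q = k \<and> linked hp ch ck cn (cn q) L"

abbreviation "heap s \<equiv> linked (nmem s ''hp'' 0) (nmem s ''CH'') (nmem s ''CK'') (nmem s ''CN'')"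

definition hext :: "state \<Rightarrow> state \<Rightarrow> bool" where
  "hext s s' \<longleftrightarrow> nmem s ''hp'' 0 \<le> nmem s' ''hp'' 0 \<and> (\<forall>q < nmem s ''hp'' 0.
     nmem s' ''CH'' q = nmem s ''CH'' q \<and> nmem s' ''CK'' q = nmem s ''CK'' q \<and>
     nmem s' ''CN'' q = nmem s ''CN'' q)"

lemma hext_trans: "hext s s' \<Longrightarrow> hext s' s'' \<Longrightarrow> hext s s''" by (simp add: hext_def)

lemma hext_frm: "frm A B s s' \<Longrightarrow> {''hp'', ''CH'', ''CK'', ''CN''} \<inter> A = {} \<Longrightarrow> hext s s'"
  by (auto simp: hext_def frm_def)

lemma linked_hext: "hext s s' \<Longrightarrow> heap s q L \<Longrightarrow> heap s' q L"
proof (induction L arbitrary: q)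
  case (Cons a L)
  then show ?case by (cases a) (auto simp: hext_def)
qed (simp add: hext_def)

text \<open>The table of a knapsack: entry a points to a plan that is optimal among those in
  \<open>A\<close> of total a. Total and value are parameters because both the tables over children
  (\<open>ptot\<close>, \<open>pbest\<close>) and the candidates for the node itself
  (\<open>psize\<close>, \<open>pval\<close>) have this form.\<close>

definition optrep ::
  "nat \<Rightarrow> (nat \<Rightarrow> 'l \<Rightarrow> bool) \<Rightarrow> (nat \<Rightarrow> nat) \<Rightarrow> (nat \<Rightarrow> real) \<Rightarrow> 'l set \<Rightarrow> ('l \<Rightarrow> nat) \<Rightarrow> ('l \<Rightarrow> real) \<Rightarrow> bool" where
  "optrep K h P V A tot val \<longleftrightarrow> (\<forall>a\<le>K.
     (P a = 0 \<longrightarrow> (\<forall>L\<in>A. tot L \<noteq> a)) \<and>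
     (P a \<noteq> 0 \<longrightarrow> (\<exists>L\<in>A. tot L = a \<and> h (P a) L \<and> V a = val L \<and> (\<forall>L'\<in>A. tot L' = a \<longrightarrow> val L' \<le> val L))))"

lemma optrep_heap: "(\<And>q L. h q L \<Longrightarrow> h' q L) \<Longrightarrow> optrep K h P V A tot val \<Longrightarrow> optrep K h' P V A tot val"
  unfolding optrep_def by blast

lemma optrep_table: "(\<And>a. a \<le> K \<Longrightarrow> P' a = P a) \<Longrightarrow> (\<And>a. a \<le> K \<Longrightarrow> V' a = V a) \<Longrightarrow>
    optrep K h P V A tot val \<Longrightarrow> optrep K h P' V' A tot val"
  unfolding optrep_def by simp

lemma optrep_set:
  assumes "\<And>L. tot L \<le> K \<Longrightarrow> L \<in> A \<longleftrightarrow> L \<in> A'" "optrep K h P V A tot val"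
  shows "optrep K h P V A' tot val"
  unfolding optrep_def
proof (intro allI impI)
  fix a assume a: "a \<le> K"
  have *: "L \<in> A' \<and> tot L = a \<longleftrightarrow> L \<in> A \<and> tot L = a" for L using assms(1)[of L] a by auto
  have "(P a = 0 \<longrightarrow> (\<forall>L. L \<in> A \<and> tot L = a \<longrightarrow> False)) \<and>
     (P a \<noteq> 0 \<longrightarrow> (\<exists>L. (L \<in> A \<and> tot L = a) \<and> h (P a) L \<and> V a = val L \<and> (\<forall>L'. L' \<in> A \<and> tot L' = a \<longrightarrow> val L' \<le> val L)))"
    using assms(2) a unfolding optrep_def by blast
  then show "(P a = 0 \<longrightarrow> (\<forall>L\<in>A'. tot L \<noteq> a)) \<and>
     (P a \<noteq> 0 \<longrightarrow> (\<exists>L\<in>A'. tot L = a \<and> h (P a) L \<and> V a = val L \<and> (\<forall>L'\<in>A'. tot L' = a \<longrightarrow> val L' \<le> val L)))"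
    unfolding *[symmetric] by blast
qed

lemma optrep_empty: "(\<And>a. a \<le> K \<Longrightarrow> P a = 0) \<Longrightarrow> optrep K h P V {} tot val"
  by (simp add: optrep_def)

text \<open>One comparison accounts for a whole batch \<open>M\<close> of plans, because all of them
  have total c and \<open>L0\<close> is the best of them.\<close>

lemma optrep_relax:
  assumes "optrep K h P V A tot val"
    and "L0 \<in> M" "\<And>L. L \<in> M \<Longrightarrow> tot L = c \<and> val L \<le> val L0"
  shows "P c \<noteq> 0 \<and> val L0 \<le> V c \<Longrightarrow> optrep K h P V (A \<union> M) tot val"
    and "\<not> (P c \<noteq> 0 \<and> val L0 \<le> V c) \<Longrightarrow> h q L0 \<Longrightarrow> q \<noteq> 0 \<Longrightarrow>
      optrep K h (P(c := q)) (V(c := val L0)) (A \<union> M) tot val"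
proof -
  have other: "(P a = 0 \<longrightarrow> (\<forall>L\<in>A \<union> M. tot L \<noteq> a)) \<and> (P a \<noteq> 0 \<longrightarrow> (\<exists>L\<in>A \<union> M. tot L = a \<and> h (P a) L \<and>
      V a = val L \<and> (\<forall>L'\<in>A \<union> M. tot L' = a \<longrightarrow> val L' \<le> val L)))"
    if "a \<le> K" "a \<noteq> c" for a
  proof -
    have "L \<in> A \<union> M \<and> tot L = a \<longleftrightarrow> L \<in> A \<and> tot L = a" for L using assms(3)[of L] that(2) by auto
    then have "(\<forall>L\<in>A \<union> M. tot L \<noteq> a) \<longleftrightarrow> (\<forall>L\<in>A. tot L \<noteq> a)"
      "\<And>L0. (\<forall>L'\<in>A \<union> M. tot L' = a \<longrightarrow> val L' \<le> val L0) \<longleftrightarrow> (\<forall>L'\<in>A. tot L' = a \<longrightarrow> val L' \<le> val L0)"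
      by blast+
    then show ?thesis using assms(1) that(1) unfolding optrep_def by blast
  qed
  show "optrep K h P V (A \<union> M) tot val" if c: "P c \<noteq> 0 \<and> val L0 \<le> V c"
    unfolding optrep_def
  proof (intro allI impI)
    fix a assume a: "a \<le> K"
    show "(P a = 0 \<longrightarrow> (\<forall>L\<in>A \<union> M. tot L \<noteq> a)) \<and> (P a \<noteq> 0 \<longrightarrow> (\<exists>L\<in>A \<union> M. tot L = a \<and> h (P a) L \<and>
      V a = val L \<and> (\<forall>L'\<in>A \<union> M. tot L' = a \<longrightarrow> val L' \<le> val L)))"
    proof (cases "a = c")
      case True
      then obtain L where L: "L \<in> A" "tot L = c" "h (P c) L" "V c = val L"
        "\<forall>L'\<in>A. tot L' = c \<longrightarrow> val L' \<le> val L"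
        using assms(1) a c unfolding optrep_def by blast
      have "val L' \<le> val L" if "L' \<in> A \<union> M" "tot L' = c" for L'
        using that L(4,5) assms(3)[of L'] c by fastforce
      then show ?thesis using L c True by blast
    qed (use other a in blast)
  qed
  show "optrep K h (P(c := q)) (V(c := val L0)) (A \<union> M) tot val" if c: "\<not> (P c \<noteq> 0 \<and> val L0 \<le> V c)" "h q L0" "q \<noteq> 0"
    unfolding optrep_def
  proof (intro allI impI)
    fix a assume a: "a \<le> K"
    show "((P(c := q)) a = 0 \<longrightarrow> (\<forall>L\<in>A \<union> M. tot L \<noteq> a)) \<and> ((P(c := q)) a \<noteq> 0 \<longrightarrow>
      (\<exists>L\<in>A \<union> M. tot L = a \<and> h ((P(c := q)) a) L \<and>
      (V(c := val L0)) a = val L \<and> (\<forall>L'\<in>A \<union> M. tot L' = a \<longrightarrow> val L' \<le> val L)))"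
    proof (cases "a = c")
      case True
      have "val L' \<le> val L0" if L': "L' \<in> A" "tot L' = c" for L'
      proof -
        from L' assms(1) a True have "P c \<noteq> 0" unfolding optrep_def by blast
        moreover from this L' assms(1) a True have "val L' \<le> V c" unfolding optrep_def by metis
        ultimately show ?thesis using c(1) by linarith
      qed
      then have "\<forall>L'\<in>A \<union> M. tot L' = c \<longrightarrow> val L' \<le> val L0" using assms(3) by blast
      then show ?thesis using True c assms(2) assms(3)[OF assms(2)] by auto
    next
      case False
      then show ?thesis using other[OF a False] by simp
    qed
  qed
qed

lemma optrep_beyond:
  "optrep K h P V A tot val \<Longrightarrow> (\<And>L. L \<in> M \<Longrightarrow> K < tot L) \<Longrightarrow> optrep K h P V (A \<union> M) tot val"
  by (rule optrep_set[rotated]) (auto simp: not_less[symmetric])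

definition clear :: "name \<Rightarrow> com" where
  "clear P = For ''c'' K1 (NSet P (N ''c'') (NConst 0))"

lemma wp_clear:
  assumes "P \<noteq> ''c''" "P \<noteq> ''K''"
  shows "wp (clear P) s (\<lambda>t s'. t \<le> (nmem s ''K'' 0 + 2) * 20 \<and> (\<forall>a\<le>nmem s ''K'' 0. nmem s' P a = 0))"
  unfolding clear_def
  by (rule wp_conseq[OF wp_For_const[where m = "nmem s ''K'' 0 + 1" and b = 4 and
      I = "\<lambda>i s'. \<forall>a<i. nmem s' P a = 0"]])
    ((use assms in \<open>auto simp: wp_simps frm less_Suc_eq\<close>)[4], simp add: less_Suc_eq_le)

definition copy :: "com" where
  "copy = For ''c'' K1 (NSet ''TP'' (N ''c'') (NGet ''NP'' (N ''c'')) ;;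
     RSet ''TV'' (N ''c'') (RGet ''NV'' (N ''c'')))"

lemma wp_copy:
  "wp copy s (\<lambda>t s'. t \<le> (nmem s ''K'' 0 + 2) * 40 \<and>
     (\<forall>a\<le>nmem s ''K'' 0. nmem s' ''TP'' a = nmem s ''NP'' a \<and> rmem s' ''TV'' a = rmem s ''NV'' a))"
  unfolding copy_def
  by (rule wp_conseq[OF wp_For_const[where m = "nmem s ''K'' 0 + 1" and b = 12 and
      I = "\<lambda>i s'. \<forall>a<i. nmem s' ''TP'' a = nmem s ''NP'' a \<and> rmem s' ''TV'' a = rmem s ''NV'' a"]])
    ((auto simp: wp_simps frm less_Suc_eq)[4], simp add: less_Suc_eq_le)

section \<open>The dynamic program at a node\<close>

text \<open>\<open>TP\<close>, \<open>TV\<close> hold the table over the children merged so far, the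
  row of \<open>BP\<close>, \<open>BV\<close> at \<open>bx\<close> that of the child x, and
  \<open>NP\<close>, \<open>NV\<close> the table under construction, whose entry a + b is relaxed. A
  list cell is allocated only on improvement.\<close>

definition "merge_cell =
  If (And (NLess (NConst 0) (NGet ''BP'' (NAdd (N ''bx'') (N ''b'')))) (NLess (NAdd (N ''a'') (N ''b'')) K1))
    (RLet ''t'' (RAdd (RGet ''TV'' (N ''a'')) (RGet ''BV'' (NAdd (N ''bx'') (N ''b'')))) ;;
     If (Not (And (NLess (NConst 0) (NGet ''NP'' (NAdd (N ''a'') (N ''b''))))
           (Not (RLess (RGet ''NV'' (NAdd (N ''a'') (N ''b''))) (R ''t'')))))
       (NSet ''CH'' (N ''hp'') (N ''x'') ;;
        NSet ''CK'' (N ''hp'') (N ''b'') ;;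
        NSet ''CN'' (N ''hp'') (NGet ''TP'' (N ''a'')) ;;
        NSet ''NP'' (NAdd (N ''a'') (N ''b'')) (N ''hp'') ;;
        RSet ''NV'' (NAdd (N ''a'') (N ''b'')) (R ''t'') ;;
        NLet ''hp'' (NAdd (N ''hp'') (NConst 1)))
       Skip)
    Skip"

definition "merge_loop = For ''a'' (NAdd (N ''cA'') (NConst 1))
  (If (NLess (NConst 0) (NGet ''TP'' (N ''a'')))
     (For ''b'' (NAdd (N ''cx'') (NConst 1)) merge_cell) Skip)"

text \<open>With truncated subtraction, \<open>K - (K - m)\<close> is \<open>min K m\<close>.
  Bounding both loops by such minima is what makes a merge cost a product
  \<open>min K a * min K b\<close> up to terms linear in K.\<close>

definition "merge = clear ''NP'' ;;
  NLet ''cx'' (NSub (N ''K'') (NSub (N ''K'') (NGet ''sz'' (N ''x'')))) ;;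
  NLet ''bx'' (NGet ''bs'' (N ''x'')) ;;
  merge_loop ;;
  copy ;;
  NLet ''cA'' (NSub (N ''K'') (NSub (N ''K'') (NAdd (N ''cA'') (N ''cx''))))"

lemma nw_clear [simp]: "nw (clear P) = {''c'', P}" and rw_clear [simp]: "rw (clear P) = {}"
  by (simp_all add: clear_def)

lemma nw_copy [simp]: "nw copy = {''c'', ''TP''}" and rw_copy [simp]: "rw copy = {''TV''}"
  by (simp_all add: copy_def)

lemma nw_merge_cell [simp]: "nw merge_cell = {''CH'', ''CK'', ''CN'', ''NP'', ''hp''}"
  and rw_merge_cell [simp]: "rw merge_cell = {''t'', ''NV''}"
  by (auto simp: merge_cell_def)

lemma nw_merge_loop [simp]: "nw merge_loop = {''a'', ''b'', ''CH'', ''CK'', ''CN'', ''NP'', ''hp''}"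
  and rw_merge_loop [simp]: "rw merge_loop = {''t'', ''NV''}"
  by (auto simp: merge_loop_def)

lemma nw_merge [simp]: "nw merge = {''c'', ''NP'', ''cx'', ''bx'', ''a'', ''b'', ''CH'', ''CK'', ''CN'',
    ''hp'', ''TP'', ''cA''}"
  and rw_merge [simp]: "rw merge = {''t'', ''NV'', ''TV''}"
  by (auto simp: merge_def)

context weighted_tree
begin

definition ptot :: "(nat \<times> nat) list \<Rightarrow> nat" where "ptot L = (\<Sum>(c, k)\<leftarrow>L. k)"
definition pbest :: "(nat \<times> nat) list \<Rightarrow> real" where "pbest L = (\<Sum>(c, k)\<leftarrow>L. best c k)"

definition base :: "nat \<Rightarrow> nat" where "base v = v * (K + 1)"

text \<open>For k = 1 the pointer merely signals existence: the optimum is the collapsed tree, which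
  no plan describes. From k = 2 on the row must lead to an optimal plan.\<close>

definition rowrep ::
  "(nat \<Rightarrow> (nat \<times> nat) list \<Rightarrow> bool) \<Rightarrow> (nat \<Rightarrow> nat) \<Rightarrow> (nat \<Rightarrow> real) \<Rightarrow> nat \<Rightarrow> bool" where
  "rowrep h P V v \<longleftrightarrow> (\<forall>k\<le>K. (P (base v + k) = 0 \<longrightarrow> \<not> feas v k) \<and>
     (P (base v + k) \<noteq> 0 \<longrightarrow> feas v k \<and> V (base v + k) = best v k \<and>
       (2 \<le> k \<longrightarrow> (\<exists>L. h (P (base v + k)) L \<and> valid v L \<and> psize v L = k \<and> pval v L = best v k))))"

lemma rowrep_heap: "(\<And>q L. h q L \<Longrightarrow> h' q L) \<Longrightarrow> rowrep h P V v \<Longrightarrow> rowrep h' P V v"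
  unfolding rowrep_def by blast

abbreviation "tables h P V A \<equiv> optrep K h P V A ptot pbest"

abbreviation "ext c X D \<equiv> {(c, k) # L | k L. L \<in> plans_over X \<and> feas c k \<and> D k L}"

text \<open>Principle of optimality: giving b nodes to the child c adds \<open>best c b\<close> to
  any plan over \<open>X\<close>, so among the plans of total i only the stored optimum has to be
  extended.\<close>

lemma wp_merge_row:
  assumes K: "nmem s ''K'' 0 = K" and c: "nmem s ''x'' 0 = c" "nmem s ''bx'' 0 = base c"
    and row: "rowrep (heap s) (nmem s ''BP'') (rmem s ''BV'') c"
    and cx: "nmem s ''cx'' 0 = m" and a: "nmem s ''a'' 0 = i" "i \<le> K"
    and T: "tables (heap s) (nmem s ''TP'') (rmem s ''TV'') (plans_over X)" "nmem s ''TP'' i \<noteq> 0"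
    and hp: "2 \<le> nmem s ''hp'' 0"
    and NP: "tables (heap s) (nmem s ''NP'') (rmem s ''NV'') D"
  shows "wp (For ''b'' (NAdd (N ''cx'') (NConst 1)) merge_cell) s (\<lambda>t s'. t \<le> (m + 2) * 150 \<and> hext s s' \<and>
    tables (heap s') (nmem s' ''NP'') (rmem s' ''NV'') (D \<union> ext c X (\<lambda>k L. ptot L = i \<and> k < m + 1)))"
proof -
  from T a(2) obtain L1 where L1: "L1 \<in> plans_over X" "ptot L1 = i" "heap s (nmem s ''TP'' i) L1"
    "rmem s ''TV'' i = pbest L1" "\<And>L. L \<in> plans_over X \<Longrightarrow> ptot L = i \<Longrightarrow> pbest L \<le> pbest L1"
    unfolding optrep_def by blast
  let ?E = "\<lambda>j. ext c X (\<lambda>k L. ptot L = i \<and> k < j)"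
  have "wp (For ''b'' (NAdd (N ''cx'') (NConst 1)) merge_cell) s (\<lambda>t s'. t \<le> (m + 1 + 1) * (120 + 4 + 9) \<and>
    nmem s' ''b'' 0 = m + 1 \<and>
    (hext s s' \<and> tables (heap s') (nmem s' ''NP'') (rmem s' ''NV'') (D \<union> ?E (m + 1))))"
  proof (rule wp_conseq[OF wp_For_const[where m = "m + 1" and b = 120 and
      I = "\<lambda>j s'. hext s s' \<and> tables (heap s') (nmem s' ''NP'') (rmem s' ''NV'') (D \<union> ?E j)"]], goal_cases)
    case 2
    then show ?case using NP by (simp add: hext_def)
  next
    case (3 i s')
    then show ?case using cx by (simp add: frm)
  next
    case (4 j s')
    have f: "nmem s' y = nmem s y" if "y \<notin> {''b'', ''CH'', ''CK'', ''CN'', ''NP'', ''hp''}" for y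
      using frm_n[OF 4(3)] that by simp
    have fr: "rmem s' y = rmem s y" if "y \<notin> {''t'', ''NV''}" for y
      using frm_r[OF 4(3)] that by simp
    have h: "hext s s'" and N: "tables (heap s') (nmem s' ''NP'') (rmem s' ''NV'') (D \<union> ?E j)"
      using 4(4) by auto
    let ?M = "ext c X (\<lambda>k L. ptot L = i \<and> k = j)"
    have E: "D \<union> ?E (Suc j) = D \<union> ?E j \<union> ?M" by (auto simp: less_Suc_eq)
    let ?bp = "nmem s ''BP'' (base c + j)"
    show ?case
    proof (cases "?bp \<noteq> 0 \<and> i + j \<le> K")
      case False
      have "tables (heap s') (nmem s' ''NP'') (rmem s' ''NV'') (D \<union> ?E (Suc j))"
      proof (cases "i + j \<le> K")
        case True
        then have "\<not> feas c j" using False row unfolding rowrep_def by auto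
        then have M0: "?M = {}" by auto
        show ?thesis unfolding E M0 Un_empty_right by (rule N)
      next
        case False
        show ?thesis unfolding E by (rule optrep_beyond[OF N]) (use False in \<open>auto simp: ptot_def\<close>)
      qed
      then show ?thesis
        using False h 4(2) K c a unfolding merge_cell_def
        by (auto simp: wp_simps f hext_def)
    next
      case True
      then have bp: "?bp \<noteq> 0" "i + j \<le> K" by auto
      then have F: "feas c j" and bv: "rmem s ''BV'' (base c + j) = best c j"
        using row unfolding rowrep_def by auto
      let ?L = "(c, j) # L1"
      have M: "?L \<in> ?M" using L1 F by auto
      have Mle: "ptot L = i + j \<and> pbest L \<le> pbest ?L" if "L \<in> ?M" for L
        using that L1(5) by (auto simp: ptot_def pbest_def)
      have v: "pbest ?L = rmem s ''TV'' i + rmem s ''BV'' (base c + j)"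
        using L1(4) bv by (simp add: pbest_def)
      show ?thesis
      proof (cases "nmem s' ''NP'' (i + j) \<noteq> 0 \<and> pbest ?L \<le> rmem s' ''NV'' (i + j)")
        case skip: True
        have "tables (heap s') (nmem s' ''NP'') (rmem s' ''NV'') (D \<union> ?E (Suc j))"
          unfolding E
        proof (rule optrep_relax(1)[where ?L0.0 = "?L" and c = "i + j"])
          show "ptot L = i + j \<and> pbest L \<le> pbest ?L" if "L \<in> ?M" for L using that by (rule Mle)
        qed (fact N M skip)+
        then show ?thesis
          using bp skip h 4(2) K c a v unfolding merge_cell_def
          by (auto simp: wp_simps f fr hext_def)
      next
        case upd: False
        let ?hp = "nmem s' ''hp'' 0"
        define s2 where "s2 = nupd ''hp'' 0 (?hp + 1) (rupd ''NV'' (i + j) (pbest ?L)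
          (nupd ''NP'' (i + j) ?hp (nupd ''CN'' ?hp (nmem s ''TP'' i) (nupd ''CK'' ?hp j (nupd ''CH'' ?hp c
          (rupd ''t'' 0 (pbest ?L) s'))))))"
        have h2: "hext s' s2" by (simp add: s2_def hext_def)
        have hp2: "2 \<le> ?hp" using hp h by (simp add: hext_def)
        have hL: "heap s2 ?hp ?L"
        proof -
          have "heap s2 (nmem s ''TP'' i) L1" using linked_hext[OF hext_trans[OF h h2] L1(3)] .
          then show ?thesis using hp2 by (simp add: s2_def)
        qed
        have N2: "tables (heap s2) (nmem s' ''NP'') (rmem s' ''NV'') (D \<union> ?E j)"
          using linked_hext[OF h2] N by (rule optrep_heap)
        have "tables (heap s2) ((nmem s' ''NP'')(i + j := ?hp)) ((rmem s' ''NV'')(i + j := pbest ?L)) (D \<union> ?E (Suc j))"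
          unfolding E
        proof (rule optrep_relax(2)[where ?L0.0 = "?L" and c = "i + j"])
          show "ptot L = i + j \<and> pbest L \<le> pbest ?L" if "L \<in> ?M" for L using that by (rule Mle)
          show "?hp \<noteq> 0" using hp2 by simp
        qed (fact N2 M upd hL)+
        moreover have "nmem s2 ''NP'' = (nmem s' ''NP'')(i + j := ?hp)"
          "rmem s2 ''NV'' = (rmem s' ''NV'')(i + j := pbest ?L)" by (simp_all add: s2_def)
        ultimately have "tables (heap s2) (nmem s2 ''NP'') (rmem s2 ''NV'') (D \<union> ?E (Suc j))" by simp
        then have inv: "hext s (nupd ''b'' 0 (Suc j) s2) \<and> tables (heap (nupd ''b'' 0 (Suc j) s2))
            (nmem (nupd ''b'' 0 (Suc j) s2) ''NP'') (rmem (nupd ''b'' 0 (Suc j) s2) ''NV'') (D \<union> ?E (Suc j))"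
          using hext_trans[OF h h2] by (simp add: hext_def)
        have b1: "bval (And (NLess (NConst 0) (NGet ''BP'' (NAdd (N ''bx'') (N ''b''))))
            (NLess (NAdd (N ''a'') (N ''b'')) K1)) s'"
          using bp 4(2) K c a by (simp add: f)
        have r1: "rval (RAdd (RGet ''TV'' (N ''a'')) (RGet ''BV'' (NAdd (N ''bx'') (N ''b'')))) s' = pbest ?L"
          using v 4(2) c a by (simp add: f fr)
        have b2: "bval (Not (And (NLess (NConst 0) (NGet ''NP'' (NAdd (N ''a'') (N ''b''))))
           (Not (RLess (RGet ''NV'' (NAdd (N ''a'') (N ''b''))) (R ''t''))))) (rupd ''t'' 0 (pbest ?L) s')"
          using upd 4(2) a by (auto simp: f)
        have upd_wp: "wp (NSet ''CH'' (N ''hp'') (N ''x'') ;;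
            NSet ''CK'' (N ''hp'') (N ''b'') ;;
            NSet ''CN'' (N ''hp'') (NGet ''TP'' (N ''a'')) ;;
            NSet ''NP'' (NAdd (N ''a'') (N ''b'')) (N ''hp'') ;;
            RSet ''NV'' (NAdd (N ''a'') (N ''b'')) (R ''t'') ;;
            NLet ''hp'' (NAdd (N ''hp'') (NConst 1))) (rupd ''t'' 0 (pbest ?L) s') Q = Q 38 s2" for Q
          using 4(2) c(1) a(1) by (simp add: wp_simps s2_def f numeral_eq_Suc)
        show ?thesis
          unfolding merge_cell_def wp_If if_P[OF b1] wp_Seq[of "RLet _ _"] wp_RSet[of "''t''"] r1 nval.simps(1) if_P[OF b2] upd_wp
          using inv by (intro conjI) (simp, blast+)
      qed
    qed
  qed auto
  then show ?thesis by (rule wp_conseq) auto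
qed

text \<open>The bounds \<open>cA\<close> and \<open>cx\<close> cut off only what cannot occur:
  within the limit K, no plan over \<open>X\<close> has a total above \<open>cA\<close> and no size
  above \<open>cx\<close> is possible for c.\<close>

lemma wp_merge_loop:
  assumes K: "nmem s ''K'' 0 = K" and c: "nmem s ''x'' 0 = c" "nmem s ''bx'' 0 = base c"
    and row: "rowrep (heap s) (nmem s ''BP'') (rmem s ''BV'') c"
    and cx: "nmem s ''cx'' 0 = m" "\<And>k. k \<le> K \<Longrightarrow> feas c k \<Longrightarrow> k \<le> m"
    and cA: "nmem s ''cA'' 0 = A" "A \<le> K" "\<And>L. L \<in> plans_over X \<Longrightarrow> ptot L \<le> K \<Longrightarrow> ptot L \<le> A"
    and T: "tables (heap s) (nmem s ''TP'') (rmem s ''TV'') (plans_over X)"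
    and hp: "2 \<le> nmem s ''hp'' 0"
    and NP: "\<forall>a\<le>K. nmem s ''NP'' a = 0"
  shows "wp merge_loop s (\<lambda>t s'. t \<le> (A + 2) * ((m + 2) * 170) \<and> hext s s' \<and>
    tables (heap s') (nmem s' ''NP'') (rmem s' ''NV'') (plans_over (X @ [c])))"
proof -
  let ?F = "\<lambda>i. ext c X (\<lambda>k L. ptot L < i)"
  have "wp merge_loop s (\<lambda>t s'. t \<le> (A + 1 + 1) * (((m + 2) * 150 + 10) + 4 + 9) \<and>
    nmem s' ''a'' 0 = A + 1 \<and>
    (hext s s' \<and> tables (heap s') (nmem s' ''NP'') (rmem s' ''NV'') (?F (A + 1))))"
    unfolding merge_loop_def
  proof (rule wp_conseq[OF wp_For_const[where m = "A + 1" and b = "(m + 2) * 150 + 10" and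
      I = "\<lambda>i s'. hext s s' \<and> tables (heap s') (nmem s' ''NP'') (rmem s' ''NV'') (?F i)"]], goal_cases)
    case 2
    have "?F 0 = {}" by simp
    then show ?case using NP by (auto simp: hext_def intro!: optrep_empty)
  next
    case (3 i s')
    then show ?case using cA by (simp add: frm)
  next
    case (4 i s')
    let ?A = "insert ''a'' {''b'', ''CH'', ''CK'', ''CN'', ''NP'', ''hp''}"
    have f: "nmem s' y = nmem s y" if "y \<notin> ?A" for y using frm_n[OF 4(3)] that by simp
    have fr: "rmem s' y = rmem s y" if "y \<notin> {''t'', ''NV''}" for y using frm_r[OF 4(3)] that by simp
    have h: "hext s s'" and N: "tables (heap s') (nmem s' ''NP'') (rmem s' ''NV'') (?F i)"
      using 4(4) by auto
    have iK: "i \<le> K" using 4(1) cA by simp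
    have T': "tables (heap s') (nmem s' ''TP'') (rmem s' ''TV'') (plans_over X)"
      using optrep_heap[OF linked_hext[OF h] T] by (simp add: f fr)
    have row': "rowrep (heap s') (nmem s' ''BP'') (rmem s' ''BV'') c"
      using rowrep_heap[OF linked_hext[OF h] row] by (simp add: f fr)
    show ?case
    proof (cases "nmem s ''TP'' i = 0")
      case True
      then have "ptot L \<noteq> i" if "L \<in> plans_over X" for L using T iK that unfolding optrep_def by blast
      then have "?F (Suc i) = ?F i" by (auto simp: less_Suc_eq)
      then show ?thesis using True N h 4(2) by (simp add: wp_simps f hext_def)
    next
      case False
      have hp': "2 \<le> nmem s' ''hp'' 0" using hp h by (simp add: hext_def)
      have "wp (For ''b'' (NAdd (N ''cx'') (NConst 1)) merge_cell) s' (\<lambda>t s''. t \<le> (m + 2) * 150 \<and> hext s' s'' \<and>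
        tables (heap s'') (nmem s'' ''NP'') (rmem s'' ''NV'') (?F i \<union> ext c X (\<lambda>k L. ptot L = i \<and> k < m + 1)))"
        using K c cx(1) 4(2) False
        by (intro wp_merge_row row' iK T' hp' N) (simp_all add: f)
      then have "wp (For ''b'' (NAdd (N ''cx'') (NConst 1)) merge_cell) s' (\<lambda>t s''. 5 + t \<le> (m + 2) * 150 + 10 \<and>
        hext s (nupd ''a'' 0 (Suc i) s'') \<and> tables (heap (nupd ''a'' 0 (Suc i) s''))
          (nmem (nupd ''a'' 0 (Suc i) s'') ''NP'') (rmem (nupd ''a'' 0 (Suc i) s'') ''NV'') (?F (Suc i)))"
      proof (rule wp_conseq, goal_cases)
        case (1 t s'')
        have P: "t \<le> (m + 2) * 150" "hext s' s''" "tables (heap s'') (nmem s'' ''NP'') (rmem s'' ''NV'')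
            (?F i \<union> ext c X (\<lambda>k L. ptot L = i \<and> k < m + 1))"
          using 1(1) by blast+
        have "hext s s''" using hext_trans[OF h P(2)] .
        moreover have "tables (heap s'') (nmem s'' ''NP'') (rmem s'' ''NV'') (?F (Suc i))"
        proof (rule optrep_set[OF _ P(3)])
          have km: "k < m + 1" if "feas c k" "k + y \<le> K" for k y using cx(2)[of k] that by simp
          show "L \<in> ?F i \<union> ext c X (\<lambda>k L. ptot L = i \<and> k < m + 1) \<longleftrightarrow> L \<in> ?F (Suc i)"
            if "ptot L \<le> K" for L
            using that by (auto simp: less_Suc_eq ptot_def) (metis km less_SucE Suc_eq_plus1)
        qed
        ultimately show ?case using P(1) by (simp add: hext_def)
      qed
      then show ?thesis using False 4(2) by (simp add: wp_If f)
    qed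
  qed auto
  then show ?thesis
  proof (rule wp_conseq, goal_cases)
    case (1 t s')
    have P: "t \<le> (A + 1 + 1) * (((m + 2) * 150 + 10) + 4 + 9)" "hext s s'"
        "tables (heap s') (nmem s' ''NP'') (rmem s' ''NV'') (?F (A + 1))"
      using 1(1) by blast+
    have "tables (heap s') (nmem s' ''NP'') (rmem s' ''NV'') (plans_over (X @ [c]))"
    proof (rule optrep_set[OF _ P(3)])
      fix L assume L: "ptot L \<le> K"
      show "L \<in> ?F (A + 1) \<longleftrightarrow> L \<in> plans_over (X @ [c])"
      proof
        assume "L \<in> plans_over (X @ [c])"
        then obtain k L' where L': "L = (c, k) # L'" "L' \<in> plans_over X" "feas c k"
          by (cases L) (auto simp: plans_over_def)
        then have "ptot L' \<le> A" using cA(3) L by (simp add: ptot_def)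
        then show "L \<in> ?F (A + 1)" using L' by (simp add: less_Suc_eq_le)
      qed (auto simp: plans_over_def)
    qed
    moreover have "t \<le> (A + 2) * ((m + 2) * 170)"
    proof -
      have "(A + 1 + 1) * (((m + 2) * 150 + 10) + 4 + 9) \<le> (A + 2) * ((m + 2) * 170)"
        by (intro mult_mono) auto
      then show ?thesis using P(1) by linarith
    qed
    ultimately show ?case using P(2) by blast
  qed
qed

lemma ptot_le:
  "\<forall>c\<in>set X. c < n \<Longrightarrow> L \<in> plans_over X \<Longrightarrow> ptot L \<le> (\<Sum>c\<leftarrow>X. sz c)"
proof (induction X arbitrary: L rule: rev_induct)
  case (snoc c X)
  then obtain k L' where L': "L = (c, k) # L'" "L' \<in> plans_over X" "feas c k"
    by (cases L) (auto simp: plans_over_def)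
  then show ?case using snoc.IH[of L'] snoc.prems(1) feas_bounds[of c k] by (auto simp: ptot_def)
qed (simp add: plans_over_def ptot_def)

lemma wp_merge:
  assumes K: "nmem s ''K'' 0 = K" and c: "nmem s ''x'' 0 = c" "c < n" "nmem s ''bs'' c = base c"
      "nmem s ''sz'' c = sz c"
    and row: "rowrep (heap s) (nmem s ''BP'') (rmem s ''BV'') c"
    and X: "\<forall>c\<in>set X. c < n"
    and cA: "nmem s ''cA'' 0 = min K (\<Sum>c\<leftarrow>X. sz c)"
    and T: "tables (heap s) (nmem s ''TP'') (rmem s ''TV'') (plans_over X)"
    and hp: "2 \<le> nmem s ''hp'' 0"
  shows "wp merge s (\<lambda>t s'. t \<le> (min K (\<Sum>c\<leftarrow>X. sz c) + 2) * ((min K (sz c) + 2) * 170) + (K + 2) * 100 \<and>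
    hext s s' \<and> tables (heap s') (nmem s' ''TP'') (rmem s' ''TV'') (plans_over (X @ [c])) \<and>
    nmem s' ''cA'' 0 = min K (\<Sum>c\<leftarrow>X @ [c]. sz c))"
  unfolding merge_def wp_Seq
proof (rule wp_conseq[OF wp_clear], goal_cases)
  case (3 t1 s1)
  let ?A = "min K (\<Sum>c\<leftarrow>X. sz c)" and ?m = "min K (sz c)"
  define s2 where "s2 = nupd ''bx'' 0 (base c) (nupd ''cx'' 0 ?m s1)"
  have f1: "nmem s1 y = nmem s y" if "y \<notin> {''c'', ''NP''}" for y using frm_n[OF 3(2)] that by simp
  have r1: "rmem s1 = rmem s" using frm_r[OF 3(2)] by auto
  have f2: "nmem s2 y = nmem s y" if "y \<notin> {''c'', ''NP'', ''bx'', ''cx''}" for y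
    using that f1 by (simp add: s2_def)
  have r2: "rmem s2 = rmem s" using r1 by (simp add: s2_def)
  have h2: "hext s s2" by (simp add: hext_def f2)
  have row2: "rowrep (heap s2) (nmem s2 ''BP'') (rmem s2 ''BV'') c" using row by (simp add: f2 r2)
  have T2: "tables (heap s2) (nmem s2 ''TP'') (rmem s2 ''TV'') (plans_over X)" using T by (simp add: f2 r2)
  have NP2: "\<forall>a\<le>K. nmem s2 ''NP'' a = 0" using 3(1) K by (simp add: s2_def)
  have A: "ptot L \<le> ?A" if "L \<in> plans_over X" "ptot L \<le> K" for L using ptot_le[OF X that(1)] that(2) by simp
  have m: "k \<le> ?m" if "k \<le> K" "feas c k" for k using feas_bounds[OF c(2) that(2)] that(1) by simp
  have ml: "wp merge_loop s2 (\<lambda>t s'. t \<le> (?A + 2) * ((?m + 2) * 170) \<and> hext s2 s' \<and>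
    tables (heap s') (nmem s' ''NP'') (rmem s' ''NV'') (plans_over (X @ [c])))"
    by (rule wp_merge_loop[OF _ _ _ row2 _ m _ _ A T2 _ NP2])
      (use K c cA hp in \<open>simp_all add: f2\<close>, simp_all add: s2_def)
  have sub: "nval (NSub (N ''K'') (NSub (N ''K'') (NGet ''sz'' (N ''x'')))) s1 = ?m"
    using K c by (simp add: f1 min_def)
  have "nval (NGet ''bs'' (N ''x'')) (nupd ''cx'' 0 ?m s1) = base c" using c by (simp add: f1)
  then have eq: "wp (NLet ''cx'' (NSub (N ''K'') (NSub (N ''K'') (NGet ''sz'' (N ''x''))))) s1
      (\<lambda>t2 s. wp (NLet ''bx'' (NGet ''bs'' (N ''x''))) s (\<lambda>t3 s. Q t2 t3 s)) = Q 11 5 s2"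
    for Q unfolding wp_NSet sub nval.simps(1) by (simp add: s2_def numeral_eq_Suc)
  show ?case
    unfolding eq
  proof (rule wp_conseq[OF ml], goal_cases)
    case (1 t3 s3)
    have P3: "t3 \<le> (?A + 2) * ((?m + 2) * 170)" "hext s2 s3"
      "tables (heap s3) (nmem s3 ''NP'') (rmem s3 ''NV'') (plans_over (X @ [c]))"
      using 1(1) by blast+
    have f3: "nmem s3 y = nmem s y" if "y \<notin> {''c'', ''NP'', ''bx'', ''cx'', ''a'', ''b'', ''CH'', ''CK'', ''CN'', ''hp''}" for y
      using frm_n[OF 1(2)] f2 that by simp
    have c3: "nmem s3 ''cx'' 0 = ?m" using frm_n[OF 1(2), of "''cx''"] by (simp add: s2_def)
    show ?case
    proof (rule wp_conseq[OF wp_copy], goal_cases)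
      case (1 t4 s4)
      note fr = frm[OF 1(2)]
      have "tables (heap s4) (nmem s4 ''TP'') (rmem s4 ''TV'') (plans_over (X @ [c]))"
      proof (rule optrep_table)
        show "tables (heap s4) (nmem s3 ''NP'') (rmem s3 ''NV'') (plans_over (X @ [c]))"
          using P3(3) by (simp add: fr)
      qed (use 1(1) K f3[of "''K''"] in auto)
      moreover have "hext s3 s4" by (simp add: hext_def fr)
      then have "hext s s4" using hext_trans[OF hext_trans[OF h2 P3(2)]] by blast
      moreover have "nmem s4 ''K'' 0 = K" "nmem s4 ''cA'' 0 = ?A" "nmem s4 ''cx'' 0 = ?m"
        using K cA c3 by (simp_all add: fr f3)
      moreover have "t1 \<le> (K + 2) * 20" "t4 \<le> (K + 2) * 40" using 3(1) 1(1) K f3[of "''K''"] by auto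
      ultimately show ?case
        using P3(1) by (simp add: wp_simps hext_def min_def)
    qed
  qed
qed simp_all

end

section \<open>Candidates for a node, and the round for one exception\<close>

definition etaE :: "rexp \<Rightarrow> rexp" where
  "etaE e = RSub (RConst 0) (RMul (RDiv e (R ''W'')) (RLog (RDiv e (R ''W''))))"

lemma rval_etaE [simp]: "rval (etaE e) s = eta (rmem s ''W'' 0) (rval e s)"
  and rcost_etaE [simp]: "rcost (etaE e) = 2 * rcost e + 10"
  by (simp_all add: etaE_def eta_def)

definition "cand_cell =
  If (And (NLess (NConst 0) (NGet ''TP'' (N ''a''))) (NLess (NAdd (N ''a'') (N ''ex'')) K1))
    (RLet ''t'' (RAdd (RGet ''TV'' (N ''a'')) (R ''hv'')) ;;
     If (Not (And (NLess (NConst 0) (NGet ''CP'' (NAdd (N ''a'') (N ''ex''))))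
           (Not (RLess (RGet ''CV'' (NAdd (N ''a'') (N ''ex''))) (R ''t'')))))
       (NSet ''CP'' (NAdd (N ''a'') (N ''ex'')) (NGet ''TP'' (N ''a'')) ;;
        RSet ''CV'' (NAdd (N ''a'') (N ''ex'')) (R ''t''))
       Skip)
    Skip"

text \<open>Root and \<open>other\<close> add the same number \<open>ex\<close> of nodes and the
  same value \<open>hv\<close> to all plans over the same children. The candidates are therefore a
  shifted copy of the knapsack table.\<close>

definition "cand_pre =
  If (NLess (N ''cO'') (NGet ''d'' (N ''v'')))
    (NLet ''ex'' (NConst 2) ;;
     RLet ''hv'' (RAdd (etaE (RGet ''weight'' (N ''v'')))
       (etaE (RSub (RSub (RGet ''tw'' (N ''v'')) (RGet ''weight'' (N ''v''))) (R ''wO'')))))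
    (NLet ''ex'' (NConst 1) ;; RLet ''hv'' (etaE (RGet ''weight'' (N ''v''))))"

definition "cand = cand_pre ;; For ''a'' K1 cand_cell"

lemma nw_cand [simp]: "nw cand = {''a'', ''ex'', ''CP''}" and rw_cand [simp]: "rw cand = {''t'', ''hv'', ''CV''}"
  and nw_cand_cell [simp]: "nw cand_cell = {''CP''}" and rw_cand_cell [simp]: "rw cand_cell = {''t'', ''CV''}"
  by (auto simp: cand_def cand_cell_def cand_pre_def)

definition "dp_child =
  NLet ''x'' (NGet ''top'' (NAdd (NGet ''bs'' (N ''v'')) (N ''j''))) ;;
  merge ;;
  NLet ''cO'' (NAdd (N ''cO'') (NConst 1)) ;;
  RLet ''wO'' (RAdd (R ''wO'') (RGet ''tw'' (N ''x''))) ;;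
  cand"

text \<open>For a fixed exception \<open>y\<close> the prefixes of all lengths are covered by one
  pass, since \<open>dp_child\<close> collects candidates after each merge. Only one round per
  exception is needed, not one per pair of exception and length.\<close>

definition "dp_round =
  For ''j'' (NGet ''ln'' (N ''v''))
    (If (And (Not (NLess (N ''j'') (N ''y''))) (Not (NLess (N ''y'') (N ''j'')))) Skip dp_child)"

definition "dp_start = NSet ''TP'' (NConst 0) (NConst 1) ;; RSet ''TV'' (NConst 0) (RConst 0) ;;
  NLet ''cA'' (NConst 0) ;; NLet ''cO'' (NConst 0) ;; RLet ''wO'' (RConst 0)"

definition "dp_try = clear ''TP'' ;; dp_start ;; cand ;; dp_round"

definition "dp_store = For ''c'' K1
  (NSet ''BP'' (NAdd (NGet ''bs'' (N ''v'')) (N ''c'')) (NGet ''CP'' (N ''c'')) ;;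
   RSet ''BV'' (NAdd (NGet ''bs'' (N ''v'')) (N ''c'')) (RGet ''CV'' (N ''c'')))"

text \<open>\<open>y\<close> also takes the value \<open>ln v\<close>, the round without exception.
  Entry 1 is written last because the one-node tree is a collapse and not a plan; at a leaf it
  replaces the candidate from the empty plan by the same value.\<close>

definition "dp = clear ''CP'' ;;
  For ''y'' (NAdd (NGet ''ln'' (N ''v'')) (NConst 1)) dp_try ;;
  NSet ''CP'' (NConst 1) (NConst 1) ;;
  RSet ''CV'' (NConst 1) (etaE (RGet ''tw'' (N ''v''))) ;;
  dp_store"

lemma nw_dp_child [simp]: "nw dp_child = {''x'', ''cO'', ''a'', ''ex'', ''CP'', ''c'', ''NP'', ''cx'', ''bx'',
    ''b'', ''CH'', ''CK'', ''CN'', ''hp'', ''TP'', ''cA''}"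
  and rw_dp_child [simp]: "rw dp_child = {''wO'', ''t'', ''hv'', ''CV'', ''NV'', ''TV''}"
  by (auto simp: dp_child_def)

lemma nw_dp_round [simp]: "nw dp_round = insert ''j'' (nw dp_child)"
  and rw_dp_round [simp]: "rw dp_round = rw dp_child"
  by (auto simp: dp_round_def)

lemma nw_dp_start [simp]: "nw dp_start = {''TP'', ''cA'', ''cO''}"
  and rw_dp_start [simp]: "rw dp_start = {''TV'', ''wO''}"
  by (auto simp: dp_start_def)

lemma nw_dp_try [simp]: "nw dp_try = insert ''j'' (nw dp_child)"
  and rw_dp_try [simp]: "rw dp_try = rw dp_child"
  by (auto simp: dp_try_def)

lemma nw_dp_store [simp]: "nw dp_store = {''c'', ''BP''}"
  and rw_dp_store [simp]: "rw dp_store = {''BV''}"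
  by (auto simp: dp_store_def)

lemma nw_dp [simp]: "nw dp = {''BP'', ''y'', ''j''} \<union> nw dp_child"
  and rw_dp [simp]: "rw dp = insert ''BV'' (rw dp_child)"
  by (auto simp: dp_def)

context weighted_tree
begin

lemma plans_over_sums:
  fixes f :: "nat \<Rightarrow> 'b :: comm_monoid_add"
  assumes "L \<in> plans_over X"
  shows "length L = length X" "(\<Sum>(c, k)\<leftarrow>L. f c) = (\<Sum>c\<leftarrow>X. f c)"
proof -
  have f: "map fst L = rev X" using assms by (simp add: plans_over_def)
  then show "length L = length X" by (metis length_map length_rev)
  have "(\<Sum>(c, k)\<leftarrow>L. f c) = (\<Sum>c\<leftarrow>map fst L. f c)" by (induction L) auto
  then show "(\<Sum>(c, k)\<leftarrow>L. f c) = (\<Sum>c\<leftarrow>X. f c)" unfolding f by (simp add: rev_map[symmetric])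
qed

abbreviation "cands v h P V A \<equiv> optrep K h P V A (psize v) (pval v)"

lemma wp_cand:
  assumes K: "nmem s ''K'' 0 = K" and v: "nmem s ''v'' 0 = v" "nmem s ''d'' v = card (Ch v)"
      "rmem s ''weight'' v = w v" "rmem s ''tw'' v = sw v" "rmem s ''W'' 0 = W"
    and X: "nmem s ''cO'' 0 = length X" "rmem s ''wO'' 0 = (\<Sum>c\<leftarrow>X. sw c)"
    and T: "tables (heap s) (nmem s ''TP'') (rmem s ''TV'') (plans_over X)"
    and C: "cands v (heap s) (nmem s ''CP'') (rmem s ''CV'') D"
  shows "wp cand s (\<lambda>t s'. t \<le> (K + 2) * 200 \<and>
    cands v (heap s') (nmem s' ''CP'') (rmem s' ''CV'') (D \<union> plans_over X))"
proof -
  define ex where "ex = (if length X < card (Ch v) then 2 else 1 :: nat)"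
  define hv where "hv = eta W (w v) +
    (if length X < card (Ch v) then eta W (sw v - w v - (\<Sum>c\<leftarrow>X. sw c)) else 0)"
  define s1 where "s1 = rupd ''hv'' 0 hv (nupd ''ex'' 0 ex s)"
  have pre: "wp cand_pre s Q \<longleftrightarrow> Q (if length X < card (Ch v) then 58 else 27) s1" for Q
    using v X by (simp add: cand_pre_def wp_simps s1_def ex_def hv_def numeral_eq_Suc)
  have size: "psize v L = ptot L + ex" if "L \<in> plans_over X" for L
    using plans_over_sums(1)[OF that] by (simp add: psize_def ptot_def ex_def)
  have val: "pval v L = pbest L + hv" if "L \<in> plans_over X" for L
    using plans_over_sums(1)[OF that] plans_over_sums(2)[OF that, of sw]
    by (simp add: pval_def pbest_def hv_def)
  let ?D = "\<lambda>i. D \<union> {L \<in> plans_over X. ptot L < i}"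
  have "wp (For ''a'' K1 cand_cell) s1 (\<lambda>t s'. t \<le> (K + 1 + 1) * (80 + 4 + 9) \<and> nmem s' ''a'' 0 = K + 1 \<and>
    cands v (heap s') (nmem s' ''CP'') (rmem s' ''CV'') (?D (K + 1)))"
  proof (rule wp_conseq[OF wp_For_const[where m = "K + 1" and b = 80 and
      I = "\<lambda>i s'. cands v (heap s') (nmem s' ''CP'') (rmem s' ''CV'') (?D i)"]], goal_cases)
    case 2
    then show ?case using C by (simp add: s1_def)
  next
    case (3 i s')
    then show ?case using K by (simp add: frm s1_def)
  next
    case (4 i s')
    have f: "nmem s' y = nmem s y" if "y \<notin> {''a'', ''CP'', ''ex''}" for y
      using frm_n[OF 4(3)] that by (simp add: s1_def)
    have fr: "rmem s' y = rmem s y" if "y \<notin> {''t'', ''CV'', ''hv''}" for y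
      using frm_r[OF 4(3)] that by (simp add: s1_def)
    have ehv: "nmem s' ''ex'' 0 = ex" "rmem s' ''hv'' 0 = hv"
      using frm[OF 4(3)] by (simp_all add: s1_def)
    have iK: "i \<le> K" using 4(1) by simp
    note N = 4(4)
    let ?M = "{L \<in> plans_over X. ptot L = i}"
    have E: "?D (Suc i) = ?D i \<union> ?M" by (auto simp: less_Suc_eq)
    show ?case
    proof (cases "nmem s ''TP'' i \<noteq> 0 \<and> i + ex \<le> K")
      case False
      have "cands v (heap s') (nmem s' ''CP'') (rmem s' ''CV'') (?D (Suc i))"
      proof (cases "i + ex \<le> K")
        case True
        then have "nmem s ''TP'' i = 0" using False by simp
        then have M0: "?M = {}" using T iK unfolding optrep_def by blast
        show ?thesis unfolding E M0 Un_empty_right by (rule N)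
      next
        case False
        show ?thesis unfolding E by (rule optrep_beyond[OF N]) (use False size in auto)
      qed
      then show ?thesis using False 4(2) K ehv unfolding cand_cell_def by (auto simp: wp_simps f)
    next
      case True
      then have "nmem s ''TP'' i \<noteq> 0" by simp
      with T iK obtain L1 where L1: "L1 \<in> plans_over X" "ptot L1 = i" "heap s (nmem s ''TP'' i) L1"
        "rmem s ''TV'' i = pbest L1" "\<And>L. L \<in> plans_over X \<Longrightarrow> ptot L = i \<Longrightarrow> pbest L \<le> pbest L1"
        unfolding optrep_def by blast
      have M: "L1 \<in> ?M" using L1 by simp
      have Mle: "psize v L = i + ex \<and> pval v L \<le> pval v L1" if "L \<in> ?M" for L
        using that size val L1 by auto
      have v1: "pval v L1 = rmem s ''TV'' i + hv" using L1 val by simp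
      have b1: "bval (And (NLess (NConst 0) (NGet ''TP'' (N ''a''))) (NLess (NAdd (N ''a'') (N ''ex'')) K1)) s'"
        using True 4(2) K ehv by (simp add: f)
      have r1: "rval (RAdd (RGet ''TV'' (N ''a'')) (R ''hv'')) s' = pval v L1"
        using v1 4(2) ehv by (simp add: fr)
      let ?c2 = "Not (And (NLess (NConst 0) (NGet ''CP'' (NAdd (N ''a'') (N ''ex''))))
           (Not (RLess (RGet ''CV'' (NAdd (N ''a'') (N ''ex''))) (R ''t''))))"
      show ?thesis
      proof (cases "nmem s' ''CP'' (i + ex) \<noteq> 0 \<and> pval v L1 \<le> rmem s' ''CV'' (i + ex)")
        case skip: True
        have "cands v (heap s') (nmem s' ''CP'') (rmem s' ''CV'') (?D (Suc i))"
          unfolding E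
        proof (rule optrep_relax(1)[where ?L0.0 = L1 and c = "i + ex"])
          show "psize v L = i + ex \<and> pval v L \<le> pval v L1" if "L \<in> ?M" for L using that by (rule Mle)
        qed (fact N M skip)+
        moreover have "\<not> bval ?c2 (rupd ''t'' 0 (pval v L1) s')"
          using skip 4(2) ehv by auto
        note b2 = if_not_P[OF this]
        ultimately show ?thesis
          unfolding cand_cell_def wp_If if_P[OF b1] wp_Seq[of "RLet _ _"] wp_RSet[of "''t''"] r1 nval.simps(1) b2
          by (simp add: wp_Skip)
      next
        case upd: False
        define s2 where "s2 = rupd ''CV'' (i + ex) (pval v L1) (nupd ''CP'' (i + ex) (nmem s ''TP'' i)
          (rupd ''t'' 0 (pval v L1) s'))"
        have hL: "heap s' (nmem s ''TP'' i) L1" using L1(3) by (simp add: f)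
        have "cands v (heap s') ((nmem s' ''CP'')(i + ex := nmem s ''TP'' i))
            ((rmem s' ''CV'')(i + ex := pval v L1)) (?D (Suc i))"
          unfolding E
        proof (rule optrep_relax(2)[where ?L0.0 = L1 and c = "i + ex"])
          show "psize v L = i + ex \<and> pval v L \<le> pval v L1" if "L \<in> ?M" for L using that by (rule Mle)
          show "nmem s ''TP'' i \<noteq> 0" using True by simp
        qed (fact N M upd hL)+
        then have inv: "cands v (heap (nupd ''a'' 0 (Suc i) s2)) (nmem (nupd ''a'' 0 (Suc i) s2) ''CP'')
            (rmem (nupd ''a'' 0 (Suc i) s2) ''CV'') (?D (Suc i))"
          by (simp add: s2_def)
        have "bval ?c2 (rupd ''t'' 0 (pval v L1) s')" using upd 4(2) ehv by auto
        note b2 = if_P[OF this]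
        have blk: "wp (NSet ''CP'' (NAdd (N ''a'') (N ''ex'')) (NGet ''TP'' (N ''a'')) ;;
            RSet ''CV'' (NAdd (N ''a'') (N ''ex'')) (R ''t'')) (rupd ''t'' 0 (pval v L1) s') Q = Q 17 s2" for Q
          using 4(2) ehv by (simp add: wp_simps s2_def f numeral_eq_Suc)
        show ?thesis
          unfolding cand_cell_def wp_If if_P[OF b1] wp_Seq[of "RLet _ _"] wp_RSet[of "''t''"] r1 nval.simps(1) b2 blk
          using inv by (intro conjI) (simp, blast)
      qed
    qed
  qed auto
  then show ?thesis
    unfolding cand_def wp_Seq pre
  proof (rule wp_conseq, goal_cases)
    case (1 t s')
    then have P: "t \<le> (K + 1 + 1) * (80 + 4 + 9)"
      "cands v (heap s') (nmem s' ''CP'') (rmem s' ''CV'') (?D (K + 1))" by blast+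
    have "cands v (heap s') (nmem s' ''CP'') (rmem s' ''CV'') (D \<union> plans_over X)"
    proof (rule optrep_set[OF _ P(2)])
      fix L :: "(nat \<times> nat) list" assume L: "psize v L \<le> K"
      have "ptot L < K + 1" if "L \<in> plans_over X" using size[OF that] L by simp
      then show "L \<in> ?D (K + 1) \<longleftrightarrow> L \<in> D \<union> plans_over X" by auto
    qed
    moreover have "(if length X < card (Ch v) then 58 else 27) + t \<le> (K + 2) * 200"
      using P(1) by simp
    ultimately show ?case by blast
  qed
qed

definition dpenv :: "state \<Rightarrow> nat \<Rightarrow> nat list \<Rightarrow> bool" where
  "dpenv s v L0 \<longleftrightarrow> nmem s ''K'' 0 = K \<and> nmem s ''v'' 0 = v \<and> rmem s ''W'' 0 = W \<and>
     rmem s ''weight'' v = w v \<and> rmem s ''tw'' v = sw v \<and> nmem s ''d'' v = card (Ch v) \<and>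
     nmem s ''ln'' v = length L0 \<and> nmem s ''bs'' v = base v \<and>
     (\<forall>j<length L0. nmem s ''top'' (base v + j) = L0 ! j) \<and>
     (\<forall>c\<in>set L0. c < n \<and> nmem s ''bs'' c = base c \<and> nmem s ''sz'' c = sz c \<and> rmem s ''tw'' c = sw c \<and>
        rowrep (heap s) (nmem s ''BP'') (rmem s ''BV'') c) \<and>
     2 \<le> nmem s ''hp'' 0"

lemma dpenv_frm:
  assumes "dpenv s v L0" "frm A B s s'" "hext s s'"
    "{''K'', ''v'', ''d'', ''ln'', ''bs'', ''top'', ''sz'', ''BP''} \<inter> A = {}"
    "{''W'', ''weight'', ''tw'', ''BV''} \<inter> B = {}"
  shows "dpenv s' v L0"
proof -
  have e: "nmem s' ''K'' = nmem s ''K''" "nmem s' ''v'' = nmem s ''v''" "nmem s' ''d'' = nmem s ''d''"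
    "nmem s' ''ln'' = nmem s ''ln''" "nmem s' ''bs'' = nmem s ''bs''" "nmem s' ''top'' = nmem s ''top''"
    "nmem s' ''sz'' = nmem s ''sz''" "nmem s' ''BP'' = nmem s ''BP''"
    "rmem s' ''W'' = rmem s ''W''" "rmem s' ''weight'' = rmem s ''weight''"
    "rmem s' ''tw'' = rmem s ''tw''" "rmem s' ''BV'' = rmem s ''BV''"
    using assms(4,5) by (auto intro!: frm_n[OF assms(2)] frm_r[OF assms(2)])
  have "2 \<le> nmem s' ''hp'' 0" if "2 \<le> nmem s ''hp'' 0" using that assms(3) by (simp add: hext_def)
  moreover have "rowrep (heap s') (nmem s' ''BP'') (rmem s' ''BV'') c"
    if "rowrep (heap s) (nmem s ''BP'') (rmem s ''BV'') c" for c
    unfolding e using linked_hext[OF assms(3)] that by (rule rowrep_heap)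
  ultimately show ?thesis using assms(1) unfolding dpenv_def e by blast
qed

definition dpst :: "state \<Rightarrow> nat \<Rightarrow> nat list \<Rightarrow> (nat \<times> nat) list set \<Rightarrow> bool" where
  "dpst s v X D \<longleftrightarrow> nmem s ''cO'' 0 = length X \<and> rmem s ''wO'' 0 = (\<Sum>c\<leftarrow>X. sw c) \<and>
     nmem s ''cA'' 0 = min K (\<Sum>c\<leftarrow>X. sz c) \<and>
     tables (heap s) (nmem s ''TP'') (rmem s ''TV'') (plans_over X) \<and>
     cands v (heap s) (nmem s ''CP'') (rmem s ''CV'') D"

definition merge_time :: "nat list \<Rightarrow> nat \<Rightarrow> nat" where
  "merge_time X c = (min K (\<Sum>c\<leftarrow>X. sz c) + 2) * ((min K (sz c) + 2) * 170) + (K + 2) * 400"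

lemma wp_dp_child:
  assumes env: "dpenv s v L0" and j: "nmem s ''j'' 0 = j" "j < length L0"
    and X: "set X \<subseteq> set L0" and st: "dpst s v X D"
  shows "wp dp_child s (\<lambda>t s'. t \<le> merge_time X (L0 ! j) \<and> hext s s' \<and>
    dpst s' v (X @ [L0 ! j]) (D \<union> plans_over (X @ [L0 ! j])))"
proof -
  let ?c = "L0 ! j"
  have c: "?c \<in> set L0" using j by simp
  define s1 where "s1 = nupd ''x'' 0 ?c s"
  have set_x: "wp (NLet ''x'' (NGet ''top'' (NAdd (NGet ''bs'' (N ''v'')) (N ''j'')))) s Q = Q 9 s1" for Q
    using env j by (simp add: wp_simps s1_def dpenv_def numeral_eq_Suc)
  have h1: "hext s s1" by (simp add: s1_def hext_def)
  have env1: "dpenv s1 v L0" using env by (simp add: dpenv_def s1_def)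
  have st1: "dpst s1 v X D" using st by (simp add: dpst_def s1_def)
  have m: "wp merge s1 (\<lambda>t s'. t \<le> (min K (\<Sum>c\<leftarrow>X. sz c) + 2) * ((min K (sz ?c) + 2) * 170) + (K + 2) * 100 \<and>
    hext s1 s' \<and> tables (heap s') (nmem s' ''TP'') (rmem s' ''TV'') (plans_over (X @ [?c])) \<and>
    nmem s' ''cA'' 0 = min K (\<Sum>c\<leftarrow>X @ [?c]. sz c))"
    by (rule wp_merge) (use env1 st1 c X in \<open>auto simp: dpenv_def dpst_def s1_def\<close>)
  show ?thesis
    unfolding dp_child_def wp_Seq set_x
  proof (rule wp_conseq[OF m], goal_cases)
    case (1 t s2)
    then have P: "t \<le> (min K (\<Sum>c\<leftarrow>X. sz c) + 2) * ((min K (sz ?c) + 2) * 170) + (K + 2) * 100"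
      "hext s1 s2" "tables (heap s2) (nmem s2 ''TP'') (rmem s2 ''TV'') (plans_over (X @ [?c]))"
      "nmem s2 ''cA'' 0 = min K (\<Sum>c\<leftarrow>X @ [?c]. sz c)" by blast+
    note fr = frm[OF 1(2)]
    have env2: "dpenv s2 v L0" by (rule dpenv_frm[OF env1 1(2) P(2)]) auto
    define s3 where "s3 = rupd ''wO'' 0 (\<Sum>c\<leftarrow>X @ [?c]. sw c) (nupd ''cO'' 0 (length X + 1) s2)"
    have blk: "wp (NLet ''cO'' (NAdd (N ''cO'') (NConst 1))) s2 (\<lambda>t2 s.
        wp (RLet ''wO'' (RAdd (R ''wO'') (RGet ''tw'' (N ''x'')))) s (\<lambda>t3 s. Q t2 t3 s)) = Q 6 8 s3" for Q
      using st1 env2 c by (simp add: wp_simps s3_def fr dpst_def dpenv_def s1_def numeral_eq_Suc)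
    have C3: "cands v (heap s3) (nmem s3 ''CP'') (rmem s3 ''CV'') D"
    proof -
      have "cands v (heap s1) (nmem s1 ''CP'') (rmem s1 ''CV'') D" using st1 by (simp add: dpst_def)
      with linked_hext[OF P(2)] have "cands v (heap s2) (nmem s1 ''CP'') (rmem s1 ''CV'') D"
        by (rule optrep_heap)
      then show ?thesis by (simp add: s3_def fr)
    qed
    have cd: "wp cand s3 (\<lambda>t s'. t \<le> (K + 2) * 200 \<and>
      cands v (heap s') (nmem s' ''CP'') (rmem s' ''CV'') (D \<union> plans_over (X @ [?c])))"
      by (rule wp_cand[OF _ _ _ _ _ _ _ _ _ C3]) (use env2 P(3) in \<open>simp_all add: dpenv_def s3_def\<close>)
    show ?case
      unfolding blk
    proof (rule wp_conseq[OF cd], goal_cases)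
      case (1 t' s4)
      note fr4 = frm[OF 1(2)]
      have h34: "hext s3 s4" by (simp add: hext_def fr4)
      have h: "hext s s4"
        using hext_trans[OF h1 hext_trans[OF P(2) hext_trans[OF _ h34]]] by (simp add: s3_def hext_def)
      have "dpst s4 v (X @ [?c]) (D \<union> plans_over (X @ [?c]))"
        using 1(1) P(3,4) by (simp add: dpst_def fr4 s3_def)
      then show ?case using 1(1) P(1) h by (simp add: merge_time_def)
    qed
  qed
qed

lemma kept_Suc: "kept L0 y (Suc j) = kept L0 y j @ (if j = y then [] else [L0 ! j])"
  by (simp add: kept_def)

lemma set_kept: "j \<le> length L0 \<Longrightarrow> set (kept L0 y j) \<subseteq> set L0"
  by (auto simp: kept_def)

definition "kept_plans L0 y j = (\<Union>i\<in>{..j}. plans_over (kept L0 y i))"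

definition "round_time L0 y j = (if j = y then 20 else merge_time (kept L0 y j) (L0 ! j) + 20)"

lemma wp_dp_round:
  assumes env: "dpenv s v L0" and y: "nmem s ''y'' 0 = y"
    and st: "dpst s v [] (D \<union> plans_over [])"
  shows "wp dp_round s (\<lambda>t s'. t \<le> (\<Sum>j<length L0. round_time L0 y j) + (length L0 + 1) * 30 \<and> hext s s' \<and>
    cands v (heap s') (nmem s' ''CP'') (rmem s' ''CV'') (D \<union> kept_plans L0 y (length L0)))"
proof -
  have "wp dp_round s (\<lambda>t s'. t \<le> (\<Sum>j<length L0. round_time L0 y j) +
      length L0 * (ncost (NGet ''ln'' (N ''v'')) + 9) + ncost (NGet ''ln'' (N ''v'')) + 9 \<and>
    nmem s' ''j'' 0 = length L0 \<and> (hext s s' \<and> dpst s' v (kept L0 y (length L0)) (D \<union> kept_plans L0 y (length L0))))"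
    unfolding dp_round_def
  proof (rule wp_For[where I = "\<lambda>j s'. hext s s' \<and> dpst s' v (kept L0 y j) (D \<union> kept_plans L0 y j)"], goal_cases)
    case 2
    then show ?case using st by (simp add: dpst_def hext_def kept_def kept_plans_def)
  next
    case (3 i s')
    then show ?case using env by (simp add: frm dpenv_def)
  next
    case (4 j s')
    have h: "hext s s'" and st': "dpst s' v (kept L0 y j) (D \<union> kept_plans L0 y j)" using 4(4) by auto
    have env': "dpenv s' v L0" by (rule dpenv_frm[OF env 4(3) h]) auto
    have y': "nmem s' ''y'' 0 = y" using frm_n[OF 4(3), of "''y''"] y by simp
    have KP: "kept_plans L0 y (Suc j) = kept_plans L0 y j \<union> plans_over (kept L0 y (Suc j))"
      by (auto simp: kept_plans_def atMost_Suc)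
    show ?case
    proof (cases "j = y")
      case True
      have k: "kept L0 y (Suc j) = kept L0 y j" using True by (simp add: kept_Suc)
      have kp: "kept_plans L0 y (Suc j) = kept_plans L0 y j" unfolding KP k by (auto simp: kept_plans_def)
      have "bval (And (Not (NLess (N ''j'') (N ''y''))) (Not (NLess (N ''y'') (N ''j'')))) s'"
        using True y' 4(2) by simp
      note b = if_P[OF this]
      show ?thesis
        unfolding wp_If b wp_Skip k kp
        using st' h True by (simp add: round_time_def dpst_def hext_def)
    next
      case False
      have k: "kept L0 y (Suc j) = kept L0 y j @ [L0 ! j]" using False by (simp add: kept_Suc)
      have "wp dp_child s' (\<lambda>t s''. 20 + t \<le> round_time L0 y j \<and>
        (hext s (nupd ''j'' 0 (Suc j) s'') \<and> dpst (nupd ''j'' 0 (Suc j) s'') v (kept L0 y (Suc j)) (D \<union> kept_plans L0 y (Suc j))))"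
      proof (rule wp_conseq[OF wp_dp_child[OF env' 4(2,1) set_kept st']], goal_cases)
        case 1
        then show ?case using 4(1) by simp
      next
        case (2 t s'')
        have "hext s s''" using hext_trans[OF h] 2(1) by blast
        then show ?case using 2(1) False
          unfolding KP k by (simp add: round_time_def dpst_def hext_def Un_assoc)
      qed
      note * = this
      have "\<not> bval (And (Not (NLess (N ''j'') (N ''y''))) (Not (NLess (N ''y'') (N ''j'')))) s'"
        using False y' 4(2) by auto
      note b = if_not_P[OF this]
      show ?thesis unfolding wp_If b using * by (rule wp_conseq) simp
    qed
  qed auto
  then show ?thesis by (rule wp_conseq) (auto simp: dpst_def)
qed


text \<open>\<open>Phi\<close> is a potential for the total cost of merging tables: combining sets of \<open>a\<close> and \<open>b\<close>
  nodes costs \<open>min K a * min K b\<close>.\<close>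

definition Phi :: "nat \<Rightarrow> nat" where "Phi a = min K a * (2 * a - min K a)"

text \<open>\<open>Phi\<close> is the square up to K and its tangent from there on. The square of a
  sum leaves 2ab for a merge that costs ab, and the linear continuation keeps the potential of the
  whole tree at O(K n). The proof moves to integers to avoid truncated subtraction.\<close>

lemma Phi_merge: "Phi a + Phi b + min K a * min K b \<le> Phi (a + b)"
proof -
  define f where "f x = (if x \<le> int K then x * x else int K * (2 * x - int K))" for x :: int
  define g where "g x = (if x \<le> int K then x else int K)" for x :: int
  have P: "int (Phi x) = f (int x)" for x
    by (auto simp: Phi_def f_def of_nat_diff min_def algebra_simps)
  have G: "int (min K x) = g (int x)" for x by (auto simp: g_def)
  have main: "f x + f y + g x * g y \<le> f (x + y)" if "0 \<le> x" "x \<le> y" for x y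
  proof -
    have K0: "0 \<le> int K" by simp
    consider "x + y \<le> int K" | "y \<le> int K" "int K < x + y" | "x \<le> int K" "int K < y" | "int K < x"
      by linarith
    then show ?thesis
    proof cases
      case 1
      have "0 \<le> x * y" using that by simp
      then show ?thesis using 1 that K0 by (simp add: f_def g_def algebra_simps)
    next
      case 2
      \<comment> \<open>The difference of the two sides is a sum of two products of nonnegative
        factors; \<open>2 * (x + y) - int K - y\<close> is nonnegative because
        \<open>int K < x + y\<close>.\<close>
      have "0 \<le> (int K - y) * (2 * (x + y) - int K - y)"
        using 2 that by (intro mult_nonneg_nonneg) auto
      moreover have "0 \<le> x * (y - x)" using that by (intro mult_nonneg_nonneg) auto
      moreover have "int K * (2 * (x + y) - int K) - (x * x + y * y + x * y) =
          (int K - y) * (2 * (x + y) - int K - y) + x * (y - x)"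
        by (simp add: algebra_simps)
      ultimately have "x * x + y * y + x * y \<le> int K * (2 * (x + y) - int K)" by linarith
      then show ?thesis using 2 that by (simp add: f_def g_def)
    next
      case 3
      have "0 \<le> x * (int K - x)" using 3 that by (auto intro!: mult_nonneg_nonneg)
      then show ?thesis using 3 that by (simp add: f_def g_def algebra_simps)
    next
      case 4
      then show ?thesis using that K0 by (simp add: f_def g_def algebra_simps)
    qed
  qed
  have "f (int a) + f (int b) + g (int a) * g (int b) \<le> f (int a + int b)"
    using main[of "int a" "int b"] main[of "int b" "int a"]
    by (cases "int a \<le> int b") (auto simp: add.commute mult.commute)
  then have "int (Phi a + Phi b + min K a * min K b) \<le> int (Phi (a + b))"
    unfolding of_nat_add of_nat_mult P G by simp
  then show ?thesis by linarith
qed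

lemma Phi_add: "Phi a + Phi b \<le> Phi (a + b)" using Phi_merge[of a b] by linarith

lemma Phi_sum: "finite C \<Longrightarrow> (\<Sum>c\<in>C. Phi (f c)) \<le> Phi (\<Sum>c\<in>C. f c)"
proof (induction rule: finite_induct)
  case (insert c C)
  then show ?case using Phi_add[of "f c" "\<Sum>c\<in>C. f c"] by simp
qed simp

lemma Phi_le: "Phi a \<le> 2 * K * a"
proof -
  have "min K a * (2 * a - min K a) \<le> K * (2 * a)" by (intro mult_mono) auto
  then show ?thesis by (simp add: Phi_def)
qed

text \<open>The potential of v beyond that of its children. One gap pays for the product terms of
  one round at v, and over the tree the gaps telescope to \<open>Phi n\<close>.\<close>

definition "gap v = Phi (sz v) - (\<Sum>c\<in>Ch v. Phi (sz c))"

lemma Phi_Ch: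
  assumes "v < n" "X \<subseteq> Ch v"
  shows "Phi (\<Sum>c\<in>X. sz c) + (\<Sum>c\<in>Ch v - X. Phi (sz c)) \<le> Phi (sz v)"
proof -
  have "(\<Sum>c\<in>Ch v - X. Phi (sz c)) \<le> Phi (\<Sum>c\<in>Ch v - X. sz c)" by (rule Phi_sum) simp
  moreover have "sz v = (\<Sum>c\<in>X. sz c) + (\<Sum>c\<in>Ch v - X. sz c) + 1"
    using sz_eq[OF assms(1)] sum.subset_diff[OF assms(2) finite_Ch, of sz] by simp
  ultimately show ?thesis
    using Phi_add[of "\<Sum>c\<in>X. sz c" "\<Sum>c\<in>Ch v - X. sz c"]
      Phi_add[of "(\<Sum>c\<in>X. sz c) + (\<Sum>c\<in>Ch v - X. sz c)" 1] by simp
qed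

lemma gap_eq: "v < n \<Longrightarrow> gap v + (\<Sum>c\<in>Ch v. Phi (sz c)) = Phi (sz v)"
  using Phi_Ch[of v "{}"] by (simp add: gap_def)

lemma sum_Ch: "(\<Sum>v<n. \<Sum>c\<in>Ch v. f c) = (\<Sum>c\<in>{..<n} - {rt}. f c)"
proof -
  have "(\<Sum>c\<in>(\<Union>v\<in>{..<n}. Ch v). f c) = (\<Sum>v<n. \<Sum>c\<in>Ch v. f c)"
    by (rule sum.UNION_disjoint) (use Ch_disjoint in auto)
  moreover have "(\<Union>v\<in>{..<n}. Ch v) = {..<n} - {rt}"
    using Ch_iff in_Ch_p p_less by fastforce
  ultimately show ?thesis by simp
qed

lemma sum_gap: "(\<Sum>v<n. gap v) \<le> 2 * K * n"
proof -
  have "(\<Sum>v<n. gap v) + (\<Sum>v<n. \<Sum>c\<in>Ch v. Phi (sz c)) = (\<Sum>v<n. Phi (sz v))"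
    unfolding sum.distrib[symmetric] by (intro sum.cong refl gap_eq) simp
  moreover have "(\<Sum>v<n. Phi (sz v)) = Phi (sz rt) + (\<Sum>c\<in>{..<n} - {rt}. Phi (sz c))"
    using rt_less by (intro sum.remove) auto
  ultimately show ?thesis using Phi_le[of n] unfolding sum_Ch sz_rt by simp
qed

lemma sum_card_Ch: "(\<Sum>v<n. card (Ch v) + 1) \<le> 2 * n"
proof -
  have "(\<Sum>v<n. card (Ch v)) = (\<Sum>v<n. \<Sum>c\<in>Ch v. 1)" by simp
  also have "\<dots> = card ({..<n} - {rt})" unfolding sum_Ch by simp
  finally show ?thesis using card_Diff_subset[of "{rt}" "{..<n}"] rt_less by (simp only: sum.distrib) simp
qed

text \<open>\<open>Phi_merge\<close> telescoped along a round: the growing table is one set of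
  nodes, each new child another, and the skipped child costs nothing.\<close>

lemma kept_Phi: "(\<Sum>i<j. if i = y then 0 else min K (\<Sum>c\<leftarrow>kept L y i. sz c) * min K (sz (L ! i))) +
    (\<Sum>c\<leftarrow>kept L y j. Phi (sz c)) \<le> Phi (\<Sum>c\<leftarrow>kept L y j. sz c)"
proof (induction j)
  case (Suc j)
  show ?case
  proof (cases "j = y")
    case False
    then show ?thesis
      using Suc Phi_merge[of "\<Sum>c\<leftarrow>kept L y j. sz c" "sz (L ! j)"] by (simp add: kept_Suc)
  qed (use Suc in \<open>simp add: kept_Suc\<close>)
qed (simp add: kept_def)

lemma merges_le_gap:
  assumes "v < n" "heaviest (Ch v) L"
  shows "(\<Sum>i<length L. if i = y then 0 else min K (\<Sum>c\<leftarrow>kept L y i. sz c) * min K (sz (L ! i))) \<le> gap v"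
proof -
  let ?X = "kept L y (length L)"
  have d: "distinct ?X" using assms(2) by (auto simp: kept_def heaviest_def distinct_map intro: inj_on_nth)
  have X: "set ?X \<subseteq> Ch v" using assms(2) set_kept[of "length L" L y] by (auto simp: heaviest_def)
  have s: "(\<Sum>c\<leftarrow>?X. f c) = (\<Sum>c\<in>set ?X. f c)" for f :: "nat \<Rightarrow> nat"
    using sum_list_distinct_conv_sum_set[OF d] .
  have "(\<Sum>c\<in>Ch v. Phi (sz c)) = (\<Sum>c\<in>set ?X. Phi (sz c)) + (\<Sum>c\<in>Ch v - set ?X. Phi (sz c))"
    using sum.subset_diff[OF X finite_Ch, of "\<lambda>c. Phi (sz c)"] by simp
  then show ?thesis
    using kept_Phi[of y L "length L"] Phi_Ch[OF assms(1) X] unfolding s gap_def by linarith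
qed

lemma round_time_sum:
  assumes "v < n" "heaviest (Ch v) L"
  shows "(\<Sum>j<length L. round_time L y j) \<le> 170 * gap v + length L * (2600 * K)"
proof -
  let ?p = "\<lambda>i. if i = y then 0 else min K (\<Sum>c\<leftarrow>kept L y i. sz c) * min K (sz (L ! i))"
  \<comment> \<open>Apart from the product, a merge takes at most 1080 K + 1500, which is below 2600
    K since K is at least 1.\<close>
  have "round_time L y j \<le> 170 * ?p j + 2600 * K" for j
  proof (cases "j = y")
    case False
    let ?A = "min K (\<Sum>c\<leftarrow>kept L y j. sz c)" and ?B = "min K (sz (L ! j))"
    have "(?A + 2) * ((?B + 2) * 170) = 170 * (?A * ?B) + 340 * ?A + 340 * ?B + 680"
      by (simp add: algebra_simps)
    moreover have "?A \<le> K" "?B \<le> K" by simp_all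
    ultimately show ?thesis using False K_pos by (simp add: round_time_def merge_time_def)
  qed (use K_pos in \<open>simp add: round_time_def\<close>)
  then have "(\<Sum>j<length L. round_time L y j) \<le> (\<Sum>j<length L. 170 * ?p j + 2600 * K)"
    by (intro sum_mono)
  also have "\<dots> = 170 * (\<Sum>j<length L. ?p j) + length L * (2600 * K)"
    by (simp add: sum.distrib sum_distrib_left)
  finally show ?thesis using merges_le_gap[OF assms, of y] by linarith
qed

section \<open>One round, and the complete table of a node\<close>

lemma wp_dp_try:
  assumes v: "v < n" "heaviest (Ch v) L0" and env: "dpenv s v L0" and y: "nmem s ''y'' 0 = y"
    and C: "cands v (heap s) (nmem s ''CP'') (rmem s ''CV'') D"
  shows "wp dp_try s (\<lambda>t s'. t \<le> 170 * gap v + (length L0 + 1) * (3500 * K) \<and> hext s s' \<and>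
    cands v (heap s') (nmem s' ''CP'') (rmem s' ''CV'') (D \<union> kept_plans L0 y (length L0)))"
  unfolding dp_try_def wp_Seq
proof (rule wp_conseq[OF wp_clear], goal_cases)
  case (3 t1 s1)
  note fr1 = frm[OF 3(2)]
  define s2 where "s2 = rupd ''wO'' 0 0 (nupd ''cO'' 0 0 (nupd ''cA'' 0 0 (rupd ''TV'' 0 0 (nupd ''TP'' 0 1 s1))))"
  have st: "wp dp_start s1 Q = Q 15 s2" for Q
    by (simp add: dp_start_def wp_simps s2_def numeral_eq_Suc)
  have K: "nmem s ''K'' 0 = K" using env by (simp add: dpenv_def)
  have f2: "frm {''TP'', ''c'', ''cA'', ''cO''} {''TV'', ''wO''} s s2"
    using 3(2) by (auto simp: frm_def s2_def)
  have h2: "hext s s2" by (rule hext_frm[OF f2]) auto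
  have env2: "dpenv s2 v L0" by (rule dpenv_frm[OF env f2 h2]) auto
  have T2: "tables (heap s2) (nmem s2 ''TP'') (rmem s2 ''TV'') (plans_over [])"
    using 3(1) K by (auto simp: optrep_def s2_def plans_over_def ptot_def pbest_def)
  have C2: "cands v (heap s2) (nmem s2 ''CP'') (rmem s2 ''CV'') D"
    using C by (simp add: s2_def fr1)
  have y2: "nmem s2 ''y'' 0 = y" using y by (simp add: s2_def fr1)
  have t1: "t1 \<le> (K + 2) * 20" using 3(1) K by simp
  have cd: "wp cand s2 (\<lambda>t s'. t \<le> (K + 2) * 200 \<and>
      cands v (heap s') (nmem s' ''CP'') (rmem s' ''CV'') (D \<union> plans_over []))"
    by (rule wp_cand[OF _ _ _ _ _ _ _ _ T2 C2]) (use env2 in \<open>simp_all add: dpenv_def s2_def\<close>)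
  show ?case
    unfolding st
  proof (rule wp_conseq[OF cd], goal_cases)
    case (1 t3 s3)
    note fr3 = frm[OF 1(2)]
    have h3: "hext s2 s3" by (rule hext_frm[OF 1(2)]) auto
    have env3: "dpenv s3 v L0" by (rule dpenv_frm[OF env2 1(2) h3]) auto
    have "dpst s3 v [] (D \<union> plans_over [])"
      using 1(1) T2 by (simp add: dpst_def fr3) (simp add: s2_def)
    from wp_dp_round[OF env3 _ this, of y]
    have r: "wp dp_round s3 (\<lambda>t s'. t \<le> (\<Sum>j<length L0. round_time L0 y j) + (length L0 + 1) * 30 \<and> hext s3 s' \<and>
        cands v (heap s') (nmem s' ''CP'') (rmem s' ''CV'') (D \<union> kept_plans L0 y (length L0)))"
      using y2 by (simp add: fr3)
    show ?case
    proof (rule wp_conseq[OF r], goal_cases)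
      case (1 t4 s4)
      have "hext s s4" using 1(1) hext_trans[OF h2 hext_trans[OF h3]] by blast
      moreover have "t1 + (15 + (t3 + t4)) \<le> 170 * gap v + (length L0 + 1) * (3500 * K)"
      proof -
        define LK where "LK = length L0 * K"
        have e: "(length L0 + 1) * (3500 * K) = 3500 * LK + 3500 * K" by (simp add: LK_def)
        define S where "S = sum (round_time L0 y) {..<length L0}"
        have "S \<le> 170 * gap v + 2600 * LK"
          using round_time_sum[OF v, of y] by (simp add: LK_def S_def)
        moreover have "length L0 \<le> LK" using K_pos by (simp add: LK_def)
        moreover have "t3 \<le> (K + 2) * 200" "t4 \<le> S + (length L0 + 1) * 30"
          using 1(1) \<open>t3 \<le> _ \<and> _\<close> unfolding S_def by blast+
        ultimately have "t4 \<le> 170 * gap v + 2630 * LK + 30" "t1 + 15 + t3 \<le> 675 * K"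
          using t1 K_pos unfolding distrib_right by linarith+
        then show ?thesis unfolding e using K_pos by linarith
      qed
      ultimately show ?case using 1(1) by blast
    qed
  qed
qed simp_all

lemma base_eq_iff: "i \<le> K \<Longrightarrow> j \<le> K \<Longrightarrow> base u + i = base v + j \<longleftrightarrow> u = v \<and> i = j"
proof
  assume "i \<le> K" "j \<le> K" "base u + i = base v + j"
  moreover have "(u * (K + 1) + i) div (K + 1) = u" "(v * (K + 1) + j) div (K + 1) = v"
    using \<open>i \<le> K\<close> \<open>j \<le> K\<close> by (simp_all only: div_mult_self3 div_less less_Suc_eq_le Suc_eq_plus1[symmetric])
  ultimately show "u = v \<and> i = j" unfolding base_def by (metis add_left_cancel)
qed auto

text \<open>With the loop overhead there are at most K + 2 rounds to count, bounded by 3 K. Each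
  costs 170 gaps and 3500 K per kept child, which gives 510 and 10500; the remaining 1000 absorb
  clearing, storing and loop control.\<close>

definition "dp_time v = 510 * K * gap v + 11500 * K\<^sup>2 * (card (Ch v) + 1)"

lemma wp_dp:
  assumes v: "v < n" "heaviest (Ch v) L0" and env: "dpenv s v L0"
  shows "wp dp s (\<lambda>t s'. t \<le> dp_time v \<and> hext s s' \<and>
    rowrep (heap s') (nmem s' ''BP'') (rmem s' ''BV'') v \<and>
    (\<forall>u k. u \<noteq> v \<longrightarrow> k \<le> K \<longrightarrow> nmem s' ''BP'' (base u + k) = nmem s ''BP'' (base u + k) \<and>
      rmem s' ''BV'' (base u + k) = rmem s ''BV'' (base u + k)))"
  unfolding dp_def wp_Seq
proof (rule wp_conseq[OF wp_clear], goal_cases)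
  case (3 t1 s1)
  let ?m = "length L0"
  let ?D = "\<lambda>y. \<Union>y'\<in>{..<y}. kept_plans L0 y' ?m"
  have K: "nmem s ''K'' 0 = K" using env by (simp add: dpenv_def)
  have t1: "t1 \<le> (K + 2) * 20" using 3(1) K by simp
  have h1: "hext s s1" by (rule hext_frm[OF 3(2)]) auto
  have env1: "dpenv s1 v L0" by (rule dpenv_frm[OF env 3(2) h1]) auto
  let ?b = "170 * gap v + (?m + 1) * (3500 * K)"
  have loop: "wp (For ''y'' (NAdd (NGet ''ln'' (N ''v'')) (NConst 1)) dp_try) s1
    (\<lambda>t s'. t \<le> (?m + 1 + 1) * (?b + 5 + 9) \<and> nmem s' ''y'' 0 = ?m + 1 \<and>
      (hext s1 s' \<and> cands v (heap s') (nmem s' ''CP'') (rmem s' ''CV'') (?D (?m + 1))))"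
  proof (rule wp_conseq[OF wp_For_const[where m = "?m + 1" and b = ?b and
      I = "\<lambda>y s'. hext s1 s' \<and> cands v (heap s') (nmem s' ''CP'') (rmem s' ''CV'') (?D y)"]], goal_cases)
    case 2
    then show ?case using 3(1) K by (simp add: hext_def optrep_empty)
  next
    case (3 i s')
    then show ?case using env1 by (simp add: frm dpenv_def)
  next
    case (4 y s')
    then have h: "hext s1 s'" and C: "cands v (heap s') (nmem s' ''CP'') (rmem s' ''CV'') (?D y)" by auto
    have env': "dpenv s' v L0" by (rule dpenv_frm[OF env1 4(3) h]) auto
    show ?case
    proof (rule wp_conseq[OF wp_dp_try[OF v env' 4(2) C]], goal_cases)
      case (1 t s'')
      have "hext s1 s''" using 1(1) hext_trans[OF h] by blast
      moreover have "?D (Suc y) = ?D y \<union> kept_plans L0 y ?m" by (auto simp: less_Suc_eq)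
      ultimately show ?case using 1(1) by (simp add: hext_def)
    qed
  qed auto
  show ?case
  proof (rule wp_conseq[OF loop], goal_cases)
    case (1 t2 s2)
    then have P: "t2 \<le> (?m + 1 + 1) * (?b + 5 + 9)" "hext s1 s2"
      "cands v (heap s2) (nmem s2 ''CP'') (rmem s2 ''CV'') (?D (?m + 1))" by blast+
    have env2: "dpenv s2 v L0" by (rule dpenv_frm[OF env1 1(2) P(2)]) auto
    define cp where "cp = (nmem s2 ''CP'')(1 := 1)"
    define cv where "cv = (rmem s2 ''CV'')(1 := eta W (sw v))"
    define s3 where "s3 = rupd ''CV'' 1 (eta W (sw v)) (nupd ''CP'' 1 1 s2)"
    have blk: "wp (NSet ''CP'' (NConst 1) (NConst 1)) s2 (\<lambda>t3 s. wp (RSet ''CV'' (NConst 1)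
        (etaE (RGet ''tw'' (N ''v'')))) s (\<lambda>t4 s. Q t3 t4 s)) = Q 3 18 s3" for Q
      using env2 by (simp add: wp_simps s3_def dpenv_def numeral_eq_Suc)
    have store: "wp dp_store s3 (\<lambda>t s'. t \<le> (K + 2) * 40 \<and>
      (\<forall>k\<le>K. nmem s' ''BP'' (base v + k) = cp k \<and> rmem s' ''BV'' (base v + k) = cv k) \<and>
      (\<forall>u k. u \<noteq> v \<longrightarrow> k \<le> K \<longrightarrow> nmem s' ''BP'' (base u + k) = nmem s2 ''BP'' (base u + k) \<and>
        rmem s' ''BV'' (base u + k) = rmem s2 ''BV'' (base u + k)))"
      unfolding dp_store_def
    proof (rule wp_conseq[OF wp_For_const[where m = "K + 1" and b = 20 and
        I = "\<lambda>i s'. (\<forall>k<i. nmem s' ''BP'' (base v + k) = cp k \<and> rmem s' ''BV'' (base v + k) = cv k) \<and>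
          (\<forall>u k. u \<noteq> v \<longrightarrow> k \<le> K \<longrightarrow> nmem s' ''BP'' (base u + k) = nmem s2 ''BP'' (base u + k) \<and>
            rmem s' ''BV'' (base u + k) = rmem s2 ''BV'' (base u + k))"]], goal_cases)
      case 2
      then show ?case by (simp add: s3_def)
    next
      case (3 i s')
      then show ?case using env2 by (simp add: frm s3_def dpenv_def)
    next
      case (4 i s')
      have e: "nmem s' ''bs'' v = base v" "nmem s' ''v'' 0 = v" "nmem s' ''CP'' = cp" "rmem s' ''CV'' = cv"
        using frm[OF 4(3)] env2 by (simp_all add: s3_def dpenv_def cp_def cv_def)
      have ne: "base u + k \<noteq> base v + i" if "u \<noteq> v" "k \<le> K" for u k
        using base_eq_iff[OF that(2), of i u v] 4(1) that(1) by simp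
      show ?case using 4(2,4) e by (simp add: wp_simps less_Suc_eq ne)
    next
      case (5 t s')
      then show ?case by (simp add: less_Suc_eq_le)
    qed auto
    show ?case
      unfolding blk
    proof (rule wp_conseq[OF store], goal_cases)
      case (1 t5 s5)
      have h3: "hext s2 s3" by (simp add: s3_def hext_def)
      have h5: "hext s3 s5" by (rule hext_frm[OF 1(2)]) auto
      have h25: "hext s2 s5" using hext_trans[OF h3 h5] .
      have hs: "hext s s5" using hext_trans[OF h1 hext_trans[OF P(2) h25]] .
      define DD where "DD = ?D (?m + 1)"
      have P3: "cands v (heap s2) (nmem s2 ''CP'') (rmem s2 ''CV'') DD" using P(3) by (simp only: DD_def)
      have val: "valid v L" if LD: "L \<in> DD" for L
      proof -
        obtain y j where "j \<le> ?m" "L \<in> plans_over (kept L0 y j)"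
          using LD by (auto simp: DD_def kept_plans_def)
        then show ?thesis using valid_kept[OF v(2)] by blast
      qed
      \<comment> \<open>Completeness of the search: by the exchange argument, the plans of all
        rounds include one at least as good as any given summary tree of the same size.\<close>
      have full: "\<exists>L\<in>DD. psize v L = k \<and> x \<le> pval v L" if k: "achv v k x" "k \<noteq> 1" "k \<le> K" for k x
      proof -
        from plan_complete[OF v(1,2) k] obtain y j L where L: "y \<le> ?m" "j \<le> ?m"
          "L \<in> plans_over (kept L0 y j)" "psize v L = k" "x \<le> pval v L" .
        then have "L \<in> kept_plans L0 y ?m" by (auto simp: kept_plans_def)
        then have "L \<in> DD" using L(1) by (auto simp: DD_def less_Suc_eq_le)
        then show ?thesis using L by blast
      qed
      have row: "rowrep (heap s5) (nmem s5 ''BP'') (rmem s5 ''BV'') v"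
        unfolding rowrep_def
      proof (intro allI impI)
        fix k assume kK: "k \<le> K"
        have bp: "nmem s5 ''BP'' (base v + k) = cp k" "rmem s5 ''BV'' (base v + k) = cv k" using 1(1) kK by auto
        show "(nmem s5 ''BP'' (base v + k) = 0 \<longrightarrow> \<not> feas v k) \<and> (nmem s5 ''BP'' (base v + k) \<noteq> 0 \<longrightarrow>
          feas v k \<and> rmem s5 ''BV'' (base v + k) = best v k \<and> (2 \<le> k \<longrightarrow>
          (\<exists>L. heap s5 (nmem s5 ''BP'' (base v + k)) L \<and> valid v L \<and> psize v L = k \<and> pval v L = best v k)))"
        proof (cases "k = 1")
          case True
          then show ?thesis unfolding bp using feas_1[of v] best_1[OF v(1)] by (simp add: cp_def cv_def)
        next
          case False
          then have c: "cp k = nmem s2 ''CP'' k" "cv k = rmem s2 ''CV'' k" by (simp_all add: cp_def cv_def)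
          show ?thesis
          proof (cases "nmem s2 ''CP'' k = 0")
            case True
            then have "psize v L \<noteq> k" if "L \<in> DD" for L using P3 kK that unfolding optrep_def by blast
            then have "\<not> feas v k" using full[OF achv_best[OF v(1)] False kK] by blast
            then show ?thesis unfolding bp c using True by simp
          next
            case ne: False
            with P3 kK obtain L where L: "L \<in> DD" "psize v L = k" "heap s2 (nmem s2 ''CP'' k) L"
              "rmem s2 ''CV'' k = pval v L" "\<And>L'. L' \<in> DD \<Longrightarrow> psize v L' = k \<Longrightarrow> pval v L' \<le> pval v L"
              unfolding optrep_def by blast
            have a: "achv v k (pval v L)" using achv_plan[OF v(1) val[OF L(1)]] L(2) by simp
            have "y \<le> pval v L" if "achv v k y" for y
            proof -
              from full[OF that False kK] obtain L' where "L' \<in> DD" "psize v L' = k" "y \<le> pval v L'"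
                by blast
              with L(5)[of L'] show ?thesis by linarith
            qed
            then have "best v k = pval v L" using best_eqI[OF v(1) a] by blast
            moreover have "feas v k" using a by (auto simp: feas_def)
            ultimately show ?thesis
              unfolding bp c
              using ne L(2,4) val[OF L(1)] linked_hext[OF h25 L(3)] by (intro conjI impI exI[of _ L]) simp_all
          qed
        qed
      qed
      have other: "nmem s2 ''BP'' = nmem s ''BP''" "rmem s2 ''BV'' = rmem s ''BV''"
        using frm[OF \<open>frm _ _ s1 s2\<close>] frm[OF 3(2)] by simp_all
      have m: "?m \<le> K" "?m \<le> card (Ch v)" using v(2) by (simp_all add: heaviest_def)
      have "t1 + (t2 + (3 + (18 + t5))) \<le> dp_time v"
      proof -
        have "t2 \<le> (3 * K) * (170 * gap v + (card (Ch v) + 1) * (3500 * K) + 14 * K)"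
        proof -
          have "(?m + 1) * (3500 * K) \<le> (card (Ch v) + 1) * (3500 * K)"
            using m(2) by (intro mult_le_mono) simp_all
          then have "?b + 5 + 9 \<le> 170 * gap v + (card (Ch v) + 1) * (3500 * K) + 14 * K"
            using K_pos by linarith
          moreover have "?m + 1 + 1 \<le> 3 * K" using m(1) K_pos by linarith
          ultimately show ?thesis using P(1) mult_le_mono order.trans by blast
        qed
        also have "\<dots> = 510 * K * gap v + 10500 * K\<^sup>2 * (card (Ch v) + 1) + 42 * K\<^sup>2"
          by (simp add: algebra_simps power2_eq_square)
        finally have t2: "t2 \<le> \<dots>" .
        have t5: "t5 \<le> (K + 2) * 40" using 1(1) by blast
        have "K \<le> K\<^sup>2" "1 \<le> K\<^sup>2" using K_pos by (auto simp: power2_eq_square)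
        moreover have "K\<^sup>2 \<le> K\<^sup>2 * (card (Ch v) + 1)" by simp
        ultimately have "t1 + 21 + t5 + 42 * K\<^sup>2 \<le> 1000 * (K\<^sup>2 * (card (Ch v) + 1))"
          using t1 t5 unfolding distrib_left distrib_right by linarith
        then show ?thesis using t2 unfolding dp_time_def by linarith
      qed
      then show ?case using hs row 1(1) unfolding other by blast
    qed
  qed
qed simp_all

end

section \<open>Passing a node to its parent\<close>

text \<open>Behind the place of insertion the recursion carries the displaced element on instead of
  copying the tail. It thus mirrors the array loop of the program, which carries it in
  \<open>z\<close>.\<close>

fun ins :: "('a \<Rightarrow> real) \<Rightarrow> 'a \<Rightarrow> 'a list \<Rightarrow> 'a list" where
  "ins f c [] = [c]"
| "ins f c (d # L) = (if f d < f c then c # ins f d L else d # ins f c L)"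

lemma set_ins [simp]: "set (ins f c L) = insert c (set L)"
  by (induction L arbitrary: c) auto

lemma length_ins [simp]: "length (ins f c L) = Suc (length L)"
  by (induction L arbitrary: c) auto

lemma distinct_ins: "distinct L \<Longrightarrow> c \<notin> set L \<Longrightarrow> distinct (ins f c L)"
  by (rule card_distinct) (simp add: distinct_card)

lemma sorted_ins: "sorted_wrt (\<lambda>c d. f d \<le> f c) L \<Longrightarrow> sorted_wrt (\<lambda>c d. f d \<le> f c) (ins f c L)"
  by (induction L arbitrary: c) force+

definition "eqb a b = And (Not (NLess a b)) (Not (NLess b a))"

lemma bval_eqb [simp]: "bval (eqb a b) s \<longleftrightarrow> nval a s = nval b s"
  and bcost_eqb [simp]: "bcost (eqb a b) = 2 * ncost a + 2 * ncost b + 5"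
  by (auto simp: eqb_def)

definition "push_cell =
  NLet ''t'' (NGet ''top'' (NAdd (NGet ''bs'' (N ''x'')) (N ''j''))) ;;
  If (RLess (RGet ''tw'' (N ''t'')) (RGet ''tw'' (N ''z'')))
    (NSet ''top'' (NAdd (NGet ''bs'' (N ''x'')) (N ''j'')) (N ''z'') ;; NLet ''z'' (N ''t'')) Skip"

definition "push_start =
  NSet ''sz'' (N ''x'') (NAdd (NGet ''sz'' (N ''x'')) (NGet ''sz'' (N ''v''))) ;;
  RSet ''tw'' (N ''x'') (RAdd (RGet ''tw'' (N ''x'')) (RGet ''tw'' (N ''v''))) ;;
  NLet ''z'' (N ''v'')"

definition "push_end =
  If (NLess (NGet ''ln'' (N ''x'')) (N ''K''))
    (NSet ''top'' (NAdd (NGet ''bs'' (N ''x'')) (NGet ''ln'' (N ''x''))) (N ''z'') ;;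
     NSet ''ln'' (N ''x'') (NAdd (NGet ''ln'' (N ''x'')) (NConst 1))) Skip"

definition "push_parent = push_start ;; For ''j'' (NGet ''ln'' (N ''x'')) push_cell ;; push_end"

definition "push = NLet ''x'' (NGet ''parent'' (N ''v'')) ;; If (eqb (N ''x'') (N ''v'')) Skip push_parent"

lemma nw_push_cell [simp]: "nw push_cell = {''t'', ''top'', ''z''}" and rw_push_cell [simp]: "rw push_cell = {}"
  by (auto simp: push_cell_def)

lemma nw_push_parent [simp]: "nw push_parent = {''sz'', ''z'', ''j'', ''t'', ''top'', ''ln''}"
  and rw_push_parent [simp]: "rw push_parent = {''tw''}"
  by (auto simp: push_parent_def push_start_def push_end_def)

lemma nw_push [simp]: "nw push = insert ''x'' (nw push_parent)" and rw_push [simp]: "rw push = {''tw''}"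
  by (auto simp: push_def)

context weighted_tree
begin

lemma heaviest_ins:
  assumes "heaviest C L" "finite C" "c \<notin> C"
  shows "heaviest (insert c C) (take K (ins sw c L))"
proof -
  from assms(1) have L: "distinct L" "set L \<subseteq> C" "length L = min K (card C)"
    "sorted_wrt (\<lambda>c d. sw d \<le> sw c) L" "\<And>c d. c \<in> C - set L \<Longrightarrow> d \<in> set L \<Longrightarrow> sw c \<le> sw d"
    by (auto simp: heaviest_def)
  let ?I = "ins sw c L"
  have d: "distinct ?I" using distinct_ins[OF L(1)] L(2) assms(3) by auto
  have so: "sorted_wrt (\<lambda>c d. sw d \<le> sw c) (take K ?I @ drop K ?I)"
    using sorted_ins[OF L(4)] by simp
  have "sw x \<le> sw e" if x: "x \<in> insert c C - set (take K ?I)" and e: "e \<in> set (take K ?I)" for x e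
  proof (cases "x \<in> set ?I")
    case True
    then have "x \<in> set (drop K ?I)" using x by (metis Diff_iff UnE append_take_drop_id set_append)
    then show ?thesis using so e by (simp only: sorted_wrt_append)
  next
    case False
    then have xL: "x \<in> C - set L" using x by auto
    have "length L = K"
    proof (rule ccontr)
      assume "length L \<noteq> K"
      then have "card (set L) = card C" using L(3) distinct_card[OF L(1)] by simp
      then have "set L = C" using card_subset_eq[OF assms(2) L(2)] by blast
      then show False using xL by blast
    qed
    then have ne: "drop K ?I \<noteq> []" by simp
    \<comment> \<open>An \<open>x\<close> outside the old list implies that this list was full, so
      some element \<open>l\<close> is pushed out now. If \<open>e\<close> is the new child,
      \<open>l\<close> mediates: the old list makes it at least as heavy as \<open>x\<close>, and
      sortedness makes it at most as heavy as \<open>e\<close>.\<close>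
    define l where "l = hd (drop K ?I)"
    have l: "l \<in> set (drop K ?I)" using ne by (simp add: l_def)
    show ?thesis
    proof (cases "e \<in> set L")
      case True
      then show ?thesis using L(5)[OF xL] by blast
    next
      case False
      then have ec: "e = c" using e in_set_takeD[OF e] by auto
      have "l \<noteq> e"
        using d l e by (metis append_take_drop_id disjoint_iff distinct_append)
      then have "l \<in> set L" using in_set_dropD[OF l] ec by auto
      then have "sw x \<le> sw l" using L(5)[OF xL] by blast
      also have "sw l \<le> sw e" using so e l by (simp only: sorted_wrt_append)
      finally show ?thesis .
    qed
  qed
  moreover have "set (take K ?I) \<subseteq> insert c C" using set_take_subset[of K ?I] L(2) by auto
  moreover have "length (take K ?I) = min K (card (insert c C))" using L(3) assms(2,3) by auto
  ultimately show ?thesis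
    using d so unfolding heaviest_def sorted_wrt_append by simp
qed

lemma wp_push_parent:
  assumes K: "nmem s ''K'' 0 = K" and v: "nmem s ''v'' 0 = v" "rmem s ''tw'' v = sw v"
    and x: "nmem s ''x'' 0 = x" "x \<noteq> v" "nmem s ''bs'' x = base x"
    and L: "nmem s ''ln'' x = length L" "length L \<le> K" "\<And>i. i < length L \<Longrightarrow> nmem s ''top'' (base x + i) = L ! i"
      "\<And>c. c \<in> set L \<Longrightarrow> c \<noteq> x \<and> rmem s ''tw'' c = sw c"
  shows "wp push_parent s (\<lambda>t s'. t \<le> (K + 2) * 100 \<and>
    nmem s' ''sz'' = (nmem s ''sz'')(x := nmem s ''sz'' x + nmem s ''sz'' v) \<and>
    rmem s' ''tw'' = (rmem s ''tw'')(x := rmem s ''tw'' x + sw v) \<and>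
    nmem s' ''ln'' = (nmem s ''ln'')(x := length (take K (ins sw v L))) \<and>
    (\<forall>i<length (take K (ins sw v L)). nmem s' ''top'' (base x + i) = take K (ins sw v L) ! i) \<and>
    (\<forall>y i. y \<noteq> x \<longrightarrow> i \<le> K \<longrightarrow> nmem s' ''top'' (base y + i) = nmem s ''top'' (base y + i)))"
proof -
  define s1 where "s1 = nupd ''z'' 0 v (rupd ''tw'' x (rmem s ''tw'' x + sw v)
    (nupd ''sz'' x (nmem s ''sz'' x + nmem s ''sz'' v) s))"
  have st: "wp push_start s Q = Q 24 s1" for Q
    using v x by (simp add: push_start_def wp_simps s1_def numeral_eq_Suc)
  let ?a = "\<lambda>s' i. nmem s' ''top'' (base x + i)"
  have tw1: "rmem s1 ''tw'' c = sw c" if "c \<in> insert v (set L)" for c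
    using that v x L(4) by (auto simp: s1_def)
  \<comment> \<open>The invariant: the first j cells already agree with the final list, and the rest
    of it is the pending insertion of \<open>z\<close> into \<open>drop j L\<close>.\<close>
  have loop: "wp (For ''j'' (NGet ''ln'' (N ''x'')) push_cell) s1 (\<lambda>t s'. t \<le> (length L + 1) * (40 + 3 + 9) \<and>
    nmem s' ''j'' 0 = length L \<and>
    (map (?a s') [0..<length L] @ ins sw (nmem s' ''z'' 0) (drop (length L) L) = ins sw v L \<and>
     (\<forall>i. length L \<le> i \<longrightarrow> i < length L \<longrightarrow> ?a s' i = L ! i) \<and> nmem s' ''z'' 0 \<in> insert v (set L) \<and>
     (\<forall>y i. y \<noteq> x \<longrightarrow> i \<le> K \<longrightarrow> nmem s' ''top'' (base y + i) = nmem s ''top'' (base y + i))))"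
  proof (rule wp_conseq[OF wp_For_const[where m = "length L" and b = 40 and
      I = "\<lambda>j s'. map (?a s') [0..<j] @ ins sw (nmem s' ''z'' 0) (drop j L) = ins sw v L \<and>
     (\<forall>i. j \<le> i \<longrightarrow> i < length L \<longrightarrow> ?a s' i = L ! i) \<and> nmem s' ''z'' 0 \<in> insert v (set L) \<and>
     (\<forall>y i. y \<noteq> x \<longrightarrow> i \<le> K \<longrightarrow> nmem s' ''top'' (base y + i) = nmem s ''top'' (base y + i))"]], goal_cases)
    case 2
    then show ?case using L by (simp add: s1_def)
  next
    case (3 i s')
    then show ?case using L x by (simp add: frm s1_def)
  next
    case (4 j s')
    have e: "nmem s' ''bs'' x = base x" "nmem s' ''x'' 0 = x" "rmem s' ''tw'' = rmem s1 ''tw''"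
      using frm[OF 4(3)] x by (simp_all add: s1_def)
    let ?z = "nmem s' ''z'' 0"
    have I: "map (?a s') [0..<j] @ ins sw ?z (drop j L) = ins sw v L" "\<And>i. j \<le> i \<Longrightarrow> i < length L \<Longrightarrow> ?a s' i = L ! i"
      "?z \<in> insert v (set L)"
      "\<And>y i. y \<noteq> x \<Longrightarrow> i \<le> K \<Longrightarrow> nmem s' ''top'' (base y + i) = nmem s ''top'' (base y + i)"
      using 4(4) by blast+
    have dr: "drop j L = L ! j # drop (Suc j) L" using 4(1) by (simp add: Cons_nth_drop_Suc)
    have aj: "?a s' j = L ! j" using I(2) 4(1) by simp
    have tz: "rmem s1 ''tw'' ?z = sw ?z" "rmem s1 ''tw'' (L ! j) = sw (L ! j)" using tw1 I(3) 4(1) by simp_all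
    have ne: "base y + i \<noteq> base x + j" if "y \<noteq> x" "i \<le> K" for y i
      using base_eq_iff[OF that(2), of j y x] 4(1) L(2) that(1) by simp
    show ?case
    proof (cases "sw (L ! j) < sw ?z")
      case True
      have m: "map (\<lambda>i. if i = j then ?z else ?a s' i) [0..<j] = map (?a s') [0..<j]"
        by (intro map_cong) auto
      have "map (?a s') [0..<j] @ ?z # ins sw (L ! j) (drop (Suc j) L) = ins sw v L"
        using I(1) True unfolding dr by simp
      then show ?thesis
        using True I(2,4) 4(1,2) e aj tz ne unfolding push_cell_def
        by (simp add: wp_simps m fun_upd_def)
    next
      case False
      have "map (?a s') [0..<j] @ L ! j # ins sw ?z (drop (Suc j) L) = ins sw v L"
        using I(1) False unfolding dr by simp
      then show ?thesis
        using False I(2-4) 4(1,2) e aj tz unfolding push_cell_def by (simp add: wp_simps)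
    qed
  qed auto
  show ?thesis
    unfolding push_parent_def wp_Seq st
  proof (rule wp_conseq[OF loop], goal_cases)
    case (1 t s2)
    then have I: "map (?a s2) [0..<length L] @ [nmem s2 ''z'' 0] = ins sw v L"
      "\<And>y i. y \<noteq> x \<Longrightarrow> i \<le> K \<Longrightarrow> nmem s2 ''top'' (base y + i) = nmem s ''top'' (base y + i)"
      by simp_all
    have t: "t \<le> (length L + 1) * 52" using 1(1) by simp
    note fr = frm[OF 1(2)]
    have e: "nmem s2 ''bs'' x = base x" "nmem s2 ''x'' 0 = x" "nmem s2 ''K'' 0 = K"
      "nmem s2 ''ln'' = nmem s ''ln''" "rmem s2 ''tw'' = (rmem s ''tw'')(x := rmem s ''tw'' x + sw v)"
      "nmem s2 ''sz'' = (nmem s ''sz'')(x := nmem s ''sz'' x + nmem s ''sz'' v)"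
      using x K by (simp_all add: fr s1_def)
    have nth: "ins sw v L ! i = (if i < length L then ?a s2 i else nmem s2 ''z'' 0)" if "i < Suc (length L)" for i
      unfolding I(1)[symmetric] using that by (simp add: nth_append)
    show ?case
    proof (cases "length L < K")
      case True
      have ne: "base y + i \<noteq> base x + length L" if "y \<noteq> x" "i \<le> K" for y i
        using base_eq_iff[OF that(2), of "length L" y x] True that(1) by simp
      show ?thesis
        using True e L t I(2) ne nth by (simp add: push_end_def wp_simps less_Suc_eq)
    next
      case False
      \<comment> \<open>A full list keeps its length: the element carried past its end is dropped,
        as by \<open>take K\<close>.\<close>
      then have "length L = K" using L(2) by simp
      then show ?thesis
        using e L t I(2) nth by (simp add: push_end_def wp_simps fun_upd_idem)
    qed
  qed
qed

end

definition "bu_body = NLet ''v'' (NGet ''q'' (N ''i'')) ;; dp ;; push"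

definition "bottom_up = For ''i'' (N ''n'') bu_body"

section \<open>Initialisation and processing order\<close>

text \<open>The language has no multiplication of naturals, so the row offsets
  \<open>v * (K + 1)\<close> are accumulated in \<open>acc\<close> and kept in
  \<open>bs\<close>.\<close>

definition "init_cell =
  NSet ''sz'' (N ''v'') (NConst 1) ;; NSet ''d'' (N ''v'') (NConst 0) ;; NSet ''ln'' (N ''v'') (NConst 0) ;;
  NSet ''bs'' (N ''v'') (N ''acc'') ;; NLet ''acc'' (NAdd (N ''acc'') K1) ;;
  RSet ''tw'' (N ''v'') (RGet ''weight'' (N ''v'')) ;; RLet ''W'' (RAdd (R ''W'') (RGet ''weight'' (N ''v''))) ;;
  If (eqb (NGet ''parent'' (N ''v'')) (N ''v'')) (NLet ''r'' (N ''v'')) Skip"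

definition "init = RLet ''W'' (RConst 0) ;; NLet ''acc'' (NConst 0) ;; NLet ''hp'' (NConst 2) ;;
  For ''v'' (N ''n'') init_cell"

definition "degree_cell = If (eqb (NGet ''parent'' (N ''v'')) (N ''v'')) Skip
  (NSet ''d'' (NGet ''parent'' (N ''v'')) (NAdd (NGet ''d'' (NGet ''parent'' (N ''v''))) (NConst 1)))"

definition "degrees = For ''v'' (N ''n'') degree_cell"

definition "leaf_cell = NSet ''cnt'' (N ''v'') (NGet ''d'' (N ''v'')) ;;
  If (NLess (NConst 0) (NGet ''d'' (N ''v''))) Skip
    (NSet ''q'' (N ''tl'') (N ''v'') ;; NLet ''tl'' (NAdd (N ''tl'') (NConst 1)))"

definition "leaves = NLet ''tl'' (NConst 0) ;; For ''v'' (N ''n'') leaf_cell"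

text \<open>Leaves are peeled off with a queue: a node enters \<open>q\<close> when the last of its
  children has been treated. Children thus precede their parents without recursion and in constant
  time per node.\<close>

definition "order_cell = NLet ''u'' (NGet ''q'' (N ''i'')) ;; NLet ''x'' (NGet ''parent'' (N ''u'')) ;;
  If (eqb (N ''x'') (N ''u'')) Skip
    (NSet ''cnt'' (N ''x'') (NSub (NGet ''cnt'' (N ''x'')) (NConst 1)) ;;
     If (NLess (NConst 0) (NGet ''cnt'' (N ''x''))) Skip
       (NSet ''q'' (N ''tl'') (N ''x'') ;; NLet ''tl'' (NAdd (N ''tl'') (NConst 1))))"

definition "order = For ''i'' (N ''n'') order_cell"

lemma nw_init_cell [simp]: "nw init_cell = {''sz'', ''d'', ''ln'', ''bs'', ''acc'', ''r''}"
  and rw_init_cell [simp]: "rw init_cell = {''tw'', ''W''}"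
  by (auto simp: init_cell_def)

lemma nw_init [simp]: "nw init = {''sz'', ''d'', ''ln'', ''bs'', ''acc'', ''r'', ''hp'', ''v''}"
  and rw_init [simp]: "rw init = {''tw'', ''W''}"
  by (auto simp: init_def)

lemma nw_degree_cell [simp]: "nw degree_cell = {''d''}" and rw_degree_cell [simp]: "rw degree_cell = {}"
  and nw_degrees [simp]: "nw degrees = {''d'', ''v''}" and rw_degrees [simp]: "rw degrees = {}"
  by (auto simp: degree_cell_def degrees_def)

lemma nw_leaf_cell [simp]: "nw leaf_cell = {''cnt'', ''q'', ''tl''}" and rw_leaf_cell [simp]: "rw leaf_cell = {}"
  and nw_leaves [simp]: "nw leaves = {''cnt'', ''q'', ''tl'', ''v''}" and rw_leaves [simp]: "rw leaves = {}"
  by (auto simp: leaf_cell_def leaves_def)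

lemma nw_order_cell [simp]: "nw order_cell = {''u'', ''x'', ''cnt'', ''q'', ''tl''}"
  and rw_order_cell [simp]: "rw order_cell = {}"
  and nw_order [simp]: "nw order = {''u'', ''x'', ''cnt'', ''q'', ''tl'', ''i''}" and rw_order [simp]: "rw order = {}"
  by (auto simp: order_cell_def order_def)

lemma nw_bu_body [simp]: "nw bu_body = insert ''v'' (nw dp \<union> nw push)"
  and rw_bu_body [simp]: "rw bu_body = rw dp \<union> rw push"
  by (auto simp: bu_body_def)

section \<open>Invariant of the bottom-up pass\<close>

context weighted_tree
begin

definition "env s \<longleftrightarrow> nmem s ''n'' 0 = n \<and> nmem s ''K'' 0 = K \<and> rmem s ''W'' 0 = W \<and>
  (\<forall>v<n. nmem s ''parent'' v = p v \<and> rmem s ''weight'' v = w v \<and> nmem s ''bs'' v = base v \<and>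
     nmem s ''d'' v = card (Ch v))"

lemma env_frm:
  assumes "env s" "frm A B s s'" "{''n'', ''K'', ''parent'', ''bs'', ''d''} \<inter> A = {}" "{''W'', ''weight''} \<inter> B = {}"
  shows "env s'"
proof -
  have e: "nmem s' ''n'' = nmem s ''n''" "nmem s' ''K'' = nmem s ''K''" "nmem s' ''parent'' = nmem s ''parent''"
    "nmem s' ''bs'' = nmem s ''bs''" "nmem s' ''d'' = nmem s ''d''" "rmem s' ''W'' = rmem s ''W''"
    "rmem s' ''weight'' = rmem s ''weight''"
    using assms(3,4) by (auto intro!: frm_n[OF assms(2)] frm_r[OF assms(2)])
  show ?thesis using assms(1) unfolding env_def e .
qed

text \<open>\<open>Z\<close> is the set of nodes already treated. Sizes, weights and lists of
  heaviest children account only for the children in \<open>Z\<close>; they become final once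
  \<open>Ch v \<subseteq> Z\<close>, exactly when v may be treated.\<close>

definition "bust s Z \<longleftrightarrow> (\<forall>v<n. nmem s ''sz'' v = 1 + (\<Sum>c\<in>Ch v \<inter> Z. sz c) \<and>
    rmem s ''tw'' v = w v + (\<Sum>c\<in>Ch v \<inter> Z. sw c) \<and>
    (\<exists>L. heaviest (Ch v \<inter> Z) L \<and> nmem s ''ln'' v = length L \<and>
       (\<forall>i<length L. nmem s ''top'' (base v + i) = L ! i))) \<and>
  (\<forall>v\<in>Z. rowrep (heap s) (nmem s ''BP'') (rmem s ''BV'') v) \<and> 2 \<le> nmem s ''hp'' 0"

lemma bust_done:
  assumes "bust s Z" "v < n" "Ch v \<subseteq> Z"
  shows "nmem s ''sz'' v = sz v" "rmem s ''tw'' v = sw v"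
proof -
  have "Ch v \<inter> Z = Ch v" using assms(3) by blast
  then show "nmem s ''sz'' v = sz v" "rmem s ''tw'' v = sw v"
    using assms(1,2) sz_eq[OF assms(2)] sw_eq[OF assms(2)] by (simp_all add: bust_def)
qed

lemma wp_push:
  assumes env: "env s" and st: "bust s Z" and v: "nmem s ''v'' 0 = v" "v < n" "v \<notin> Z" "Ch v \<subseteq> Z"
    and Z: "\<And>c. c \<in> Z \<Longrightarrow> c < n \<and> Ch c \<subseteq> Z"
    and row: "rowrep (heap s) (nmem s ''BP'') (rmem s ''BV'') v"
  shows "wp push s (\<lambda>t s'. t \<le> (K + 2) * 100 + 20 \<and> env s' \<and> bust s' (insert v Z))"
proof (cases "v = rt")
  case True
  have C: "Ch u \<inter> insert v Z = Ch u \<inter> Z" if "u < n" for u using rt_notin_Ch[OF that] True by auto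
  define s1 where "s1 = nupd ''x'' 0 v s"
  have "bust s1 (insert v Z)" using st row C by (simp add: bust_def s1_def)
  moreover have "env s1" using env by (simp add: env_def s1_def)
  moreover have "wp push s Q = Q 19 s1" for Q
    using v env True p_rt by (simp add: push_def wp_simps s1_def env_def numeral_eq_Suc)
  ultimately show ?thesis by simp
next
  case False
  let ?x = "p v"
  have x: "?x < n" "?x \<noteq> v" "v \<in> Ch ?x" using p_less[OF v(2)] p_eq_iff[OF v(2)] in_Ch_p[OF v(2)] False by auto
  define s1 where "s1 = nupd ''x'' 0 ?x s"
  from st x(1) obtain L where L: "heaviest (Ch ?x \<inter> Z) L" "nmem s ''ln'' ?x = length L"
    "\<And>i. i < length L \<Longrightarrow> nmem s ''top'' (base ?x + i) = L ! i"
    unfolding bust_def by blast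
  have Ltw: "c \<noteq> ?x \<and> rmem s ''tw'' c = sw c" if "c \<in> set L" for c
  proof -
    have c: "c \<in> Ch ?x" "c \<in> Z" using L(1) that by (auto simp: heaviest_def)
    then show ?thesis using sz_Ch[OF x(1) c(1)] bust_done(2)[OF st] Z by auto
  qed
  have tw: "rmem s ''tw'' v = sw v" and szv: "nmem s ''sz'' v = sz v" using bust_done[OF st v(2,4)] by auto
  let ?L = "take K (ins sw v L)"
  have hL: "heaviest (insert v (Ch ?x \<inter> Z)) ?L" by (rule heaviest_ins[OF L(1)]) (use v in auto)
  have Cx: "Ch ?x \<inter> insert v Z = insert v (Ch ?x \<inter> Z)" using x(3) by auto
  have Cu: "Ch u \<inter> insert v Z = Ch u \<inter> Z" if "u < n" "u \<noteq> ?x" for u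
    using Ch_disjoint[OF that(1) x(1) that(2)] x(3) by auto
  have pp: "wp push_parent s1 (\<lambda>t s'. t \<le> (K + 2) * 100 \<and>
    nmem s' ''sz'' = (nmem s1 ''sz'')(?x := nmem s1 ''sz'' ?x + nmem s1 ''sz'' v) \<and>
    rmem s' ''tw'' = (rmem s1 ''tw'')(?x := rmem s1 ''tw'' ?x + sw v) \<and>
    nmem s' ''ln'' = (nmem s1 ''ln'')(?x := length ?L) \<and>
    (\<forall>i<length ?L. nmem s' ''top'' (base ?x + i) = ?L ! i) \<and>
    (\<forall>y i. y \<noteq> ?x \<longrightarrow> i \<le> K \<longrightarrow> nmem s' ''top'' (base y + i) = nmem s1 ''top'' (base y + i)))"
    by (rule wp_push_parent)
      (use env v tw x L Ltw in \<open>simp_all add: s1_def env_def heaviest_def\<close>)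
  have step: "wp push s Q = wp push_parent s1 (\<lambda>t. Q (5 + (13 + t)))" for Q
    using v x env by (simp add: push_def wp_Seq wp_NSet wp_If s1_def env_def numeral_eq_Suc)
  show ?thesis
    unfolding step
  proof (rule wp_conseq[OF pp], goal_cases)
    case (1 t s')
    then have P: "t \<le> (K + 2) * 100"
      "nmem s' ''sz'' = (nmem s ''sz'')(?x := nmem s ''sz'' ?x + sz v)"
      "rmem s' ''tw'' = (rmem s ''tw'')(?x := rmem s ''tw'' ?x + sw v)"
      "nmem s' ''ln'' = (nmem s ''ln'')(?x := length ?L)"
      "\<And>i. i < length ?L \<Longrightarrow> nmem s' ''top'' (base ?x + i) = ?L ! i"
      "\<And>y i. y \<noteq> ?x \<Longrightarrow> i \<le> K \<Longrightarrow> nmem s' ''top'' (base y + i) = nmem s ''top'' (base y + i)"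
      using szv by (simp_all add: s1_def)
    have "frm {''x''} {} s s1" by (simp add: frm_def s1_def)
    from frm_trans[OF this 1(2), of "insert ''x'' (nw push_parent)" "rw push_parent"]
    have f: "frm (insert ''x'' (nw push_parent)) (rw push_parent) s s'" by auto
    have env': "env s'" by (rule env_frm[OF env f]) auto
    have hp: "nmem s' ''hp'' = nmem s ''hp''" "nmem s' ''CH'' = nmem s ''CH''"
      "nmem s' ''CK'' = nmem s ''CK''" "nmem s' ''CN'' = nmem s ''CN''" "nmem s' ''BP'' = nmem s ''BP''"
      "rmem s' ''BV'' = rmem s ''BV''"
      using frm[OF f] by simp_all
    have "bust s' (insert v Z)"
      unfolding bust_def
    proof (intro conjI allI impI ballI)
      fix u assume u: "u < n"
      show "nmem s' ''sz'' u = 1 + (\<Sum>c\<in>Ch u \<inter> insert v Z. sz c)"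
      proof (cases "u = ?x")
        case True
        then show ?thesis unfolding P(2) using st u v(3) by (simp add: Cx bust_def)
      qed (use st u Cu P(2) in \<open>simp add: bust_def\<close>)
      show "rmem s' ''tw'' u = w u + (\<Sum>c\<in>Ch u \<inter> insert v Z. sw c)"
      proof (cases "u = ?x")
        case True
        then show ?thesis unfolding P(3) using st u v(3) by (simp add: Cx bust_def)
      qed (use st u Cu P(3) in \<open>simp add: bust_def\<close>)
      show "\<exists>L. heaviest (Ch u \<inter> insert v Z) L \<and> nmem s' ''ln'' u = length L \<and>
        (\<forall>i<length L. nmem s' ''top'' (base u + i) = L ! i)"
      proof (cases "u = ?x")
        case True
        show ?thesis unfolding True Cx using hL P(4,5) by (intro exI[of _ ?L]) auto
      next
        case False
        from st u obtain L' where L': "heaviest (Ch u \<inter> Z) L'" "nmem s ''ln'' u = length L'"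
          "\<forall>i<length L'. nmem s ''top'' (base u + i) = L' ! i"
          unfolding bust_def by blast
        then have "length L' \<le> K" by (simp add: heaviest_def)
        then show ?thesis unfolding Cu[OF u False]
          using L' P(4) P(6)[OF False] False by (intro exI[of _ L']) auto
      qed
    next
      fix u assume "u \<in> insert v Z"
      then show "rowrep (heap s') (nmem s' ''BP'') (rmem s' ''BV'') u"
        unfolding hp using st row by (auto simp: bust_def)
    next
      show "2 \<le> nmem s' ''hp'' 0" unfolding hp using st by (simp add: bust_def)
    qed
    then show ?case using env' P(1) by simp
  qed
qed

lemma wp_bu_step:
  assumes env: "env s" and st: "bust s Z" and v: "nmem s ''v'' 0 = v" "v < n" "v \<notin> Z" "Ch v \<subseteq> Z"
    and Z: "\<And>c. c \<in> Z \<Longrightarrow> c < n \<and> Ch c \<subseteq> Z"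
  shows "wp (dp ;; push) s (\<lambda>t s'. t \<le> dp_time v + ((K + 2) * 100 + 20) \<and> env s' \<and> bust s' (insert v Z))"
proof -
  have CZ: "Ch v \<inter> Z = Ch v" using v(4) by blast
  from st v(2) obtain L where L': "heaviest (Ch v \<inter> Z) L" "nmem s ''ln'' v = length L"
    "\<forall>i<length L. nmem s ''top'' (base v + i) = L ! i"
    unfolding bust_def by blast
  note L = L'[unfolded CZ]
  have c: "c < n \<and> c \<in> Z \<and> Ch c \<subseteq> Z" if "c \<in> set L" for c
    using that L(1) v(4) Z by (auto simp: heaviest_def)
  have rows: "rowrep (heap s) (nmem s ''BP'') (rmem s ''BV'') u" if "u \<in> Z" for u
    using st that by (simp add: bust_def)
  have denv: "dpenv s v L"
    unfolding dpenv_def using env v L c st bust_done[OF st] rows by (simp add: env_def bust_def)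
  show ?thesis
    unfolding wp_Seq
  proof (rule wp_conseq[OF wp_dp[OF v(2) L(1) denv]], goal_cases)
    case (1 t s1)
    then have P: "t \<le> dp_time v" "hext s s1" "rowrep (heap s1) (nmem s1 ''BP'') (rmem s1 ''BV'') v"
      "\<And>u k. u \<noteq> v \<Longrightarrow> k \<le> K \<Longrightarrow> nmem s1 ''BP'' (base u + k) = nmem s ''BP'' (base u + k) \<and>
        rmem s1 ''BV'' (base u + k) = rmem s ''BV'' (base u + k)" by blast+
    note f = frm[OF 1(2)]
    have env1: "env s1" by (rule env_frm[OF env 1(2)]) auto
    have rows1: "rowrep (heap s1) (nmem s1 ''BP'') (rmem s1 ''BV'') u" if "u \<in> Z" for u
    proof -
      have "u \<noteq> v" using that v(3) by blast
      have "rowrep (heap s1) (nmem s ''BP'') (rmem s ''BV'') u"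
        using linked_hext[OF P(2)] rows[OF that] by (rule rowrep_heap)
      then show ?thesis unfolding rowrep_def using P(4)[OF \<open>u \<noteq> v\<close>] by simp
    qed
    have "2 \<le> nmem s1 ''hp'' 0" using P(2) st by (simp add: hext_def bust_def)
    then have st1: "bust s1 Z" using st rows1 by (simp add: bust_def f)
    show ?case
    proof (rule wp_conseq[OF wp_push[OF env1 st1 _ v(2-4) Z P(3)]], goal_cases)
      case (3 t' s2)
      then show ?case using P(1) by simp
    qed (use v in \<open>simp_all add: f\<close>)
  qed
qed

definition "good_order q \<longleftrightarrow> bij_betw q {..<n} {..<n} \<and> (\<forall>i<n. Ch (q i) \<subseteq> q ` {..<i})"

lemma wp_bottom_up:
  assumes env: "env s" and st: "bust s {}" and q: "good_order (nmem s ''q'')"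
  shows "wp bottom_up s (\<lambda>t s'. t \<le> 30000 * K\<^sup>2 * n \<and> env s' \<and> bust s' {..<n})"
proof -
  let ?q = "nmem s ''q''"
  have bij: "bij_betw ?q {..<n} {..<n}" and pre: "\<And>i. i < n \<Longrightarrow> Ch (?q i) \<subseteq> ?q ` {..<i}"
    using q by (auto simp: good_order_def)
  have qn: "?q i < n" if "i < n" for i using bij_betwE[OF bij] that by auto
  have "wp bottom_up s (\<lambda>t s'. t \<le> (\<Sum>i<n. dp_time (?q i) + ((K + 2) * 100 + 30)) +
    n * (ncost (N ''n'') + 9) + ncost (N ''n'') + 9 \<and> nmem s' ''i'' 0 = n \<and> (env s' \<and> bust s' (?q ` {..<n})))"
    unfolding bottom_up_def
  proof (rule wp_For[where I = "\<lambda>i s'. env s' \<and> bust s' (?q ` {..<i})"], goal_cases)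
    case 2
    then show ?case using env st by (simp add: env_def bust_def)
  next
    case (3 i s')
    then show ?case by (simp add: env_def)
  next
    case (4 i s')
    have fq: "nmem s' ''q'' = ?q" using frm_n[OF 4(3), of "''q''"] by simp
    define s1 where "s1 = nupd ''v'' 0 (?q i) s'"
    have 1: "env s1" "bust s1 (?q ` {..<i})" using 4(4) by (simp_all add: s1_def env_def bust_def)
    have "?q i \<notin> ?q ` {..<i}" using bij_betw_imp_inj_on[OF bij] 4(1) by (auto dest: inj_onD)
    moreover have "c < n \<and> Ch c \<subseteq> ?q ` {..<i}" if c: "c \<in> ?q ` {..<i}" for c
    proof -
      obtain j where j: "j < i" "c = ?q j" using c by auto
      have "?q ` {..<j} \<subseteq> ?q ` {..<i}" using j by auto
      then show ?thesis using pre[of j] qn[of j] j 4(1) by auto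
    qed
    ultimately have "wp (dp ;; push) s1 (\<lambda>t s'. t \<le> dp_time (?q i) + ((K + 2) * 100 + 20) \<and> env s' \<and>
        bust s' (insert (?q i) (?q ` {..<i})))"
      by (intro wp_bu_step 1 qn pre 4(1)) (simp_all add: s1_def)
    then have "wp (dp ;; push) s1 (\<lambda>t s''. 5 + t \<le> dp_time (?q i) + ((K + 2) * 100 + 30) \<and>
        env (nupd ''i'' 0 (Suc i) s'') \<and> bust (nupd ''i'' 0 (Suc i) s'') (?q ` {..<Suc i}))"
      by (rule wp_conseq) (simp add: env_def bust_def lessThan_Suc)
    moreover have "wp (NLet ''v'' (NGet ''q'' (N ''i''))) s' Q = Q 5 s1" for Q
      using 4(2) fq by (simp add: wp_simps s1_def numeral_eq_Suc)
    ultimately show ?case unfolding bu_body_def wp_Seq[of "NLet _ _"] by simp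
  qed auto
  then show ?thesis
  proof (rule wp_conseq, goal_cases)
    case (1 t s')
    have "(\<Sum>i<n. dp_time (?q i) + ((K + 2) * 100 + 30)) = (\<Sum>v<n. dp_time v + ((K + 2) * 100 + 30))"
      using sum.reindex_bij_betw[OF bij, of "\<lambda>v. dp_time v + ((K + 2) * 100 + 30)"] .
    also have "\<dots> = 510 * K * (\<Sum>v<n. gap v) + 11500 * K\<^sup>2 * (\<Sum>v<n. card (Ch v) + 1) + n * ((K + 2) * 100 + 30)"
    proof -
      have "(\<Sum>v<n. dp_time v + ((K + 2) * 100 + 30)) = (\<Sum>v<n. 510 * K * gap v) +
          (\<Sum>v<n. 11500 * K\<^sup>2 * (card (Ch v) + 1)) + (\<Sum>v<n. (K + 2) * 100 + 30)"
        by (simp only: dp_time_def sum.distrib)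
      then show ?thesis by (simp only: sum_distrib_left[symmetric] sum_constant card_lessThan) simp
    qed
    \<comment> \<open>The gaps add up to at most \<open>2 * K * n\<close> and the degrees plus one
      to at most \<open>2 * n\<close>; hence the leading constant 1020 + 23000 = 24020.\<close>
    also have "\<dots> \<le> 510 * K * (2 * K * n) + 11500 * K\<^sup>2 * (2 * n) + n * ((K + 2) * 100 + 30)"
      by (intro add_mono mult_le_mono order.refl sum_gap sum_card_Ch)
    finally have t: "t \<le> 24020 * (K\<^sup>2 * n) + (100 * (K * n) + 241 * n) + 11"
      using 1(1) by (simp add: algebra_simps power2_eq_square)
    have "1 * 1 \<le> K * n" "K * n \<le> K\<^sup>2 * n" "1 * n \<le> K * n"
      using K_pos n_pos by (intro mult_le_mono; simp add: power2_eq_square)+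
    then have "t \<le> 30000 * (K\<^sup>2 * n)" using t by linarith
    moreover have "?q ` {..<n} = {..<n}" using bij_betw_imp_surj_on[OF bij] .
    ultimately show ?case using 1(1) by simp
  qed
qed

section \<open>Row offsets, degrees and the leaf-to-root order\<close>

lemma wp_init:
  assumes "nmem s ''n'' 0 = n" "nmem s ''K'' 0 = K" "\<forall>v<n. nmem s ''parent'' v = p v"
    "\<forall>v<n. rmem s ''weight'' v = w v"
  shows "wp init s (\<lambda>t s'. t \<le> (n + 1) * 150 + 20 \<and> nmem s' ''hp'' 0 = 2 \<and> nmem s' ''r'' 0 = rt \<and>
    rmem s' ''W'' 0 = W \<and>
    (\<forall>v<n. nmem s' ''sz'' v = 1 \<and> nmem s' ''d'' v = 0 \<and> nmem s' ''ln'' v = 0 \<and> nmem s' ''bs'' v = base v \<and>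
      rmem s' ''tw'' v = w v))"
proof -
  define s1 where "s1 = nupd ''hp'' 0 2 (nupd ''acc'' 0 0 (rupd ''W'' 0 0 s))"
  let ?I = "\<lambda>i s'. nmem s' ''acc'' 0 = base i \<and> rmem s' ''W'' 0 = (\<Sum>v<i. w v) \<and>
    (rt < i \<longrightarrow> nmem s' ''r'' 0 = rt) \<and>
    (\<forall>v<i. nmem s' ''sz'' v = 1 \<and> nmem s' ''d'' v = 0 \<and> nmem s' ''ln'' v = 0 \<and> nmem s' ''bs'' v = base v \<and>
      rmem s' ''tw'' v = w v)"
  have loop: "wp (For ''v'' (N ''n'') init_cell) s1 (\<lambda>t s'. t \<le> (n + 1) * (100 + 2 + 9) \<and> nmem s' ''v'' 0 = n \<and> ?I n s')"
  proof (rule wp_conseq[OF wp_For_const[where m = n and b = 100 and I = ?I]], goal_cases)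
    case 2
    then show ?case by (simp add: s1_def base_def)
  next
    case (3 i s')
    then show ?case using assms by (simp add: frm s1_def)
  next
    case (4 i s')
    have e: "nmem s' ''K'' 0 = K" "nmem s' ''parent'' i = p i" "rmem s' ''weight'' i = w i"
      using assms frm[OF 4(3)] 4(1) by (simp_all add: s1_def)
    let ?s2 = "rupd ''W'' 0 (rmem s' ''W'' 0 + w i) (rupd ''tw'' i (w i) (nupd ''acc'' 0 (base i + (K + 1))
      (nupd ''bs'' i (base i) (nupd ''ln'' i 0 (nupd ''d'' i 0 (nupd ''sz'' i 1 s'))))))"
    define s2 where "s2 = (if i = rt then nupd ''r'' 0 i ?s2 else ?s2)"
    have blk: "wp init_cell s' Q" if "\<And>t. t \<le> 100 \<Longrightarrow> Q t s2" for Q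
      using that 4(2,4) e p_eq_iff[OF 4(1)]
      by (cases "i = rt") (simp_all add: init_cell_def wp_simps s2_def)
    have r2: "rt < Suc i \<longrightarrow> nmem s2 ''r'' 0 = rt" using 4(4) by (auto simp: s2_def less_Suc_eq)
    have m2: "nmem s2 ''acc'' 0 = base (Suc i)" "rmem s2 ''W'' 0 = (\<Sum>v<Suc i. w v)"
      using 4(4) by (simp_all add: s2_def base_def)
    have a2: "nmem s2 ''sz'' = (nmem s' ''sz'')(i := 1)" "nmem s2 ''d'' = (nmem s' ''d'')(i := 0)"
      "nmem s2 ''ln'' = (nmem s' ''ln'')(i := 0)" "nmem s2 ''bs'' = (nmem s' ''bs'')(i := base i)"
      "rmem s2 ''tw'' = (rmem s' ''tw'')(i := w i)"
      by (simp_all add: s2_def)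
    have "\<forall>v<Suc i. nmem s2 ''sz'' v = 1 \<and> nmem s2 ''d'' v = 0 \<and> nmem s2 ''ln'' v = 0 \<and>
        nmem s2 ''bs'' v = base v \<and> rmem s2 ''tw'' v = w v"
      unfolding a2 using 4(4) by (simp add: less_Suc_eq)
    then show ?case using r2 m2 by (intro blk) simp
  qed auto
  have blk: "wp (RLet ''W'' (RConst 0)) s (\<lambda>t1 s. wp (NLet ''acc'' (NConst 0)) s
      (\<lambda>t2 s. wp (NLet ''hp'' (NConst 2)) s (\<lambda>t3 s. Q t1 t2 t3 s))) = Q 3 3 3 s1" for Q
    by (simp add: wp_simps s1_def numeral_eq_Suc)
  show ?thesis
    unfolding init_def wp_Seq blk
  proof (rule wp_conseq[OF loop], goal_cases)
    case (1 t s')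
    moreover have "nmem s' ''hp'' 0 = 2" using frm[OF 1(2)] by (simp add: s1_def)
    moreover have "W = (\<Sum>v<n. w v)" by (simp add: W_def nodes_T)
    ultimately show ?case using rt_less by simp
  qed
qed

lemma wp_degrees:
  assumes "nmem s ''n'' 0 = n" "\<forall>v<n. nmem s ''parent'' v = p v" "\<forall>v<n. nmem s ''d'' v = 0"
  shows "wp degrees s (\<lambda>t s'. t \<le> (n + 1) * 100 \<and> (\<forall>v<n. nmem s' ''d'' v = card (Ch v)))"
proof -
  have "wp degrees s (\<lambda>t s'. t \<le> (n + 1) * (50 + 2 + 9) \<and> nmem s' ''v'' 0 = n \<and>
      (\<forall>v<n. nmem s' ''d'' v = card (Ch v \<inter> {..<n})))"
    unfolding degrees_def
  proof (rule wp_conseq[OF wp_For_const[where m = n and b = 50 and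
      I = "\<lambda>i s'. \<forall>v<n. nmem s' ''d'' v = card (Ch v \<inter> {..<i})"]], goal_cases)
    case 2
    then show ?case using assms(3) by simp
  next
    case (3 i s')
    then show ?case using assms(1) by (simp add: frm)
  next
    case (4 i s')
    have e: "nmem s' ''parent'' i = p i" using assms frm[OF 4(3)] 4(1) by simp
    show ?case
    proof (cases "i = rt")
      case True
      have "Ch v \<inter> {..<Suc i} = Ch v \<inter> {..<i}" if "v < n" for v
        using rt_notin_Ch[OF that] True by (auto simp: less_Suc_eq)
      then show ?thesis using 4(2,4) e True p_rt by (simp add: degree_cell_def wp_simps)
    next
      case False
      have pi: "p i \<noteq> i" using p_eq_iff[OF 4(1)] False by simp
      define s2 where "s2 = nupd ''d'' (p i) (nmem s' ''d'' (p i) + 1) s'"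
      have blk: "wp degree_cell s' Q" if "\<And>t. t \<le> 50 \<Longrightarrow> Q t s2" for Q
        using that 4(2) e pi by (simp add: degree_cell_def wp_simps s2_def)
      have "nmem s2 ''d'' v = card (Ch v \<inter> {..<Suc i})" if "v < n" for v
      proof (cases "v = p i")
        case True
        then have "i \<in> Ch v" using Ch_iff[OF that] False 4(1) by simp
        then have "Ch v \<inter> {..<Suc i} = insert i (Ch v \<inter> {..<i})" by auto
        then show ?thesis using 4(4) that True by (simp add: s2_def)
      next
        case ne: False
        then have "i \<notin> Ch v" using Ch_iff[OF that] by simp
        then have "Ch v \<inter> {..<Suc i} = Ch v \<inter> {..<i}" by (auto simp: less_Suc_eq)
        then show ?thesis using 4(4) that ne by (simp add: s2_def)
      qed
      then show ?thesis by (intro blk) simp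
    qed
  qed auto
  then show ?thesis
  proof (rule wp_conseq, goal_cases)
    case (1 t s')
    have "Ch v \<inter> {..<n} = Ch v" if "v < n" for v using Ch_less[OF that] by auto
    then show ?case using 1(1) by simp
  qed
qed

lemma wp_leaves:
  assumes "nmem s ''n'' 0 = n" "\<forall>v<n. nmem s ''d'' v = card (Ch v)"
  shows "wp leaves s (\<lambda>t s'. t \<le> (n + 1) * 100 + 3 \<and> (\<forall>v<n. nmem s' ''cnt'' v = card (Ch v)) \<and>
    inj_on (nmem s' ''q'') {..<nmem s' ''tl'' 0} \<and>
    nmem s' ''q'' ` {..<nmem s' ''tl'' 0} = {v. v < n \<and> Ch v = {}})"
proof -
  define s1 where "s1 = nupd ''tl'' 0 0 s"
  have loop: "wp (For ''v'' (N ''n'') leaf_cell) s1 (\<lambda>t s'. t \<le> (n + 1) * (50 + 2 + 9) \<and> nmem s' ''v'' 0 = n \<and>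
      ((\<forall>v<n. nmem s' ''cnt'' v = card (Ch v)) \<and> inj_on (nmem s' ''q'') {..<nmem s' ''tl'' 0} \<and>
       nmem s' ''q'' ` {..<nmem s' ''tl'' 0} = {v. v < n \<and> Ch v = {}}))"
  proof (rule wp_conseq[OF wp_For_const[where m = n and b = 50 and
      I = "\<lambda>i s'. (\<forall>v<i. nmem s' ''cnt'' v = card (Ch v)) \<and> inj_on (nmem s' ''q'') {..<nmem s' ''tl'' 0} \<and>
       nmem s' ''q'' ` {..<nmem s' ''tl'' 0} = {v. v < i \<and> Ch v = {}}"]], goal_cases)
    case 2
    then show ?case by (simp add: s1_def)
  next
    case (3 i s')
    then show ?case using assms(1) by (simp add: frm s1_def)
  next
    case (4 i s')
    have e: "nmem s' ''d'' i = card (Ch i)" using assms frm[OF 4(3)] 4(1) by (simp add: s1_def)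
    let ?q = "nmem s' ''q''" and ?tl = "nmem s' ''tl'' 0"
    have I: "\<forall>v<i. nmem s' ''cnt'' v = card (Ch v)" "inj_on ?q {..<?tl}" "?q ` {..<?tl} = {v. v < i \<and> Ch v = {}}"
      using 4(4) by auto
    show ?case
    proof (cases "Ch i = {}")
      case True
      have im: "(?q(?tl := i)) ` {..<?tl} = ?q ` {..<?tl}" by (intro image_cong) auto
      have "(?q(?tl := i)) ` {..<Suc ?tl} = {v. v < Suc i \<and> Ch v = {}}"
        unfolding lessThan_Suc image_insert im I(3) using True by (auto simp: less_Suc_eq)
      moreover have "inj_on (?q(?tl := i)) {..<Suc ?tl}"
      proof -
        have "inj_on (?q(?tl := i)) {..<?tl}" using I(2) by (simp add: inj_on_def)
        moreover have "i \<notin> ?q ` {..<?tl}" unfolding I(3) by simp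
        ultimately show ?thesis unfolding lessThan_Suc by (simp add: im)
      qed
      ultimately show ?thesis using 4(2) e True I(1) by (simp add: leaf_cell_def wp_simps less_Suc_eq)
    next
      case False
      then have "{v. v < Suc i \<and> Ch v = {}} = {v. v < i \<and> Ch v = {}}" by (auto simp: less_Suc_eq)
      moreover have "card (Ch i) > 0" using False by (simp add: card_gt_0_iff)
      ultimately show ?thesis using 4(2) e I by (simp add: leaf_cell_def wp_simps less_Suc_eq)
    qed
  qed auto
  have blk: "wp (NLet ''tl'' (NConst 0)) s Q = Q 3 s1" for Q by (simp add: wp_simps s1_def numeral_eq_Suc)
  show ?thesis unfolding leaves_def wp_Seq blk using loop by (rule wp_conseq) auto
qed

lemma wp_order:
  assumes "nmem s ''n'' 0 = n" "\<forall>v<n. nmem s ''parent'' v = p v" "\<forall>v<n. nmem s ''cnt'' v = card (Ch v)"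
    "inj_on (nmem s ''q'') {..<nmem s ''tl'' 0}"
    "nmem s ''q'' ` {..<nmem s ''tl'' 0} = {v. v < n \<and> Ch v = {}}"
  shows "wp order s (\<lambda>t s'. t \<le> (n + 1) * 100 \<and> good_order (nmem s' ''q''))"
proof -
  \<comment> \<open>After i steps the queue contains precisely the nodes whose children all lie
    among its first i entries, and \<open>cnt\<close> counts the children still missing.\<close>
  define I where "I i q tl cnt \<longleftrightarrow> i \<le> tl \<and> inj_on q {..<tl} \<and>
    q ` {..<tl} = {v. v < n \<and> Ch v \<subseteq> q ` {..<i}} \<and> (\<forall>v<n. cnt v = card (Ch v - q ` {..<i})) \<and>
    (\<forall>j<i. Ch (q j) \<subseteq> q ` {..<j})" for i tl :: nat and q cnt :: "nat \<Rightarrow> nat"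
  \<comment> \<open>If the queue ran dry at i < n, the treated set would contain every node all of
    whose children it contains. By induction on the size of subtrees it would then contain all n
    nodes, although it has only i elements.\<close>
  have progress: "i < tl" if I: "I i q tl cnt" and i: "i < n" for i q tl cnt
  proof (rule ccontr)
    assume "\<not> i < tl"
    then have tl: "tl = i" using I by (simp add: I_def)
    let ?Z = "q ` {..<i}"
    have Z: "?Z = {v. v < n \<and> Ch v \<subseteq> ?Z}" and inj: "inj_on q {..<i}" using I tl by (auto simp: I_def)
    have "card ?Z = i" using card_image[OF inj] by simp
    then have "?Z \<noteq> {..<n}" using i by auto
    then obtain u where u: "u < n" "u \<notin> ?Z" using Z by auto
    have "\<forall>u. u < n \<longrightarrow> u \<notin> ?Z \<longrightarrow> False"
    proof (rule allI, induct_tac u rule: measure_induct_rule[where f = sz], intro impI)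
      fix u assume IH: "\<And>c. sz c < sz u \<Longrightarrow> c < n \<longrightarrow> c \<notin> ?Z \<longrightarrow> False" and u: "u < n" "u \<notin> ?Z"
      have "Ch u \<subseteq> ?Z" using IH sz_Ch[OF u(1)] Ch_less[OF u(1)] by blast
      then show False using u Z by blast
    qed
    then show False using u by blast
  qed
  have "wp order s (\<lambda>t s'. t \<le> (n + 1) * (60 + 2 + 9) \<and> nmem s' ''i'' 0 = n \<and>
      I n (nmem s' ''q'') (nmem s' ''tl'' 0) (nmem s' ''cnt''))"
    unfolding order_def
  proof (rule wp_conseq[OF wp_For_const[where m = n and b = 60 and
      I = "\<lambda>i s'. I i (nmem s' ''q'') (nmem s' ''tl'' 0) (nmem s' ''cnt'')"]], goal_cases)
    case 2
    then show ?case using assms by (simp add: I_def)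
  next
    case (3 i s')
    then show ?case using assms(1) by (simp add: frm)
  next
    case (4 i s')
    let ?q = "nmem s' ''q''" and ?tl = "nmem s' ''tl'' 0" and ?cnt = "nmem s' ''cnt''"
    let ?u = "?q i" and ?Z = "?q ` {..<i}"
    have itl: "i < ?tl" using progress[OF 4(4,1)] .
    have I: "inj_on ?q {..<?tl}" "?q ` {..<?tl} = {v. v < n \<and> Ch v \<subseteq> ?Z}"
      "\<And>v. v < n \<Longrightarrow> ?cnt v = card (Ch v - ?Z)" "\<And>j. j < i \<Longrightarrow> Ch (?q j) \<subseteq> ?q ` {..<j}"
      using 4(4) unfolding I_def by blast+
    have "?u \<in> ?q ` {..<?tl}" using itl by simp
    then have u: "?u < n" "Ch ?u \<subseteq> ?Z" unfolding I(2) by auto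
    have uZ: "?u \<notin> ?Z" using I(1) itl by (auto dest: inj_onD)
    have e: "nmem s' ''parent'' ?u = p ?u" using assms frm[OF 4(3)] u by simp
    have Z': "?q ` {..<Suc i} = insert ?u ?Z" by (simp add: lessThan_Suc)
    have I4: "\<forall>j<Suc i. Ch (?q j) \<subseteq> ?q ` {..<j}" using I(4) u(2) by (auto simp: less_Suc_eq)
    show ?case
    proof (cases "?u = rt")
      case True
      have C: "Ch v - insert ?u ?Z = Ch v - ?Z" "Ch v \<subseteq> insert ?u ?Z \<longleftrightarrow> Ch v \<subseteq> ?Z" if "v < n" for v
        using rt_notin_Ch[OF that] True by auto
      have "{v. v < n \<and> Ch v \<subseteq> insert ?u ?Z} = {v. v < n \<and> Ch v \<subseteq> ?Z}" using C(2) by blast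
      then have "I (Suc i) ?q ?tl ?cnt"
        unfolding I_def Z' using itl I(1-3) I4 C(1) by simp
      then show ?thesis using 4(2) e True p_rt by (simp add: order_cell_def wp_simps)
    next
      case False
      let ?x = "p ?u"
      have x: "?x < n" "?x \<noteq> ?u" "?u \<in> Ch ?x"
        using p_less[OF u(1)] p_eq_iff[OF u(1)] in_Ch_p[OF u(1)] False by auto
      let ?cnt' = "?cnt(?x := ?cnt ?x - 1)"
      have other: "Ch v - insert ?u ?Z = Ch v - ?Z" "Ch v \<subseteq> insert ?u ?Z \<longleftrightarrow> Ch v \<subseteq> ?Z"
        if "v < n" "v \<noteq> ?x" for v
        using Ch_disjoint[OF that(1) x(1) that(2)] x(3) by auto
      have "Ch ?x - insert ?u ?Z = (Ch ?x - ?Z) - {?u}" by auto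
      then have cx: "card (Ch ?x - insert ?u ?Z) = card (Ch ?x - ?Z) - 1"
        using x(3) uZ by simp
      have cnt': "\<forall>v<n. ?cnt' v = card (Ch v - insert ?u ?Z)"
        using other(1) I(3) cx x(1) by auto
      have "?cnt' ?x = card (Ch ?x - insert ?u ?Z)" using cnt' x(1) by blast
      then have zero: "?cnt' ?x = 0 \<longleftrightarrow> Ch ?x \<subseteq> insert ?u ?Z"
        by (simp only: card_eq_0_iff finite_Diff finite_Ch Diff_eq_empty_iff simp_thms)
      have xZ: "\<not> Ch ?x \<subseteq> ?Z" using x(3) uZ by auto
      show ?thesis
      proof (cases "?cnt' ?x = 0")
        case z: True
        have im: "(?q(?tl := ?x)) ` A = ?q ` A" if "A \<subseteq> {..<?tl}" for A using that by (intro image_cong) auto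
        have imi: "(?q(?tl := ?x)) ` {..<j} = ?q ` {..<j}" if "j \<le> ?tl" for j using that by (intro im) auto
        have "(?q(?tl := ?x)) ` {..<Suc ?tl} = insert ?x (?q ` {..<?tl})"
          unfolding lessThan_Suc image_insert imi[OF order.refl] by simp
        also have "\<dots> = {v. v < n \<and> Ch v \<subseteq> insert ?u ?Z}"
          unfolding I(2) using other(2) x(1) zero z by auto
        finally have A: "(?q(?tl := ?x)) ` {..<Suc ?tl} = {v. v < n \<and> Ch v \<subseteq> insert ?u ?Z}" .
        have "inj_on (?q(?tl := ?x)) {..<?tl}" using I(1) by (simp add: inj_on_def)
        moreover have "?x \<notin> ?q ` {..<?tl}" unfolding I(2) using xZ by simp
        ultimately have B: "inj_on (?q(?tl := ?x)) {..<Suc ?tl}"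
          unfolding lessThan_Suc by (simp add: imi[OF order.refl])
        have D: "\<forall>j<Suc i. Ch ((?q(?tl := ?x)) j) \<subseteq> (?q(?tl := ?x)) ` {..<j}"
        proof (intro allI impI)
          fix j assume j: "j < Suc i"
          then have "(?q(?tl := ?x)) j = ?q j" "(?q(?tl := ?x)) ` {..<j} = ?q ` {..<j}"
            using itl imi[of j] by simp_all
          then show "Ch ((?q(?tl := ?x)) j) \<subseteq> (?q(?tl := ?x)) ` {..<j}" using I4 j by simp
        qed
        have "I (Suc i) (?q(?tl := ?x)) (Suc ?tl) ?cnt'"
          unfolding I_def imi[OF Suc_leI[OF itl]] Z' using A B D cnt' itl by simp
        then show ?thesis using 4(2) e x(2) z by (simp add: order_cell_def wp_simps)
      next
        case nz: False
        have "{v. v < n \<and> Ch v \<subseteq> insert ?u ?Z} = {v. v < n \<and> Ch v \<subseteq> ?Z}"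
          using other(2) zero nz xZ by blast
        then have "I (Suc i) ?q ?tl ?cnt'"
          unfolding I_def Z' using itl I(1,2) I4 cnt' by simp
        then show ?thesis using 4(2) e x(2) nz by (simp add: order_cell_def wp_simps)
      qed
    qed
  qed auto
  then show ?thesis
  proof (rule wp_conseq, goal_cases)
    case (1 t s')
    let ?q = "nmem s' ''q''"
    have I: "I n ?q (nmem s' ''tl'' 0) (nmem s' ''cnt'')" and t: "t \<le> (n + 1) * 100" using 1(1) by auto
    have inj: "inj_on ?q {..<n}" using I unfolding I_def by (auto intro: inj_on_subset)
    have "?q ` {..<n} \<subseteq> ?q ` {..<nmem s' ''tl'' 0}" using I unfolding I_def by (intro image_mono) auto
    also have "\<dots> \<subseteq> {..<n}" using I unfolding I_def by auto
    finally have sub: "?q ` {..<n} \<subseteq> {..<n}" .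
    have "?q ` {..<n} = {..<n}" using card_subset_eq[OF _ sub] card_image[OF inj] by simp
    then have "good_order ?q" using inj I by (auto simp: good_order_def bij_betw_def I_def)
    then show ?case using t by blast
  qed
qed

end

section \<open>Extracting the summary trees\<close>

definition "walk = While (NLess (NConst 1) (N ''pt''))
  (NSet ''kk'' (NGet ''CH'' (N ''pt'')) (NGet ''CK'' (N ''pt'')) ;;
   NLet ''cl'' (NAdd (N ''cl'') (NConst 1)) ;;
   NLet ''pt'' (NGet ''CN'' (N ''pt'')))"

text \<open>The block of v is written before that of its parent is read. At the root, which is its
  own parent, this makes the new block its own parent, as the output format demands.\<close>

definition "new_block =
  NSet ''block'' (NAdd (N ''kn'') (N ''v'')) (N ''id'') ;;
  NSet ''sparent'' (NAdd (N ''kn'') (N ''id'')) (NGet ''block'' (NAdd (N ''kn'') (NGet ''parent'' (N ''v'')))) ;;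
  NSet ''df'' (N ''v'') (N ''id'') ;; NLet ''my'' (N ''id'') ;; NLet ''id'' (NAdd (N ''id'') (NConst 1))"

text \<open>The length \<open>cl\<close> of the plan tells whether children remain for
  \<open>other\<close>, so they need not be inspected; each of them later finds the number of
  \<open>other\<close> in \<open>df v\<close>.\<close>

definition "expand_block =
  NLet ''pt'' (NGet ''BP'' (NAdd (NGet ''bs'' (N ''v'')) (NGet ''kk'' (N ''v'')))) ;; NLet ''cl'' (NConst 0) ;;
  walk ;;
  If (NLess (N ''cl'') (NGet ''d'' (N ''v'')))
    (NSet ''sparent'' (NAdd (N ''kn'') (N ''id'')) (N ''my'') ;; NSet ''df'' (N ''v'') (N ''id'') ;;
     NLet ''id'' (NAdd (N ''id'') (NConst 1))) Skip"

definition "old_block =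
  NSet ''block'' (NAdd (N ''kn'') (N ''v'')) (NGet ''df'' (NGet ''parent'' (N ''v''))) ;;
  NSet ''df'' (N ''v'') (NGet ''df'' (NGet ''parent'' (N ''v'')))"

text \<open>Reading \<open>q\<close> backwards treats parents before children: the allotment and the
  default block of v come from its parent.\<close>

definition "dec_cell =
  NLet ''v'' (NGet ''q'' (NSub (NSub (N ''n'') (NConst 1)) (N ''i''))) ;;
  If (NLess (NConst 0) (NGet ''kk'' (N ''v'')))
    (new_block ;; If (NLess (NConst 1) (NGet ''kk'' (N ''v''))) expand_block Skip)
    old_block"

definition "dec_k =
  For ''v'' (N ''n'') (NSet ''kk'' (N ''v'') (NConst 0)) ;;
  NSet ''kk'' (N ''r'') (N ''k'') ;; NLet ''id'' (NConst 0) ;;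
  For ''i'' (N ''n'') dec_cell ;;
  RSet ''entropy'' (N ''k'') (RGet ''BV'' (NAdd (NGet ''bs'' (N ''r'')) (N ''k'')))"

text \<open>The row offset k n is accumulated in \<open>kn\<close>, for want of a multiplication of
  naturals.\<close>

definition "decode_cell = NLet ''k'' (NAdd (N ''k0'') (NConst 1)) ;; NLet ''kn'' (NAdd (N ''kn'') (N ''n'')) ;; dec_k"

definition "decode_all = NLet ''kn'' (NConst 0) ;;
  For ''k0'' (NSub (N ''K'') (NSub (N ''K'') (N ''n''))) decode_cell"

lemma nw_walk [simp]: "nw walk = {''kk'', ''cl'', ''pt''}" and rw_walk [simp]: "rw walk = {}"
  by (auto simp: walk_def)

lemma nw_dec_cell [simp]: "nw dec_cell = {''v'', ''block'', ''sparent'', ''df'', ''my'', ''id'', ''pt'', ''cl'', ''kk''}"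
  and rw_dec_cell [simp]: "rw dec_cell = {}"
  by (auto simp: dec_cell_def new_block_def expand_block_def old_block_def)

lemma nw_dec_k [simp]: "nw dec_k = insert ''i'' (nw dec_cell)" and rw_dec_k [simp]: "rw dec_k = {''entropy''}"
  by (auto simp: dec_k_def)

lemma nw_decode_cell [simp]: "nw decode_cell = {''k'', ''kn''} \<union> nw dec_k"
  and rw_decode_cell [simp]: "rw decode_cell = {''entropy''}"
  by (auto simp: decode_cell_def)

lemma wp_While:
  "wp (While b c) s Q \<longleftrightarrow> (if bval b s then wp c s (\<lambda>t1 s1. wp (While b c) s1 (\<lambda>t2 s2. Q (bcost b + t1 + t2) s2))
     else Q (bcost b) s)"
proof (cases "bval b s")
  case True
  then show ?thesis unfolding wp_def by (simp only: if_True) (blast intro: exec.WhileTrue elim: WhileE)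
next
  case False
  have "exec (While b c) s (bcost b) s" using False by (rule exec.WhileFalse)
  then show ?thesis using False wp_atomic by simp
qed

lemma wp_walk:
  assumes "heap s q L" "nmem s ''pt'' 0 = q" "distinct (map fst L)"
  shows "wp walk s (\<lambda>t s'. t \<le> length L * 30 + 10 \<and> nmem s' ''cl'' 0 = nmem s ''cl'' 0 + length L \<and>
    nmem s' ''kk'' = (\<lambda>c. case map_of L c of None \<Rightarrow> nmem s ''kk'' c | Some k \<Rightarrow> k))"
  using assms
proof (induction L arbitrary: s q)
  case Nil
  then show ?case unfolding walk_def by (subst wp_While) simp
next
  case (Cons a L)
  obtain c k where a: "a = (c, k)" by (cases a)
  define s1 where "s1 = nupd ''pt'' 0 (nmem s ''CN'' q) (nupd ''cl'' 0 (nmem s ''cl'' 0 + 1) (nupd ''kk'' c k s))"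
  have h: "1 < q" "nmem s ''CH'' q = c" "nmem s ''CK'' q = k" "heap s (nmem s ''CN'' q) L"
    using Cons.prems(1) a by auto
  have "wp walk s1 (\<lambda>t s'. t \<le> length L * 30 + 10 \<and> nmem s' ''cl'' 0 = nmem s1 ''cl'' 0 + length L \<and>
    nmem s' ''kk'' = (\<lambda>c. case map_of L c of None \<Rightarrow> nmem s1 ''kk'' c | Some k \<Rightarrow> k))"
    by (rule Cons.IH[of _ "nmem s ''CN'' q"]) (use h(4) Cons.prems(3) in \<open>simp_all add: s1_def\<close>)
  moreover have "map_of L c = None" using Cons.prems(3) a by (auto simp: map_of_eq_None_iff image_iff)
  ultimately have w: "wp walk s1 (\<lambda>t s'. 30 + t \<le> length (a # L) * 30 + 10 \<and>
    nmem s' ''cl'' 0 = nmem s ''cl'' 0 + length (a # L) \<and>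
    nmem s' ''kk'' = (\<lambda>c. case map_of (a # L) c of None \<Rightarrow> nmem s ''kk'' c | Some k \<Rightarrow> k))"
    by (elim wp_conseq) (auto simp: s1_def a split: option.splits)
  have "wp walk s Q = wp walk s1 (\<lambda>t. Q (4 + 18 + t))" for Q
    unfolding walk_def by (subst wp_While)
      (use h(1-3) Cons.prems(2) in \<open>simp add: wp_simps s1_def numeral_eq_Suc\<close>)
  then show ?case using w by (auto elim: wp_conseq)
qed

lemma edges_nodes: "(x, y) \<in> edges t \<Longrightarrow> x \<in> nodes t"
  by (induction t) (auto intro: rev_bexI)

lemma parent_array_cong:
  assumes "parent_array k f M" "\<And>j. j < k \<Longrightarrow> g j = f j"
  shows "parent_array k g M"
proof -
  note pa = assms(1)[unfolded parent_array_def]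
  note M = pa[THEN conjunct1] pa[THEN conjunct2, THEN conjunct1]
    pa[THEN conjunct2, THEN conjunct2, THEN conjunct1] pa[THEN conjunct2, THEN conjunct2, THEN conjunct2]
  have eq: "g x = f x" if "x \<in> nodes M" for x using that assms(2) M(2) by simp
  have "g (root M) = root M" using eq[OF root_in_nodes] M(3) by simp
  moreover have "g x = v" if "(x, v) \<in> edges M" for x v
    using eq[OF edges_nodes[OF that]] bspec[OF M(4) that] by simp
  ultimately show ?thesis using M(1,2) unfolding parent_array_def by (intro conjI ballI) auto
qed

section \<open>Invariant of the top-down numbering\<close>

context weighted_tree
begin

definition "plan v k L \<longleftrightarrow> valid v L \<and> psize v L = k \<and> pval v L = best v k"

definition local_ok :: "(nat \<Rightarrow> nat) \<Rightarrow> (nat \<Rightarrow> nat) \<Rightarrow> (nat \<Rightarrow> nat) \<Rightarrow> (nat \<Rightarrow> nat) \<Rightarrow> nat \<Rightarrow> bool" where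
  "local_ok kk blk df sp v \<longleftrightarrow> (kk v = 0 \<longrightarrow> blk v = df (p v) \<and> df v = blk v) \<and>
     (kk v \<le> 1 \<longrightarrow> (\<forall>c\<in>Ch v. kk c = 0)) \<and> (kk v = 1 \<longrightarrow> df v = blk v) \<and>
     (2 \<le> kk v \<longrightarrow> (\<exists>L. plan v (kk v) L \<and> (\<forall>c\<in>Ch v. kk c = alloc L c))) \<and>
     (1 \<le> kk v \<longrightarrow> sp (blk v) = blk (p v)) \<and>
     (2 \<le> kk v \<and> (\<exists>c\<in>Ch v. kk c = 0) \<longrightarrow> sp (df v) = blk v)"

definition "lab kk Z = {(v, b). v \<in> Z \<and> 1 \<le> kk v \<and> (b \<longrightarrow> 2 \<le> kk v \<and> (\<exists>c\<in>Ch v. kk c = 0))}"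

definition "lid blk df = (\<lambda>(v, b). if b then df v else blk v)"

text \<open>The conditions of locale \<open>numbering\<close>, restricted to a set \<open>Z\<close>
  of treated nodes that is closed under parents. The numbers below m are exactly those in use, and,
  except for the root, an allotment is nonzero only if the parent has been treated.\<close>

definition "numbered k Z kk blk df sp m \<longleftrightarrow> Z \<subseteq> {..<n} \<and> (\<forall>v\<in>Z. p v \<in> Z) \<and> kk rt = k \<and>
  (\<forall>v<n. v \<noteq> rt \<and> p v \<notin> Z \<longrightarrow> kk v = 0) \<and> (\<forall>v<n. kk v \<noteq> 0 \<longrightarrow> feas v (kk v) \<and> kk v \<le> K) \<and>
  (\<forall>v\<in>Z. local_ok kk blk df sp v) \<and> inj_on (lid blk df) (lab kk Z) \<and> lid blk df ` lab kk Z = {..<m}"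

text \<open>Treating v changes only \<open>blk v\<close>, \<open>df v\<close>, entries of
  \<open>sp\<close> from m on and the allotments of the children of v. The local conditions at nodes
  of \<open>Z\<close> read none of these: \<open>Z\<close> is closed under parents and lacks v, and
  its blocks have numbers below m.\<close>

lemma numbered_step:
  assumes st: "numbered k Z kk blk df sp m" and v: "v < n" "v \<notin> Z" "v = rt \<or> p v \<in> Z"
    and kk': "\<And>u. u \<notin> Ch v \<Longrightarrow> kk' u = kk u"
      "\<And>c. c \<in> Ch v \<Longrightarrow> kk' c \<noteq> 0 \<Longrightarrow> feas c (kk' c) \<and> kk' c \<le> K"
    and sp': "\<And>j. j < m \<Longrightarrow> sp' j = sp j"
    and loc: "local_ok kk' (blk(v := b)) (df(v := e)) sp' v"
    and lab: "lid (blk(v := b)) (df(v := e)) ` lab kk' {v} = {m..<m'}"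
      "inj_on (lid (blk(v := b)) (df(v := e))) (lab kk' {v})" "m \<le> m'"
  shows "numbered k (insert v Z) kk' (blk(v := b)) (df(v := e)) sp' m'"
proof -
  from st have S: "Z \<subseteq> {..<n}" "\<And>u. u \<in> Z \<Longrightarrow> p u \<in> Z" "kk rt = k"
    "\<And>u. u < n \<Longrightarrow> u \<noteq> rt \<Longrightarrow> p u \<notin> Z \<Longrightarrow> kk u = 0" "\<And>u. u < n \<Longrightarrow> kk u \<noteq> 0 \<Longrightarrow> feas u (kk u) \<and> kk u \<le> K"
    "\<And>u. u \<in> Z \<Longrightarrow> local_ok kk blk df sp u" "inj_on (lid blk df) (lab kk Z)" "lid blk df ` lab kk Z = {..<m}"
    unfolding numbered_def by blast+
  have ZC: "u \<notin> Ch v" if "u \<in> Z" for u using Ch_iff[OF v(1), of u] S(2)[OF that] v(2) by auto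
  have kZ: "kk' u = kk u" if "u \<in> Z" for u using kk'(1)[OF ZC[OF that]] .
  have kC: "kk' c = kk c" if "u \<in> Z" "c \<in> Ch u" for u c
    using kk'(1)[of c] Ch_disjoint[OF _ v(1), of u] that S(1) v(2) by auto
  have lab_eq: "lab kk' Z = lab kk Z" unfolding lab_def using kZ kC by auto
  have lid_eq: "lid (blk(v := b)) (df(v := e)) l = lid blk df l" if "l \<in> lab kk Z" for l
    using that v(2) by (auto simp: lab_def lid_def)
  have lab_ins: "lab kk' (insert v Z) = lab kk Z \<union> lab kk' {v}"
    unfolding lab_eq[symmetric] by (auto simp: lab_def)
  have im: "lid (blk(v := b)) (df(v := e)) ` lab kk Z = {..<m}"
    using S(8) lid_eq by (simp cong: image_cong)
  have "local_ok kk' (blk(v := b)) (df(v := e)) sp' u" if u: "u \<in> Z" for u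
  proof -
    have ne: "u \<noteq> v" "p u \<noteq> v" using u v(2) S(2)[OF u] by auto
    have b: "blk u < m" if "1 \<le> kk u"
    proof -
      have "(u, False) \<in> lab kk Z" using u that by (simp add: lab_def)
      then have "lid blk df (u, False) \<in> {..<m}" unfolding S(8)[symmetric] by (rule imageI)
      then show ?thesis by (simp add: lid_def)
    qed
    have d: "df u < m" if "2 \<le> kk u \<and> (\<exists>c\<in>Ch u. kk c = 0)"
    proof -
      have "(u, True) \<in> lab kk Z" using u that by (simp add: lab_def)
      then have "lid blk df (u, True) \<in> {..<m}" unfolding S(8)[symmetric] by (rule imageI)
      then show ?thesis by (simp add: lid_def)
    qed
    have C: "(\<forall>c\<in>Ch u. kk' c = 0) \<longleftrightarrow> (\<forall>c\<in>Ch u. kk c = 0)" "(\<exists>c\<in>Ch u. kk' c = 0) \<longleftrightarrow> (\<exists>c\<in>Ch u. kk c = 0)"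
      "\<And>L. (\<forall>c\<in>Ch u. kk' c = alloc L c) \<longleftrightarrow> (\<forall>c\<in>Ch u. kk c = alloc L c)"
      using kC[OF u] by simp_all
    have eqs: "(blk(v := b)) u = blk u" "(blk(v := b)) (p u) = blk (p u)" "(df(v := e)) u = df u"
      "(df(v := e)) (p u) = df (p u)"
      using ne by simp_all
    note l = S(6)[OF u, unfolded local_ok_def]
    from l have "1 \<le> kk u \<longrightarrow> sp (blk u) = blk (p u)" by (elim conjE)
    then have "1 \<le> kk u \<longrightarrow> sp' (blk u) = blk (p u)" using b sp' by simp
    moreover from l have "2 \<le> kk u \<and> (\<exists>c\<in>Ch u. kk c = 0) \<longrightarrow> sp (df u) = blk u" by (elim conjE)
    then have "2 \<le> kk u \<and> (\<exists>c\<in>Ch u. kk c = 0) \<longrightarrow> sp' (df u) = blk u" using d sp' by simp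
    ultimately have "(1 \<le> kk u \<longrightarrow> sp' (blk u) = blk (p u)) \<and>
      (2 \<le> kk u \<and> (\<exists>c\<in>Ch u. kk c = 0) \<longrightarrow> sp' (df u) = blk u)" ..
    then show ?thesis
      using l unfolding local_ok_def kZ[OF u] C eqs by (elim conjE, intro conjI) assumption+
  qed
  then have "\<forall>u\<in>insert v Z. local_ok kk' (blk(v := b)) (df(v := e)) sp' u" using loc by blast
  moreover have "inj_on (lid (blk(v := b)) (df(v := e))) (lab kk' (insert v Z))"
    unfolding lab_ins inj_on_Un
  proof (intro conjI)
    show "inj_on (lid (blk(v := b)) (df(v := e))) (lab kk Z)" using S(7) lid_eq by (simp add: inj_on_def)
    show "lid (blk(v := b)) (df(v := e)) ` (lab kk Z - lab kk' {v}) \<inter>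
        lid (blk(v := b)) (df(v := e)) ` (lab kk' {v} - lab kk Z) = {}"
    proof -
      have "lid (blk(v := b)) (df(v := e)) ` (lab kk Z - lab kk' {v}) \<subseteq> {..<m}"
        unfolding im[symmetric] by (intro image_mono Diff_subset)
      moreover have "lid (blk(v := b)) (df(v := e)) ` (lab kk' {v} - lab kk Z) \<subseteq> {m..<m'}"
        unfolding lab(1)[symmetric] by (intro image_mono Diff_subset)
      moreover have "{..<m} \<inter> {m..<m'} = {}" by auto
      ultimately show ?thesis by blast
    qed
  qed (rule lab(2))
  moreover have "lid (blk(v := b)) (df(v := e)) ` lab kk' (insert v Z) = {..<m'}"
    unfolding lab_ins image_Un im lab(1) using lab(3) by auto
  moreover have "kk' rt = k" using kk'(1)[OF rt_notin_Ch[OF v(1)]] S(3) by simp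
  moreover have "kk' u = 0" if "u < n" "u \<noteq> rt" "p u \<notin> insert v Z" for u
    using kk'(1)[of u] Ch_iff[OF v(1), of u] S(4)[OF that(1,2)] that(3) by auto
  moreover have "feas u (kk' u) \<and> kk' u \<le> K" if "u < n" "kk' u \<noteq> 0" for u
    using kk'(1)[of u] kk'(2)[of u] S(5)[OF that(1)] that(2) by (cases "u \<in> Ch v") auto
  moreover have "insert v Z \<subseteq> {..<n}" "\<forall>u\<in>insert v Z. p u \<in> insert v Z"
    using S(1,2) v p_rt by auto
  ultimately show ?thesis unfolding numbered_def by blast
qed

text \<open>Every child in a plan has at least one node. Hence plans have length at most K, and a
  walk along one takes time O(K) whatever the degree of the node.\<close>

lemma plan_length: "v < n \<Longrightarrow> valid v L \<Longrightarrow> length L \<le> (\<Sum>(c, k)\<leftarrow>L. k)"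
proof -
  assume v: "v < n" "valid v L"
  have "1 \<le> snd x" if "x \<in> set L" for x
    using v(2) that feas_bounds[OF Ch_less[OF v(1)]] unfolding valid_def by fastforce
  then have "(\<Sum>x\<leftarrow>L. 1) \<le> (\<Sum>x\<leftarrow>L. snd x)" by (intro sum_list_mono)
  moreover have "(\<Sum>(c, k)\<leftarrow>L. k) = (\<Sum>x\<leftarrow>L. snd x)" by (induction L) auto
  ultimately show ?thesis by (simp add: sum_list_triv)
qed

abbreviation "blk_of s \<equiv> \<lambda>v. nmem s ''block'' (nmem s ''kn'' 0 + v)"
abbreviation "sp_of s \<equiv> \<lambda>j. nmem s ''sparent'' (nmem s ''kn'' 0 + j)"
abbreviation "num_state k Z s \<equiv>
  numbered k Z (nmem s ''kk'') (blk_of s) (nmem s ''df'') (sp_of s) (nmem s ''id'' 0)"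

text \<open>The output rows of smaller k lie below the offset \<open>kn\<close>; this keeps them
  intact.\<close>

definition "low_same s s' \<longleftrightarrow> (\<forall>i<nmem s ''kn'' 0. nmem s' ''block'' i = nmem s ''block'' i \<and>
  nmem s' ''sparent'' i = nmem s ''sparent'' i)"

lemma wp_dec_body:
  assumes env: "env s" and v: "nmem s ''v'' 0 = v" "v < n" "v \<notin> Z" "v = rt \<or> p v \<in> Z"
    and row: "rowrep (heap s) (nmem s ''BP'') (rmem s ''BV'') v"
    and st: "num_state k Z s" and k: "1 \<le> k"
  shows "wp (If (NLess (NConst 0) (NGet ''kk'' (N ''v'')))
    (new_block ;; If (NLess (NConst 1) (NGet ''kk'' (N ''v''))) expand_block Skip) old_block) s
    (\<lambda>t s'. t \<le> (K + 5) * 40 \<and> num_state k (insert v Z) s' \<and> low_same s s')"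
proof -
  let ?kk = "nmem s ''kk''" and ?m = "nmem s ''id'' 0" and ?kn = "nmem s ''kn'' 0" and ?df = "nmem s ''df''"
  \<comment> \<open>The children of v have an untreated parent, so their allotments are still 0.
    Writing the plan over these zeros turns them into exactly \<open>alloc L\<close>.\<close>
  have C0: "?kk c = 0" if "c \<in> Ch v" for c
  proof -
    have "c < n" "c \<noteq> rt" "p c \<notin> Z" using that Ch_iff[OF v(2)] v(3) by auto
    then show ?thesis using st unfolding numbered_def by blast
  qed
  have par: "nmem s ''parent'' v = p v" "nmem s ''bs'' v = base v" "nmem s ''d'' v = card (Ch v)"
    using env v(2) by (simp_all add: env_def)
  show ?thesis
  proof (cases "?kk v = 0")
    case True
    then have "v \<noteq> rt" using st k unfolding numbered_def by auto
    then have pv: "p v \<noteq> v" using p_eq_iff[OF v(2)] by simp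
    have l0: "lab ?kk {v} = {}" using True by (simp add: lab_def)
    have "numbered k (insert v Z) ?kk ((blk_of s)(v := ?df (p v))) (?df(v := ?df (p v))) (sp_of s) ?m"
      by (rule numbered_step[OF st v(2-4)])
        (use C0 True pv l0 in \<open>simp_all add: local_ok_def\<close>)
    moreover define s2 where "s2 = nupd ''df'' v (?df (p v)) (nupd ''block'' (?kn + v) (?df (p v)) s)"
    moreover have b2: "blk_of s2 = (blk_of s)(v := ?df (p v))" by (rule ext) (simp add: s2_def)
    ultimately have "num_state k (insert v Z) s2 \<and> low_same s s2"
      unfolding b2 by (simp add: s2_def low_same_def)
    moreover have "wp old_block s Q" if "\<And>t. t \<le> 30 \<Longrightarrow> Q t s2" for Q
      using that v(1) par by (simp add: old_block_def wp_simps s2_def pv)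
    ultimately show ?thesis using True v(1) by (simp add: wp_If)
  next
    case False
    let ?blk = "(blk_of s)(v := ?m)"
    define s2 where "s2 = nupd ''id'' 0 (?m + 1) (nupd ''my'' 0 ?m (nupd ''df'' v ?m
      (nupd ''sparent'' (?kn + ?m) (?blk (p v)) (nupd ''block'' (?kn + v) ?m s))))"
    have nb: "wp new_block s Q" if "\<And>t. t \<le> 40 \<Longrightarrow> Q t s2" for Q
      using that v(1) par by (auto simp: new_block_def wp_simps s2_def)
    have bval: "bval (NLess (NConst 0) (NGet ''kk'' (N ''v''))) s" using False v(1) by simp
    have low2: "low_same s s2" by (simp add: low_same_def s2_def)
    have b2: "blk_of s2 = ?blk" "sp_of s2 = (sp_of s)(?m := ?blk (p v))"
      by (rule ext, simp add: s2_def)+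
    show ?thesis
    proof (cases "?kk v = 1")
      case True
      have l1: "lab ?kk {v} = {(v, False)}" using True by (auto simp: lab_def)
      have "numbered k (insert v Z) ?kk ?blk (?df(v := ?m)) ((sp_of s)(?m := ?blk (p v))) (?m + 1)"
        by (rule numbered_step[OF st v(2-4)])
          (use C0 True l1 in \<open>auto simp: local_ok_def lid_def\<close>)
      then have ns: "num_state k (insert v Z) s2" unfolding b2 by (simp add: s2_def)
      show ?thesis
        unfolding wp_If[of "NLess (NConst 0) _"] if_P[OF bval] wp_Seq
      proof (rule nb)
        fix t :: nat assume t: "t \<le> 40"
        have "\<not> bval (NLess (NConst 1) (NGet ''kk'' (N ''v''))) s2" using True v(1) by (simp add: s2_def)
        note b3 = if_not_P[OF this]
        show "wp (If (NLess (NConst 1) (NGet ''kk'' (N ''v''))) expand_block Skip) s2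
          (\<lambda>t2 s'. bcost (NLess (NConst 0) (NGet ''kk'' (N ''v''))) + (t + t2) \<le> (K + 5) * 40 \<and>
            num_state k (insert v Z) s' \<and> low_same s s')"
          unfolding wp_If b3 wp_Skip using ns low2 t by (intro conjI) (simp, assumption+)
      qed
    next
      case ne: False
      then have k2: "2 \<le> ?kk v" using False by simp
      have fk: "feas v (?kk v)" "?kk v \<le> K" using st False v(2) unfolding numbered_def by blast+
      let ?bp = "nmem s ''BP'' (base v + ?kk v)"
      from row fk k2 obtain L where L: "heap s ?bp L" "valid v L" "psize v L = ?kk v" "pval v L = best v (?kk v)"
        unfolding rowrep_def by blast
      have dL: "distinct (map fst L)" using L(2) by (simp add: valid_def)
      have lenL: "length L \<le> K" using plan_length[OF v(2) L(2)] L(3) fk(2) by (simp add: psize_def)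
      let ?kk' = "\<lambda>c. case map_of L c of None \<Rightarrow> ?kk c | Some k \<Rightarrow> k"
      have kC: "?kk' c = alloc L c" if "c \<in> Ch v" for c
        using C0[OF that] by (simp add: alloc_def split: option.splits)
      have kN: "?kk' u = ?kk u" if "u \<notin> Ch v" for u
      proof -
        have "map_of L u = None" using that L(2) by (auto simp: map_of_eq_None_iff valid_def)
        then show ?thesis by simp
      qed
      have kF: "feas c (?kk' c) \<and> ?kk' c \<le> K" if c: "c \<in> Ch v" "?kk' c \<noteq> 0" for c
      proof -
        have "alloc L c \<le> (\<Sum>c\<in>Ch v. alloc L c)" using c(1) by (intro member_le_sum) auto
        also have "\<dots> \<le> psize v L" unfolding alloc_plan(1)[OF v(2) L(2), symmetric] alloc_size_def by simp
        finally show ?thesis using alloc_plan(3)[OF v(2) L(2)] c kC[OF c(1)] L(3) fk(2) by simp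
      qed
      have kv: "?kk' v = ?kk v" using kN sz_Ch[OF v(2), of v] by blast
      have pl: "\<exists>L. plan v (?kk v) L \<and> (\<forall>c\<in>Ch v. ?kk' c = alloc L c)"
        using L(2-4) kC by (auto simp: plan_def)
      have ex: "(\<exists>c\<in>Ch v. ?kk' c = 0) \<longleftrightarrow> length L < card (Ch v)"
      proof -
        have "?kk' c = 0 \<longleftrightarrow> c \<notin> fst ` set L" if "c \<in> Ch v" for c
        proof (cases "c \<in> fst ` set L")
          case True
          then obtain j where j: "(c, j) \<in> set L" by auto
          then have "feas c j" "alloc L c = j" using L(2) dL by (auto simp: valid_def alloc_def)
          then show ?thesis
            unfolding kC[OF that] using feas_bounds[OF Ch_less[OF v(2) that], of j] True by simp
        next
          case nin: False
          then have "map_of L c = None" by (simp add: map_of_eq_None_iff)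
          then show ?thesis unfolding kC[OF that] using nin by (simp add: alloc_def)
        qed
        then have eq: "(\<exists>c\<in>Ch v. ?kk' c = 0) \<longleftrightarrow> (\<exists>c\<in>Ch v. c \<notin> fst ` set L)" by simp
        have sub: "fst ` set L \<subseteq> Ch v" using L(2) by (simp add: valid_def)
        have card: "card (fst ` set L) = length L" using distinct_card[OF dL] by simp
        show ?thesis
        proof
          assume "\<exists>c\<in>Ch v. ?kk' c = 0"
          then have "fst ` set L \<subset> Ch v" using sub unfolding eq by blast
          from psubset_card_mono[OF finite_Ch this] show "length L < card (Ch v)" unfolding card .
        next
          assume "length L < card (Ch v)"
          then have "fst ` set L \<noteq> Ch v" using card by auto
          then show "\<exists>c\<in>Ch v. ?kk' c = 0" unfolding eq using sub by blast
        qed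
      qed
      define s3 where "s3 = nupd ''cl'' 0 0 (nupd ''pt'' 0 ?bp s2)"
      have set3: "wp (NLet ''pt'' (NGet ''BP'' (NAdd (NGet ''bs'' (N ''v'')) (NGet ''kk'' (N ''v''))))) s2
          (\<lambda>t1 s. wp (NLet ''cl'' (NConst 0)) s (\<lambda>t2 s. Q t1 t2 s)) = Q 10 3 s3" for Q
        using v(1) par by (simp add: wp_simps s3_def s2_def numeral_eq_Suc)
      have w: "wp walk s3 (\<lambda>t s'. t \<le> length L * 30 + 10 \<and> nmem s' ''cl'' 0 = nmem s3 ''cl'' 0 + length L \<and>
          nmem s' ''kk'' = (\<lambda>c. case map_of L c of None \<Rightarrow> nmem s3 ''kk'' c | Some k \<Rightarrow> k))"
        by (rule wp_walk[OF _ _ dL]) (use L(1) in \<open>simp_all add: s3_def s2_def\<close>)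
      have exb: "wp expand_block s2 (\<lambda>t s'. 60 + t \<le> (K + 5) * 40 \<and> num_state k (insert v Z) s' \<and> low_same s s')"
        unfolding expand_block_def wp_Seq set3
      proof (rule wp_conseq[OF w], goal_cases)
        case (1 t s4)
        note f = frm[OF 1(2)]
        have t: "t \<le> K * 30 + 10" using 1(1) lenL by simp
        have kk3: "nmem s3 ''kk'' = ?kk" by (simp add: s3_def s2_def)
        have cl: "nmem s4 ''cl'' 0 = length L" and kk4: "nmem s4 ''kk'' = ?kk'"
          using 1(1) unfolding kk3 by (simp_all add: s3_def)
        have e: "nmem s4 ''v'' 0 = v" "nmem s4 ''d'' v = card (Ch v)" "nmem s4 ''kn'' 0 = ?kn"
          "nmem s4 ''id'' 0 = ?m + 1" "nmem s4 ''my'' 0 = ?m" "nmem s4 ''df'' = ?df(v := ?m)"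
          "nmem s4 ''block'' = (nmem s ''block'')(?kn + v := ?m)"
          "nmem s4 ''sparent'' = (nmem s ''sparent'')(?kn + ?m := ?blk (p v))"
          using v(1) par by (simp_all add: f s3_def s2_def)
        show ?case
        proof (cases "length L < card (Ch v)")
          case True
          have exc: "\<exists>c\<in>Ch v. ?kk' c = 0" using ex True by blast
          have l2: "lab ?kk' {v} = {(v, False), (v, True)}"
            using k2 exc kv unfolding lab_def by auto
          have "numbered k (insert v Z) ?kk' ?blk (?df(v := ?m + 1))
              ((sp_of s)(?m := ?blk (p v), ?m + 1 := ?m)) (?m + 2)"
          proof (rule numbered_step[OF st v(2-4) kN kF])
            show "local_ok ?kk' ?blk (?df(v := ?m + 1)) ((sp_of s)(?m := ?blk (p v), ?m + 1 := ?m)) v"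
              unfolding local_ok_def kv using pl k2 by simp
          qed (auto simp: l2 lid_def)
          moreover define s5 where "s5 = nupd ''id'' 0 (?m + 2) (nupd ''df'' v (?m + 1) (nupd ''sparent'' (?kn + (?m + 1)) ?m s4))"
          moreover have b5: "blk_of s5 = ?blk" "sp_of s5 = (sp_of s)(?m := ?blk (p v), ?m + 1 := ?m)"
            by (rule ext, simp add: s5_def e)+
          ultimately have "num_state k (insert v Z) s5" unfolding b5 by (simp add: s5_def e kk4)
          moreover have "low_same s s5" by (simp add: s5_def e low_same_def)
          moreover have "wp (NSet ''sparent'' (NAdd (N ''kn'') (N ''id'')) (N ''my'') ;; NSet ''df'' (N ''v'') (N ''id'') ;;
             NLet ''id'' (NAdd (N ''id'') (NConst 1))) s4 Q" if "\<And>t. t \<le> 30 \<Longrightarrow> Q t s5" for Q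
            using that e by (simp add: wp_simps s5_def)
          ultimately show ?thesis using t e cl True by (simp add: wp_If)
        next
          case False
          have exc: "\<not> (\<exists>c\<in>Ch v. ?kk' c = 0)" using ex False by blast
          have l2: "lab ?kk' {v} = {(v, False)}"
            using k2 exc kv unfolding lab_def by auto
          have "numbered k (insert v Z) ?kk' ?blk (?df(v := ?m)) ((sp_of s)(?m := ?blk (p v))) (?m + 1)"
          proof (rule numbered_step[OF st v(2-4) kN kF])
            show "local_ok ?kk' ?blk (?df(v := ?m)) ((sp_of s)(?m := ?blk (p v))) v"
              unfolding local_ok_def kv using pl k2 by simp (use exc in blast)
          qed (auto simp: l2 lid_def)
          moreover have b4: "blk_of s4 = ?blk" "sp_of s4 = (sp_of s)(?m := ?blk (p v))"
            by (rule ext, simp add: e)+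
          ultimately have "num_state k (insert v Z) s4" unfolding b4 by (simp add: e kk4)
          moreover have "low_same s s4" by (simp add: e low_same_def)
          ultimately show ?thesis using t e cl False by (simp add: wp_If wp_Skip)
        qed
      qed
      have b2: "bval (NLess (NConst 1) (NGet ''kk'' (N ''v''))) s2" using k2 v(1) by (simp add: s2_def)
      show ?thesis
        unfolding wp_If[of "NLess (NConst 0) _"] if_P[OF bval] wp_Seq
      proof (rule nb)
        fix t :: nat assume "t \<le> 40"
        then show "wp (If (NLess (NConst 1) (NGet ''kk'' (N ''v''))) expand_block Skip) s2
          (\<lambda>t2 s'. bcost (NLess (NConst 0) (NGet ''kk'' (N ''v''))) + (t + t2) \<le> (K + 5) * 40 \<and>
            num_state k (insert v Z) s' \<and> low_same s s')"
          unfolding wp_If if_P[OF b2] by (intro wp_conseq[OF exb]) simp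
      qed
    qed
  qed
qed

end

section \<open>Correctness and running time of the whole program\<close>

definition "summary_program = init ;; degrees ;; leaves ;; order ;; bottom_up ;; decode_all"

context weighted_tree
begin

lemma wp_dec_loop:
  assumes env: "env s" and q: "good_order (nmem s ''q'')"
    and rows: "\<And>v. v < n \<Longrightarrow> rowrep (heap s) (nmem s ''BP'') (rmem s ''BV'') v"
    and k: "1 \<le> k" and st: "num_state k {} s"
  shows "wp (For ''i'' (N ''n'') dec_cell) s (\<lambda>t s'. t \<le> (n + 1) * ((K + 5) * 40 + 10 + 2 + 9) \<and>
    nmem s' ''i'' 0 = n \<and> (num_state k {..<n} s' \<and> low_same s s'))"
proof -
  let ?q = "nmem s ''q''"
  let ?Z = "\<lambda>i. ?q ` {n - i..<n}"
  have bij: "bij_betw ?q {..<n} {..<n}" and pre: "\<And>i. i < n \<Longrightarrow> Ch (?q i) \<subseteq> ?q ` {..<i}"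
    using q by (auto simp: good_order_def)
  note inj = bij_betw_imp_inj_on[OF bij]
  have surj: "?q ` {..<n} = {..<n}" using bij_betw_imp_surj_on[OF bij] .
  have n: "nmem s ''n'' 0 = n" using env by (simp add: env_def)
  have "wp (For ''i'' (N ''n'') dec_cell) s (\<lambda>t s'. t \<le> (n + 1) * ((K + 5) * 40 + 10 + ncost (N ''n'') + 9) \<and>
    nmem s' ''i'' 0 = n \<and> (num_state k (?Z n) s' \<and> low_same s s'))"
  proof (rule wp_For_const[where I = "\<lambda>i s'. num_state k (?Z i) s' \<and> low_same s s'"], goal_cases)
    case 2
    then show ?case using st by (simp add: low_same_def)
  next
    case (3 i s')
    then show ?case using n by (simp add: frm)
  next
    case (4 i s')
    note f = frm[OF 4(3)]
    have fi: "frm (insert ''i'' (nw dec_cell)) (rw dec_cell) s s'" using 4(3) .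
    have env': "env s'" by (rule env_frm[OF env fi]) auto
    let ?v = "?q (n - 1 - i)"
    define s1 where "s1 = nupd ''v'' 0 ?v s'"
    have set_v: "wp (NLet ''v'' (NGet ''q'' (NSub (NSub (N ''n'') (NConst 1)) (N ''i'')))) s' Q = Q 10 s1" for Q
      using 4(2) n by (simp add: wp_simps s1_def f numeral_eq_Suc)
    have vn: "?v < n" using surj 4(1) by auto
    have Z: "?Z (Suc i) = insert ?v (?Z i)"
    proof -
      have "{n - Suc i..<n} = insert (n - 1 - i) {n - i..<n}" using 4(1) by auto
      then show ?thesis by simp
    qed
    have vZ: "?v \<notin> ?Z i"
    proof
      assume "?v \<in> ?Z i"
      then obtain j where j: "n - i \<le> j" "j < n" "?q (n - 1 - i) = ?q j" by auto
      from inj_onD[OF inj j(3)] j(1,2) 4(1) show False by auto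
    qed
    \<comment> \<open>A good order puts v before its parent, so in the backward pass the parent has
      already been treated.\<close>
    have pZ: "?v = rt \<or> p ?v \<in> ?Z i"
    proof (cases "?v = rt")
      case False
      have "p ?v \<in> ?q ` {..<n}" unfolding surj using p_less[OF vn] by simp
      then obtain j where j: "j < n" "p ?v = ?q j" by auto
      have "?v \<in> ?q ` {..<j}" using in_Ch_p[OF vn False] pre[OF j(1)] unfolding j(2) by blast
      then obtain j' where j': "j' < j" "?q (n - 1 - i) = ?q j'" by auto
      from inj_onD[OF inj j'(2)] j'(1) j(1) 4(1) have "n - i \<le> j" by auto
      then show ?thesis using j by auto
    qed simp
    have h: "hext s s1" by (simp add: hext_def s1_def f)
    have row: "rowrep (heap s1) (nmem s1 ''BP'') (rmem s1 ''BV'') ?v"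
      using rows[OF vn] by (simp add: s1_def f)
    have env1: "env s1" using env' by (simp add: s1_def env_def)
    have st1: "num_state k (?Z i) s1" using 4(4) by (simp add: s1_def)
    have low1: "low_same s s1" using 4(4) by (simp add: s1_def low_same_def)
    have kn1: "nmem s1 ''kn'' 0 = nmem s ''kn'' 0" by (simp add: s1_def f)
    show ?case
      unfolding dec_cell_def wp_Seq[of "NLet _ _"] set_v
    proof (rule wp_conseq[OF wp_dec_body[OF env1 _ vn vZ pZ row st1 k]], goal_cases)
      case (2 t s2)
      then have P: "t \<le> (K + 5) * 40" "num_state k (?Z (Suc i)) s2" "low_same s1 s2"
        unfolding Z by blast+
      have "low_same s s2" using P(3) low1 kn1 by (simp add: low_same_def)
      then show ?case using P by (simp add: low_same_def)
    qed (simp add: s1_def)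
  qed simp
  moreover have "?Z n = {..<n}" using surj by (simp add: lessThan_atLeast0)
  ultimately show ?thesis by simp
qed

text \<open>Stated for functions instead of states, so that a finished row can be carried along by
  \<open>coded_cong\<close> while later rows are written.\<close>

definition "coded f g k \<longleftrightarrow> (\<exists>S M. summary_tree T S \<and> num_nodes S = k \<and> tree_value W w S = best rt k \<and>
  parent_array k g M \<and> S = map_rtree (\<lambda>j. {v. v < n \<and> f v = j}) M)"

text \<open>Once all nodes are treated, the local conditions are the assumptions of locale
  \<open>numbering\<close>, and \<open>decode\<close> applies.\<close>

lemma numbered_coded:
  assumes "numbered k {..<n} kk blk df sp m" "1 \<le> k"
  shows "coded blk sp k"
proof -
  note num = assms(1)[unfolded numbered_def]
  from num have kk: "kk rt = k" by (elim conjE)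
  from num have inj: "inj_on (lid blk df) (lab kk {..<n})" by (elim conjE)
  from num have im: "lid blk df ` lab kk {..<n} = {..<m}" by (elim conjE)
  from num have "\<forall>v\<in>{..<n}. local_ok kk blk df sp v" by (elim conjE)
  then have loc: "local_ok kk blk df sp v" if "v < n" for v using that by simp
  interpret nb: numbering n K T w p kk blk df sp
  proof
    fix v assume v: "v < n"
    note l = loc[OF v, unfolded local_ok_def plan_def]
    from l have l0: "kk v = 0 \<longrightarrow> blk v = df (p v) \<and> df v = blk v" by (elim conjE)
    from l have l1: "kk v \<le> 1 \<longrightarrow> (\<forall>c\<in>Ch v. kk c = 0)" by (elim conjE)
    from l have l2: "kk v = 1 \<longrightarrow> df v = blk v" by (elim conjE)
    from l have l3: "2 \<le> kk v \<longrightarrow> (\<exists>L. (valid v L \<and> psize v L = kk v \<and> pval v L = best v (kk v)) \<and>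
      (\<forall>c\<in>Ch v. kk c = alloc L c))" by (elim conjE)
    from l have l4: "1 \<le> kk v \<longrightarrow> sp (blk v) = blk (p v)" by (elim conjE)
    from l have l5: "2 \<le> kk v \<and> (\<exists>c\<in>Ch v. kk c = 0) \<longrightarrow> sp (df v) = blk v" by (elim conjE)
    show "blk v = df (p v) \<and> df v = blk v" if "kk v = 0" using l0 that by (rule mp)
    show "kk c = 0" if "kk v \<le> 1" "c \<in> Ch v" for c using mp[OF l1 that(1)] that(2) by (rule bspec)
    show "df v = blk v" if "kk v = 1" using l2 that by (rule mp)
    show "\<exists>L. valid v L \<and> psize v L = kk v \<and> pval v L = best v (kk v) \<and> (\<forall>c\<in>Ch v. kk c = alloc L c)"
      if "2 \<le> kk v" using mp[OF l3 that] by (simp only: conj_assoc)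
    show "sp (blk v) = blk (p v)" if "1 \<le> kk v" using l4 that by (rule mp)
    show "sp (df v) = blk v" if "2 \<le> kk v" "\<exists>c\<in>Ch v. kk c = 0" using l5 conjI[OF that] by (rule mp)
  qed
  have lab: "nb.labels = lab kk {..<n}" by (auto simp: nb.labels_def lab_def)
  have lid: "nb.label_id = lid blk df" by (rule ext) (auto simp: lid_def)
  have "1 \<le> kk rt" using kk assms(2) by simp
  from nb.decode[OF inj[folded lab lid] im[folded lab lid] this] show ?thesis
    unfolding kk coded_def by blast
qed

lemma wp_dec_k:
  assumes env: "env s" and q: "good_order (nmem s ''q'')" and r: "nmem s ''r'' 0 = rt"
    and rows: "\<And>v. v < n \<Longrightarrow> rowrep (heap s) (nmem s ''BP'') (rmem s ''BV'') v"
    and k: "nmem s ''k'' 0 = k" "1 \<le> k" "k \<le> K" "k \<le> n"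
  shows "wp dec_k s (\<lambda>t s'. t \<le> (n + 1) * (400 * K) \<and> low_same s s' \<and> coded (blk_of s') (sp_of s') k \<and>
    rmem s' ''entropy'' = (rmem s ''entropy'')(k := best rt k))"
proof -
  have n: "nmem s ''n'' 0 = n" using env by (simp add: env_def)
  have clr: "wp (For ''v'' (N ''n'') (NSet ''kk'' (N ''v'') (NConst 0))) s
    (\<lambda>t s'. t \<le> (n + 1) * (4 + ncost (N ''n'') + 9) \<and> nmem s' ''v'' 0 = n \<and> (\<forall>v<n. nmem s' ''kk'' v = 0))"
  proof (rule wp_For_const[where I = "\<lambda>i s'. \<forall>v<i. nmem s' ''kk'' v = 0"], goal_cases)
    case (3 i s')
    then show ?case using n by (simp add: frm)
  next
    case (4 i s')
    then show ?case by (simp add: wp_simps less_Suc_eq)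
  qed simp_all
  show ?thesis
    unfolding dec_k_def wp_Seq
  proof (rule wp_conseq[OF clr], goal_cases)
    case (1 t1 s1)
    note f = frm[OF 1(2)]
    define s2 where "s2 = nupd ''id'' 0 0 (nupd ''kk'' rt k s1)"
    have blk: "wp (NSet ''kk'' (N ''r'') (N ''k'')) s1 (\<lambda>t2 s. wp (NLet ''id'' (NConst 0)) s (\<lambda>t3 s. Q t2 t3 s)) = Q 5 3 s2" for Q
      using r k by (simp add: wp_simps s2_def f numeral_eq_Suc)
    have env2: "env s2" using env by (simp add: env_def s2_def f)
    have q2: "good_order (nmem s2 ''q'')" using q by (simp add: s2_def f)
    have rows2: "rowrep (heap s2) (nmem s2 ''BP'') (rmem s2 ''BV'') v" if "v < n" for v
      using rows[OF that] by (simp add: s2_def f)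
    have kk1: "\<forall>v<n. nmem s1 ''kk'' v = 0" using 1(1) by blast
    have "feas rt k" using feas_le_sz[OF rt_less k(2)] k(4) sz_rt by simp
    then have "num_state k {} s2"
      unfolding numbered_def using kk1 rt_less k(3) by (auto simp: lab_def s2_def)
    note loop = wp_dec_loop[OF env2 q2 rows2 k(2) this]
    show ?case
      unfolding blk
    proof (rule wp_conseq[OF loop], goal_cases)
      case (2 t4 s4)
      then have P: "t4 \<le> (n + 1) * ((K + 5) * 40 + 10 + 2 + 9)" "num_state k {..<n} s4" "low_same s2 s4" by blast+
      note f4 = frm[OF 2(2)]
      have "low_same s s4" using P(3) by (simp add: low_same_def s2_def f)
      moreover have c: "coded (blk_of s4) (sp_of s4) k" using numbered_coded[OF P(2) k(2)] .
      moreover have e: "nmem s4 ''k'' 0 = k" "nmem s4 ''r'' 0 = rt" "nmem s4 ''bs'' rt = base rt"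
        "rmem s4 ''entropy'' = rmem s ''entropy''" "rmem s4 ''BV'' (base rt + k) = best rt k"
      proof -
        have "nmem s ''BP'' (base rt + k) \<noteq> 0 \<and> rmem s ''BV'' (base rt + k) = best rt k"
          using rows[OF rt_less] k(3) \<open>feas rt k\<close> unfolding rowrep_def by blast
        then show "rmem s4 ''BV'' (base rt + k) = best rt k" by (simp add: f4 s2_def f)
      qed (use k r env rt_less in \<open>simp_all add: f4 s2_def f env_def\<close>)
      moreover have "t1 + (5 + (3 + (t4 + 10))) \<le> (n + 1) * (400 * K)"
      proof -
        have "t1 \<le> (n + 1) * 15" using \<open>t1 \<le> _ \<and> _\<close> by simp
        moreover have "(n + 1) * ((K + 5) * 40 + 10 + 2 + 9) + (n + 1) * 15 + (n + 1) * 18 =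
          (n + 1) * ((K + 5) * 40 + 54)" by (simp add: algebra_simps)
        moreover have "(n + 1) * ((K + 5) * 40 + 54) \<le> (n + 1) * (400 * K)"
          using K_pos by (intro mult_le_mono) simp_all
        moreover have "18 \<le> (n + 1) * 18" by simp
        ultimately show ?thesis using P(1) by linarith
      qed
      ultimately show ?case by (simp add: wp_simps low_same_def)
    qed simp
  qed
qed

definition "result s k \<longleftrightarrow> coded (\<lambda>v. nmem s ''block'' (k * n + v)) (\<lambda>j. nmem s ''sparent'' (k * n + j)) k \<and>
  rmem s ''entropy'' k = best rt k"

lemma coded_cong:
  assumes "coded f g k" "\<And>v. v < n \<Longrightarrow> f' v = f v" "\<And>j. j < k \<Longrightarrow> g' j = g j"
  shows "coded f' g' k"
proof -
  have eq: "(\<lambda>j. {v. v < n \<and> f v = j}) = (\<lambda>j. {v. v < n \<and> f' v = j})" using assms(2) by auto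
  from assms(1) obtain S M where S: "summary_tree T S" "num_nodes S = k" "tree_value W w S = best rt k"
    "parent_array k g M" "S = map_rtree (\<lambda>j. {v. v < n \<and> f v = j}) M"
    unfolding coded_def by blast
  have "parent_array k g' M" using S(4) assms(3) by (rule parent_array_cong)
  then show ?thesis
    unfolding coded_def using S(1-3) S(5)[unfolded eq] by (intro exI[of _ S] exI[of _ M] conjI)
qed

lemma wp_decode_all:
  assumes env: "env s" and q: "good_order (nmem s ''q'')" and r: "nmem s ''r'' 0 = rt"
    and rows: "\<And>v. v < n \<Longrightarrow> rowrep (heap s) (nmem s ''BP'') (rmem s ''BV'') v"
  shows "wp decode_all s (\<lambda>t s'. t \<le> 1700 * K\<^sup>2 * n \<and> (\<forall>k. 1 \<le> k \<and> k \<le> min K n \<longrightarrow> result s' k))"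
proof -
  let ?e = "NSub (N ''K'') (NSub (N ''K'') (N ''n''))"
  define s0 where "s0 = nupd ''kn'' 0 0 s"
  have loop: "wp (For ''k0'' ?e decode_cell) s0
    (\<lambda>t s'. t \<le> (min K n + 1) * ((n + 1) * (400 * K) + 20 + ncost ?e + 9) \<and> nmem s' ''k0'' 0 = min K n \<and>
      (nmem s' ''kn'' 0 = min K n * n \<and> (\<forall>k. 1 \<le> k \<and> k \<le> min K n \<longrightarrow> result s' k)))"
  proof (rule wp_For_const[where I = "\<lambda>i s'. nmem s' ''kn'' 0 = i * n \<and> (\<forall>k. 1 \<le> k \<and> k \<le> i \<longrightarrow> result s' k)"], goal_cases)
    case 2
    then show ?case by (simp add: s0_def)
  next
    case (3 i s')
    then show ?case using env by (simp add: frm s0_def env_def min_def)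
  next
    case (4 i s')
    note f = frm[OF 4(3)]
    define s1 where "s1 = nupd ''kn'' 0 (Suc i * n) (nupd ''k'' 0 (Suc i) s')"
    have blk: "wp (NLet ''k'' (NAdd (N ''k0'') (NConst 1))) s' (\<lambda>t1 s. wp (NLet ''kn'' (NAdd (N ''kn'') (N ''n''))) s (\<lambda>t2 s. Q t1 t2 s))
        = Q 6 7 s1" for Q
      using 4(2,4) env by (simp add: wp_simps s1_def f s0_def env_def numeral_eq_Suc add.commute)
    have d: "wp dec_k s1 (\<lambda>t s'. t \<le> (n + 1) * (400 * K) \<and> low_same s1 s' \<and> coded (blk_of s') (sp_of s') (Suc i) \<and>
      rmem s' ''entropy'' = (rmem s1 ''entropy'')(Suc i := best rt (Suc i)))"
      by (rule wp_dec_k)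
        (use env q r rows 4(1) in \<open>simp_all add: s1_def f s0_def env_def\<close>)
    show ?case
      unfolding decode_cell_def wp_Seq blk
    proof (rule wp_conseq[OF d], goal_cases)
      case (1 t s2)
      then have P: "t \<le> (n + 1) * (400 * K)" "low_same s1 s2" "coded (blk_of s2) (sp_of s2) (Suc i)"
        "rmem s2 ''entropy'' = (rmem s' ''entropy'')(Suc i := best rt (Suc i))"
        by (simp_all add: s1_def)
      have kn: "nmem s2 ''kn'' 0 = Suc i * n" using frm[OF 1(2)] by (simp add: s1_def)
      have new: "result s2 (Suc i)" using P(3,4) unfolding result_def kn by simp
      have old: "result s2 k" if k: "1 \<le> k" "k \<le> i" for k
      proof -
        have R: "result s' k" using 4(4) k by blast
        \<comment> \<open>Row k ends before \<open>Suc k * n\<close>, hence before the offset of the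
          row being written.\<close>
        have low: "k * n + j < nmem s1 ''kn'' 0" if "j < n" for j
        proof -
          have "k * n + j < Suc k * n" using that by simp
          also have "\<dots> \<le> Suc i * n" using k by (intro mult_le_mono) simp_all
          finally show ?thesis by (simp add: s1_def)
        qed
        have same: "nmem s2 ''block'' (k * n + j) = nmem s' ''block'' (k * n + j)"
          "nmem s2 ''sparent'' (k * n + j) = nmem s' ''sparent'' (k * n + j)" if "j < n" for j
          using P(2) low[OF that] unfolding low_same_def by (simp_all add: s1_def)
        have "coded (\<lambda>v. nmem s2 ''block'' (k * n + v)) (\<lambda>j. nmem s2 ''sparent'' (k * n + j)) k"
          using R[unfolded result_def, THEN conjunct1]
          by (rule coded_cong) (use same k 4(1) in simp_all)
        then show ?thesis using R P(4) k by (simp add: result_def)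
      qed
      have "result s2 k" if "1 \<le> k" "k \<le> Suc i" for k
        using new old[of k] that by (cases "k = Suc i") auto
      then show ?case using P(1) kn by (simp add: result_def)
    qed
  qed simp
  have blk: "wp (NLet ''kn'' (NConst 0)) s Q = Q 3 s0" for Q by (simp add: wp_simps s0_def numeral_eq_Suc)
  show ?thesis
    unfolding decode_all_def wp_Seq blk
  proof (rule wp_conseq[OF loop], goal_cases)
    case (1 t s')
    have "t \<le> (min K n + 1) * ((n + 1) * (400 * K) + 37)" using 1(1) by (simp add: algebra_simps)
    also have "\<dots> \<le> (2 * K) * ((2 * n) * (400 * K) + 37)"
    proof (rule mult_le_mono)
      show "min K n + 1 \<le> 2 * K" using K_pos by simp
      have "(n + 1) * (400 * K) \<le> (2 * n) * (400 * K)" using n_pos by (intro mult_le_mono) simp_all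
      then show "(n + 1) * (400 * K) + 37 \<le> (2 * n) * (400 * K) + 37" by simp
    qed
    also have "\<dots> = 1600 * (K\<^sup>2 * n) + 74 * K" by (simp add: algebra_simps power2_eq_square)
    finally have "t \<le> 1600 * (K\<^sup>2 * n) + 74 * K" .
    moreover have "K \<le> K\<^sup>2 * n" "1 \<le> K\<^sup>2 * n" using K_pos n_pos by (simp_all add: power2_eq_square)
    ultimately have "3 + t \<le> 1700 * (K\<^sup>2 * n)" by linarith
    then show ?case using 1(1) by simp
  qed
qed

lemma wp_summary_program:
  assumes s: "nmem s ''n'' 0 = n" "nmem s ''K'' 0 = K" "\<forall>v<n. nmem s ''parent'' v = p v"
    "\<forall>v<n. rmem s ''weight'' v = w v"
  shows "wp summary_program s (\<lambda>t s'. t \<le> 40000 * K\<^sup>2 * n \<and> (\<forall>k. 1 \<le> k \<and> k \<le> min K n \<longrightarrow> result s' k))"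
  unfolding summary_program_def wp_Seq
proof (rule wp_conseq[OF wp_init[OF s]], goal_cases)
  case (1 t1 s1)
  then have A: "t1 \<le> (n + 1) * 150 + 20" "nmem s1 ''hp'' 0 = 2" "nmem s1 ''r'' 0 = rt" "rmem s1 ''W'' 0 = W"
    "\<And>v. v < n \<Longrightarrow> nmem s1 ''sz'' v = 1 \<and> nmem s1 ''d'' v = 0 \<and> nmem s1 ''ln'' v = 0 \<and>
      nmem s1 ''bs'' v = base v \<and> rmem s1 ''tw'' v = w v" by blast+
  note f1 = frm[OF 1(2)]
  have deg: "wp degrees s1 (\<lambda>t s'. t \<le> (n + 1) * 100 \<and> (\<forall>v<n. nmem s' ''d'' v = card (Ch v)))"
    by (rule wp_degrees) (use s A in \<open>simp_all add: f1\<close>)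
  show ?case
  proof (rule wp_conseq[OF deg], goal_cases)
    case (1 t2 s2)
    note f2 = frm[OF 1(2)]
    have t2: "t2 \<le> (n + 1) * 100" using 1(1) by blast
    have lv: "wp leaves s2 (\<lambda>t s'. t \<le> (n + 1) * 100 + 3 \<and> (\<forall>v<n. nmem s' ''cnt'' v = card (Ch v)) \<and>
        inj_on (nmem s' ''q'') {..<nmem s' ''tl'' 0} \<and>
        nmem s' ''q'' ` {..<nmem s' ''tl'' 0} = {v. v < n \<and> Ch v = {}})"
      by (rule wp_leaves) (use s 1(1) in \<open>simp_all add: f1 f2\<close>)
    have d2: "\<forall>v<n. nmem s2 ''d'' v = card (Ch v)" using 1(1) by blast
    show ?case
    proof (rule wp_conseq[OF lv], goal_cases)
      case (1 t3 s3)
      note f3 = frm[OF 1(2)]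
      have t3: "t3 \<le> (n + 1) * 100 + 3" using 1(1) by blast
      have ord: "wp order s3 (\<lambda>t s'. t \<le> (n + 1) * 100 \<and> good_order (nmem s' ''q''))"
        by (rule wp_order) (use s 1(1) in \<open>simp_all add: f1 f2 f3\<close>)
      show ?case
      proof (rule wp_conseq[OF ord], goal_cases)
        case (1 t4 s4)
        note f4 = frm[OF 1(2)]
        have t4: "t4 \<le> (n + 1) * 100" and q4: "good_order (nmem s4 ''q'')" using 1(1) by blast+
        have env4: "env s4"
          using s A d2 by (simp add: env_def f1 f2 f3 f4)
        have e: "heaviest {} []" by (simp add: heaviest_def)
        have st4: "bust s4 {}"
          using A(2,5) e by (simp add: bust_def f2 f3 f4)
        show ?case
        proof (rule wp_conseq[OF wp_bottom_up[OF env4 st4 q4]], goal_cases)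
          case (1 t5 s5)
          note f5 = frm[OF 1(2)]
          have t5: "t5 \<le> 30000 * K\<^sup>2 * n" and env5: "env s5" and st5: "bust s5 {..<n}" using 1(1) by blast+
          have q5: "good_order (nmem s5 ''q'')" using q4 by (simp add: f5 bottom_up_def)
          have r5: "nmem s5 ''r'' 0 = rt" using A(3) by (simp add: f2 f3 f4 f5 bottom_up_def)
          have rows5: "rowrep (heap s5) (nmem s5 ''BP'') (rmem s5 ''BV'') v" if "v < n" for v
            using st5 that by (simp add: bust_def)
          show ?case
          proof (rule wp_conseq[OF wp_decode_all[OF env5 q5 r5 rows5]], goal_cases)
            case (2 t6 s6)
            have t6: "t6 \<le> 1700 * K\<^sup>2 * n" using 2(1) by blast
            have m: "n \<le> K\<^sup>2 * n" "1 \<le> n" using K_pos n_pos by simp_all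
            have "t1 + (t2 + (t3 + (t4 + (t5 + t6)))) \<le> 450 * n + 473 + 31700 * (K\<^sup>2 * n)"
              using A(1) t2 t3 t4 t5 t6 by (simp add: algebra_simps)
            then have "t1 + (t2 + (t3 + (t4 + (t5 + t6)))) \<le> 40000 * (K\<^sup>2 * n)" using m by linarith
            then show ?case using 2(1) by simp
          qed
        qed
      qed
    qed
  qed
qed

lemma result_correct:
  assumes "result s k"
  shows "\<exists>S. max_entropy_summary_tree w T k S \<and> output_tree n k S s \<and> rmem s ''entropy'' k = entropy w T S"
proof -
  from assms obtain S M where S: "summary_tree T S" "num_nodes S = k" "tree_value W w S = best rt k"
    "parent_array k (\<lambda>j. nmem s ''sparent'' (k * n + j)) M"
    "S = map_rtree (\<lambda>j. {v. v < n \<and> nmem s ''block'' (k * n + v) = j}) M" "rmem s ''entropy'' k = best rt k"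
    unfolding result_def coded_def by blast
  have ent: "entropy w T S' = tree_value W w S'" for S' by (simp add: entropy_eq_tree_value W_def)
  have "tree_value W w S' \<le> best rt k" if "summary_tree T S'" "num_nodes S' = k" for S'
    using that by (intro achv_le_best[OF rt_less]) (auto simp: achv_def achieves_def st_rt)
  then have "max_entropy_summary_tree w T k S"
    using S(1-3) unfolding max_entropy_summary_tree_def is_arg_max_def ent by (auto simp: not_less)
  moreover have "output_tree n k S s" using S(4,5) unfolding output_tree_def by blast
  ultimately show ?thesis using S(3,6) ent by auto
qed

end

theorem theorem3:
  "\<exists>(prog :: com) (c :: real).
     \<forall>(n :: nat) (T :: nat rtree) (w :: nat \<Rightarrow> real) (K :: nat) (s :: state).
       (\<forall>v\<in>nodes T. w v \<ge> 0) \<longrightarrow> sum w (nodes T) > 0 \<longrightarrow> K \<ge> 1 \<longrightarrow> input n T w K s \<longrightarrow>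
       (\<exists>t s'. exec prog s t s' \<and>
          real t \<le> c * (real K ^ 2 * real n + real n * log 2 (real n)) \<and>
          (\<forall>k. 1 \<le> k \<and> k \<le> min K n \<longrightarrow>
             (\<exists>S. max_entropy_summary_tree w T k S \<and>
                output_tree n k S s' \<and> rmem s' ''entropy'' k = entropy w T S)))"
proof (rule exI[of _ summary_program], rule exI[of _ "40000 :: real"], intro allI impI)
  fix n :: nat and T :: "nat rtree" and w :: "nat \<Rightarrow> real" and K :: nat and s :: state
  assume w: "\<forall>v\<in>nodes T. 0 \<le> w v" "0 < sum w (nodes T)" "1 \<le> K" and inp: "input n T w K s"
  interpret weighted_tree n K T w "nmem s ''parent''"
    by unfold_locales (use w inp in \<open>auto simp: input_def\<close>)
  have "wp summary_program s (\<lambda>t s'. t \<le> 40000 * K\<^sup>2 * n \<and> (\<forall>k. 1 \<le> k \<and> k \<le> min K n \<longrightarrow> result s' k))"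
    by (rule wp_summary_program) (use inp in \<open>simp_all add: input_def\<close>)
  then obtain t s' where t: "exec summary_program s t s'" "t \<le> 40000 * K\<^sup>2 * n"
    "\<And>k. 1 \<le> k \<Longrightarrow> k \<le> min K n \<Longrightarrow> result s' k"
    unfolding wp_def by blast
  have "real t \<le> real (40000 * K\<^sup>2 * n)" using t(2) of_nat_mono by blast
  also have "\<dots> = 40000 * (real K ^ 2 * real n)" by simp
  \<comment> \<open>The added summand is nonnegative because n is at least 1.\<close>
  also have "\<dots> \<le> 40000 * (real K ^ 2 * real n + real n * log 2 (real n))"
    using n_pos by simp
  finally show "\<exists>t s'. exec summary_program s t s' \<and>
      real t \<le> 40000 * (real K ^ 2 * real n + real n * log 2 (real n)) \<and>
      (\<forall>k. 1 \<le> k \<and> k \<le> min K n \<longrightarrow> (\<exists>S. max_entropy_summary_tree w T k S \<and>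
         output_tree n k S s' \<and> rmem s' ''entropy'' k = entropy w T S))"
    using t(1,3) result_correct by blast
qed

end
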